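(* For each $j\in\mathbb{N}\cup\{\infty\}$ let $(g_j,R_j,P_j,S_j)$ be an admissible quadruple for the differential problem in $\mathbb{R}^n$ on $[a,b]$. Assume that $(g_j,R_j,P_j,S_j)$ tends to $(g_\infty,R_\infty,P_\infty,S_\infty)$ as $j\to\infty$ in the following sense: (1) $\dim(P_j)=k$ for all $j=1,\ldots,\infty$; (2) $(P_j,S_j)\to(P_\infty,S_\infty)$ in $\mathrm{GB}_k(n,\mathbb{R})$ as $j\to\infty$; (3) $g_j\to g_\infty$ in $\mathrm{B}_{\rm sym}(\mathbb{R}^n,\mathbb{R})$ as $j\to\infty$; (4) $R_j\to R_\infty$ uniformly on $[a,b]$ as $j\to\infty$. If $t_0=b$ is not $(P_\infty,S_\infty)$-focal for $(g_\infty,R_\infty,P_\infty,S_\infty)$, then, for $j\in\mathbb{N}$ sufficiently large, $t_0=b$ is not $(P_j,S_j)$-focal for $(g_j,R_j,P_j,S_j)$, and $\mu(g_j,R_j,P_j,S_j)=\mu(g_\infty,R_\infty,P_\infty,S_\infty)$.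
   Context: **Quadruples.** An admissible quadruple for the differential problem in $\mathbb{R}^n$ (on $[a,b]$) is $(g,R,P,S)$ where: $g$ is a nondegenerate symmetric bilinear form on $\mathbb{R}^n$; $R:[a,b]\to\mathcal L(\mathbb{R}^n,\mathbb{R}^n)$ is continuous with each $R(t)$ $g$-symmetric; $P\subset\mathbb{R}^n$ is a subspace on which $g$ is nondegenerate; $S$ is a symmetric bilinear form on $P$, also regarded as the operator $S:P\to P$ with $S(v,w)=g(S[v],w)$. $(P,S)$-solutions are maps $J:[a,b]\to\mathbb{R}^n$ with $J''(t)=R(t)[J(t)]$, $J(a)\in P$, $J'(a)+S[J(a)]\in P^\perp$ ($\perp$ w.r.t. $g$). An instant $t_0\in\,]a,b]$ is $(P,S)$-focal (for the quadruple) if a nonzero $(P,S)$-solution vanishes at $t_0$. **Convergence.** $\mathrm{B}_{\rm sym}(Z,\mathbb{R})$ is the space of symmetric bilinear forms on $Z$. $\mathrm{GB}_k(n,\mathbb{R})$ is the set of pairs $(P,S)$ with $P\subset\mathbb{R}^n$ a $k$-dimensional subspace and $S\in\mathrm{B}_{\rm sym}(P,\mathbb{R})$, with its natural topology of a vector bundle over the Grassmannian. Explicitly, $(P_j,S_j)\to(P,S)$ iff for each $j$ there is a basis $e^j_1,\dots,e^j_k$ of $P_j$ with $e^j_i\to e_i$ for all $i$, where $e_1,\dots,e_k$ is a basis of $P$, and $S_j(e^j_\alpha,e^j_\beta)\to S(e_\alpha,e_\beta)$ for all $\alpha,\beta$. **Lagrangian Grassmannian and Maslov index.** For a $2n$-dimensional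 symplectic space $(V,\omega)$, $\Lambda$ is the manifold of Lagrangian subspaces. There is a canonical identification $T_L\Lambda\cong\mathrm{B}_{\rm sym}(L,\mathbb{R})$: choose a Lagrangian $L_1$ complementary to $L$; Lagrangians $W$ transverse to $L_1$ are graphs of unique linear $T:L\to L_1$, $W\mapsto\omega(T\cdot,\cdot)|_L$ is a chart, and its differential at $L$ is the identification (independent of $L_1$). For $L_0\in\Lambda$, $\Lambda_k(L_0)=\{L:\dim(L\cap L_0)=k\}$, $\Lambda_{\ge1}(L_0)=\bigcup_{i\ge1}\Lambda_i(L_0)$. A tangent vector $B$ at $L\in\Lambda_1(L_0)$ (a codimension one submanifold) is transverse iff nonzero on the line $L\cap L_0$, and positive if positive definite there. $\mu_{L_0}:H_1(\Lambda,\Lambda_0(L_0))\to\mathbb{Z}$ is the unique isomorphism with value $1$ on the class of any smooth curve with endpoints outside $\Lambda_{\ge1}(L_0)$ meeting $\Lambda_{\ge1}(L_0)$ only once, in $\Lambda_1(L_0)$, transversally with positive tangent vector. For a continuous curve $\ell$ with endpoints outside $\Lambda_{\ge1}(L_0)$, $\mu_{L_0}(\ell)$ is the value on its class; if $\{t\in\,]a,b[\,:\ell(t)\in\Lambda_{\ge1}(L_0)\}\subset[c,d]\subset\,]a,b[$, then $\mu_{L_0}(\ell):=\mu_{L_0}(\ell|_{[c,d]})$. For a quadruple $(g,R,P,S)$ put $\omega[(x_1,x_2),(y_1,y_2)]=g(x_1,y_2)-g(x_2,y_1)$ on $\mathbb{R}^{2n}$, $\Psi(t)[(J(a),J'(a))]=(J(t),J'(t))$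 for all solutions of $J''=RJ$, $\ell_0=\{(x,y):x\in P,\ y+S[x]\in P^\perp\}$, $L_0=\{0\}\oplus\mathbb{R}^n$, $\ell(t)=\Psi(t)[\ell_0]$. There are no $(P,S)$-focal instants near $a$; if $b$ is not $(P,S)$-focal, $\mu(g,R,P,S):=\mu_{L_0}(\ell)$. *)

theory Defs
  imports "HOL-Analysis.Analysis" "HOL-Homology.Homology"
begin

subsection \<open>Grassmannians and convergence of pairs (subspace, form)\<close>

definition is_frame :: "nat \<Rightarrow> (nat \<Rightarrow> 'v::euclidean_space) \<Rightarrow> 'v set \<Rightarrow> bool" where
  "is_frame k e W \<longleftrightarrow> inj_on e {..<k} \<and> independent (e ` {..<k}) \<and> span (e ` {..<k}) = W"

definition stiefel :: "nat \<Rightarrow> (nat \<Rightarrow> 'v::euclidean_space) set" where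
  "stiefel k = {e. is_frame k e (span (e ` {..<k}))}"

text \<open>
  The Grassmannian of \<open>k\<close>-dimensional subspaces carries the quotient topology of the Stiefel
  space of \<open>k\<close>-frames.  A frame is the restriction to indices below \<open>k\<close> of a
  sequence; the other entries of the sequence are irrelevant.
\<close>

definition grassmannian :: "nat \<Rightarrow> ('v::euclidean_space) set topology" where
  "grassmannian k = topology (\<lambda>U.
     U \<subseteq> {W. subspace W \<and> dim W = k} \<and>
     openin (top_of_set (stiefel k)) {e \<in> stiefel k. span (e ` {..<k}) \<in> U})"

lemma openin_grassmannian:
  "openin (grassmannian k) U \<longleftrightarrow>
     U \<subseteq> {W::'v::euclidean_space set. subspace W \<and> dim W = k} \<and>
     openin (top_of_set (stiefel k)) {e \<in> stiefel k. span (e ` {..<k}) \<in> U}"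
proof -
  have "istopology (\<lambda>U. U \<subseteq> {W::'v set. subspace W \<and> dim W = k} \<and>
     openin (top_of_set (stiefel k)) {e \<in> stiefel k. span (e ` {..<k}) \<in> U})"
    unfolding istopology_def
  proof (intro conjI allI impI)
    fix U V :: "'v set set"
    assume "U \<subseteq> {W. subspace W \<and> dim W = k} \<and>
       openin (top_of_set (stiefel k)) {e \<in> stiefel k. span (e ` {..<k}) \<in> U}"
      and "V \<subseteq> {W. subspace W \<and> dim W = k} \<and>
       openin (top_of_set (stiefel k)) {e \<in> stiefel k. span (e ` {..<k}) \<in> V}"
    moreover have "{e \<in> stiefel k. span (e ` {..<k}) \<in> U \<inter> V} =
       {e \<in> stiefel k. span (e ` {..<k}) \<in> U} \<inter> {e \<in> stiefel k. span (e ` {..<k}) \<in> V}"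
      by auto
    ultimately show "U \<inter> V \<subseteq> {W. subspace W \<and> dim W = k}"
      and "openin (top_of_set (stiefel k)) {e \<in> stiefel k. span (e ` {..<k}) \<in> U \<inter> V}"
      by (auto intro: openin_Int)
  next
    fix K :: "'v set set set"
    assume K: "\<forall>U\<in>K. U \<subseteq> {W. subspace W \<and> dim W = k} \<and>
       openin (top_of_set (stiefel k)) {e \<in> stiefel k. span (e ` {..<k}) \<in> U}"
    then show "\<Union>K \<subseteq> {W. subspace W \<and> dim W = k}" by blast
    have "{e \<in> stiefel k. span (e ` {..<k}) \<in> \<Union>K} =
       (\<Union>U\<in>K. {e \<in> stiefel k. span (e ` {..<k}) \<in> U})" by auto
    with K show "openin (top_of_set (stiefel k)) {e \<in> stiefel k. span (e ` {..<k}) \<in> \<Union>K}"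
      by auto
  qed
  then show ?thesis
    by (simp add: grassmannian_def topology_inverse')
qed

lemma topspace_grassmannian:
  "topspace (grassmannian k) = {W::'v::euclidean_space set. subspace W \<and> dim W = k}"
proof
  show "topspace (grassmannian k) \<subseteq> {W::'v set. subspace W \<and> dim W = k}"
    unfolding topspace_def openin_grassmannian by blast
  have "span (e ` {..<k}) \<in> {W::'v set. subspace W \<and> dim W = k}" if "e \<in> stiefel k" for e
    using that by (auto simp: stiefel_def is_frame_def dim_eq_card_independent card_image)
  then have "{e \<in> stiefel k. span (e ` {..<k}) \<in> {W::'v set. subspace W \<and> dim W = k}} = stiefel k"
    by blast
  then have "openin (grassmannian k) {W::'v set. subspace W \<and> dim W = k}"
    unfolding openin_grassmannian by auto
  then show "{W::'v set. subspace W \<and> dim W = k} \<subseteq> topspace (grassmannian k)"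
    by (rule openin_subset)
qed

definition sym_bilinear_on :: "'v::real_vector set \<Rightarrow> ('v \<Rightarrow> 'v \<Rightarrow> real) \<Rightarrow> bool" where
  "sym_bilinear_on P S \<longleftrightarrow>
     (\<forall>x\<in>P. \<forall>y\<in>P. S x y = S y x) \<and>
     (\<forall>x\<in>P. \<forall>y\<in>P. \<forall>z\<in>P. S (x + y) z = S x z + S y z) \<and>
     (\<forall>c. \<forall>x\<in>P. \<forall>y\<in>P. S (c *\<^sub>R x) y = c * S x y)"

text \<open>
  Sequential convergence in the vector bundle over the Grassmannian whose fibre over a
  \<open>k\<close>-dimensional subspace \<open>P\<close> is the space of symmetric bilinear forms on \<open>P\<close>.
  Only the values of a form on its subspace matter.
\<close>

definition GB_tendsto ::
  "nat \<Rightarrow> (nat \<Rightarrow> 'v::euclidean_space set) \<Rightarrow> (nat \<Rightarrow> 'v \<Rightarrow> 'v \<Rightarrow> real) \<Rightarrow>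
     'v set \<Rightarrow> ('v \<Rightarrow> 'v \<Rightarrow> real) \<Rightarrow> bool" where
  "GB_tendsto k P S P' S' \<longleftrightarrow>
     (\<exists>e e'. (\<forall>j. is_frame k (e j) (P j)) \<and> is_frame k e' P' \<and>
        (\<forall>i<k. (\<lambda>j. e j i) \<longlonglongrightarrow> e' i) \<and>
        (\<forall>\<alpha><k. \<forall>\<beta><k. (\<lambda>j. S j (e j \<alpha>) (e j \<beta>)) \<longlonglongrightarrow> S' (e' \<alpha>) (e' \<beta>)))"

subsection \<open>The Lagrangian Grassmannian\<close>

definition lagrangian :: "('v::euclidean_space \<Rightarrow> 'v \<Rightarrow> real) \<Rightarrow> 'v set \<Rightarrow> bool" where
  "lagrangian \<omega> L \<longleftrightarrow> subspace L \<and> 2 * dim L = DIM('v) \<and> (\<forall>x\<in>L. \<forall>y\<in>L. \<omega> x y = 0)"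

definition lagr_grassmannian :: "('v::euclidean_space \<Rightarrow> 'v \<Rightarrow> real) \<Rightarrow> 'v set topology" where
  "lagr_grassmannian \<omega> = subtopology (grassmannian (DIM('v) div 2)) (Collect (lagrangian \<omega>))"

definition lagr_stratum ::
  "('v::euclidean_space \<Rightarrow> 'v \<Rightarrow> real) \<Rightarrow> 'v set \<Rightarrow> nat \<Rightarrow> 'v set set" where
  "lagr_stratum \<omega> L\<^sub>0 k = {L. lagrangian \<omega> L \<and> dim (L \<inter> L\<^sub>0) = k}"

definition maslov_cycle ::
  "('v::euclidean_space \<Rightarrow> 'v \<Rightarrow> real) \<Rightarrow> 'v set \<Rightarrow> 'v set set" where
  "maslov_cycle \<omega> L\<^sub>0 = (\<Union>i\<in>{1..}. lagr_stratum \<omega> L\<^sub>0 i)"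

text \<open>
  If \<open>W\<close> is transverse to \<open>L\<^sub>1\<close> and \<open>L\<close> is complementary to \<open>L\<^sub>1\<close>, then \<open>W\<close> is the graph of
  the linear map \<open>graph_map L\<^sub>1 W\<close> from \<open>L\<close> to \<open>L\<^sub>1\<close>, and \<open>lagr_chart \<omega> L\<^sub>1 W\<close>, restricted
  to \<open>L\<close>, is the coordinate of \<open>W\<close> in the chart determined by the pair \<open>L, L\<^sub>1\<close>.
\<close>

definition graph_map :: "'v::euclidean_space set \<Rightarrow> 'v set \<Rightarrow> 'v \<Rightarrow> 'v" where
  "graph_map L\<^sub>1 W v = (THE u. u \<in> L\<^sub>1 \<and> v + u \<in> W)"

definition lagr_chart ::
  "('v::euclidean_space \<Rightarrow> 'v \<Rightarrow> real) \<Rightarrow> 'v set \<Rightarrow> 'v set \<Rightarrow> 'v \<Rightarrow> 'v \<Rightarrow> real" where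
  "lagr_chart \<omega> L\<^sub>1 W v w = \<omega> (graph_map L\<^sub>1 W v) w"

definition smooth_real_on :: "real set \<Rightarrow> (real \<Rightarrow> real) \<Rightarrow> bool" where
  "smooth_real_on A f \<longleftrightarrow>
     (\<exists>F::nat \<Rightarrow> real \<Rightarrow> real. (\<forall>t\<in>A. F 0 t = f t) \<and>
        (\<forall>k. \<forall>t\<in>A. (F k has_real_derivative F (Suc k) t) (at t within A)))"

definition smooth_lagr_curve ::
  "('v::euclidean_space \<Rightarrow> 'v \<Rightarrow> real) \<Rightarrow> real \<Rightarrow> real \<Rightarrow> (real \<Rightarrow> 'v set) \<Rightarrow> bool" where
  "smooth_lagr_curve \<omega> c d \<gamma> \<longleftrightarrow>
     continuous_map (top_of_set {c..d}) (lagr_grassmannian \<omega>) \<gamma> \<and>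
     (\<forall>L L\<^sub>1. lagrangian \<omega> L \<longrightarrow> lagrangian \<omega> L\<^sub>1 \<longrightarrow> L \<inter> L\<^sub>1 = {0} \<longrightarrow>
        (\<forall>v\<in>L. \<forall>w\<in>L.
           smooth_real_on {t \<in> {c..d}. \<gamma> t \<inter> L\<^sub>1 = {0}} (\<lambda>t. lagr_chart \<omega> L\<^sub>1 (\<gamma> t) v w)))"

text \<open>
  The form \<open>B\<close> on \<open>\<gamma> t\<close> corresponds to the tangent vector of \<open>\<gamma>\<close> at \<open>t\<close>.
\<close>

definition lagr_tangent ::
  "('v::euclidean_space \<Rightarrow> 'v \<Rightarrow> real) \<Rightarrow> real \<Rightarrow> real \<Rightarrow> (real \<Rightarrow> 'v set) \<Rightarrow> real \<Rightarrow>
     ('v \<Rightarrow> 'v \<Rightarrow> real) \<Rightarrow> bool" where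
  "lagr_tangent \<omega> c d \<gamma> t B \<longleftrightarrow>
     (\<forall>L\<^sub>1. lagrangian \<omega> L\<^sub>1 \<longrightarrow> \<gamma> t \<inter> L\<^sub>1 = {0} \<longrightarrow>
        (\<forall>v\<in>\<gamma> t. \<forall>w\<in>\<gamma> t.
           ((\<lambda>s. lagr_chart \<omega> L\<^sub>1 (\<gamma> s) v w) has_real_derivative B v w) (at t within {c..d})))"

subsection \<open>The Maslov index\<close>

text \<open>
  A smooth curve with endpoints off the Maslov cycle meeting it exactly once, in its top
  stratum, with positive tangent vector.  Positivity on the line of intersection contains
  transversality, which says that the form does not vanish there.
\<close>

definition positive_crossing_curve ::
  "('v::euclidean_space \<Rightarrow> 'v \<Rightarrow> real) \<Rightarrow> 'v set \<Rightarrow> real \<Rightarrow> real \<Rightarrow> (real \<Rightarrow> 'v set) \<Rightarrow> bool" where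
  "positive_crossing_curve \<omega> L\<^sub>0 c d \<gamma> \<longleftrightarrow>
     smooth_lagr_curve \<omega> c d \<gamma> \<and>
     (\<exists>t\<in>{c<..<d}.
        {s \<in> {c..d}. \<gamma> s \<in> maslov_cycle \<omega> L\<^sub>0} = {t} \<and> \<gamma> t \<in> lagr_stratum \<omega> L\<^sub>0 1 \<and>
        (\<exists>B. lagr_tangent \<omega> c d \<gamma> t B \<and> (\<forall>v\<in>\<gamma> t \<inter> L\<^sub>0. v \<noteq> 0 \<longrightarrow> 0 < B v v)))"

text \<open>
  A curve on \<open>[c, d]\<close> becomes a singular 1-simplex by the affine reparametrization sending the
  vertex with \<open>x 1 = 0\<close> to \<open>c\<close> and the vertex with \<open>x 1 = 1\<close> to \<open>d\<close>.
\<close>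

definition curve_class ::
  "('v::euclidean_space \<Rightarrow> 'v \<Rightarrow> real) \<Rightarrow> 'v set \<Rightarrow> real \<Rightarrow> real \<Rightarrow> (real \<Rightarrow> 'v set) \<Rightarrow>
     'v set chain set" where
  "curve_class \<omega> L\<^sub>0 c d \<gamma> =
     homologous_rel_set 1 (lagr_grassmannian \<omega>) (lagr_stratum \<omega> L\<^sub>0 0)
       (frag_of (restrict (\<lambda>x. \<gamma> (c + x 1 * (d - c))) (standard_simplex 1)))"

definition maslov_iso ::
  "('v::euclidean_space \<Rightarrow> 'v \<Rightarrow> real) \<Rightarrow> 'v set \<Rightarrow> ('v set chain set \<Rightarrow> int) \<Rightarrow> bool" where
  "maslov_iso \<omega> L\<^sub>0 \<phi> \<longleftrightarrow>
     \<phi> \<in> iso (relative_homology_group 1 (lagr_grassmannian \<omega>) (lagr_stratum \<omega> L\<^sub>0 0)) integer_group \<and>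
     (\<forall>c d \<gamma>. c < d \<longrightarrow> positive_crossing_curve \<omega> L\<^sub>0 c d \<gamma> \<longrightarrow> \<phi> (curve_class \<omega> L\<^sub>0 c d \<gamma>) = 1)"

text \<open>
  Such an isomorphism is determined on the carrier of the homology group only, so the
  description below is of its value on a class, not of the function itself.  The index is
  meant for continuous curves on \<open>[c, d]\<close> with endpoints off the Maslov cycle.
\<close>

definition maslov_index_rel ::
  "('v::euclidean_space \<Rightarrow> 'v \<Rightarrow> real) \<Rightarrow> 'v set \<Rightarrow> real \<Rightarrow> real \<Rightarrow> (real \<Rightarrow> 'v set) \<Rightarrow> int" where
  "maslov_index_rel \<omega> L\<^sub>0 c d \<gamma> = (THE m. \<exists>\<phi>. maslov_iso \<omega> L\<^sub>0 \<phi> \<and> m = \<phi> (curve_class \<omega> L\<^sub>0 c d \<gamma>))"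

text \<open>
  The extension to curves on \<open>[a, b]\<close> whose endpoints may lie on the Maslov cycle, but whose
  crossings in the open interval are confined to a compact subinterval \<open>[c, d]\<close>.  The
  endpoints of the restriction to \<open>[c, d]\<close> must be off the cycle for its class to exist.
\<close>

definition maslov_index ::
  "('v::euclidean_space \<Rightarrow> 'v \<Rightarrow> real) \<Rightarrow> 'v set \<Rightarrow> real \<Rightarrow> real \<Rightarrow> (real \<Rightarrow> 'v set) \<Rightarrow> int" where
  "maslov_index \<omega> L\<^sub>0 a b \<gamma> = (THE m. \<exists>c d. a < c \<and> c < d \<and> d < b \<and>
     {t \<in> {a<..<b}. \<gamma> t \<in> maslov_cycle \<omega> L\<^sub>0} \<subseteq> {c..d} \<and>
     \<gamma> c \<notin> maslov_cycle \<omega> L\<^sub>0 \<and> \<gamma> d \<notin> maslov_cycle \<omega> L\<^sub>0 \<and>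
     m = maslov_index_rel \<omega> L\<^sub>0 c d \<gamma>)"

subsection \<open>Admissible quadruples and focal instants\<close>

text \<open>
  Forms on the whole space are curried continuous linear maps, so that their convergence is
  convergence in norm; the form \<open>S\<close> is a plain function of which only the values on \<open>P\<close> matter.
\<close>

definition nondegenerate_on :: "'v::real_normed_vector set \<Rightarrow> ('v \<Rightarrow>\<^sub>L 'v \<Rightarrow>\<^sub>L real) \<Rightarrow> bool" where
  "nondegenerate_on P g \<longleftrightarrow> (\<forall>x\<in>P. (\<forall>y\<in>P. g x y = 0) \<longrightarrow> x = 0)"

definition admissible_quadruple ::
  "real \<Rightarrow> real \<Rightarrow> ((real^'n) \<Rightarrow>\<^sub>L (real^'n) \<Rightarrow>\<^sub>L real) \<Rightarrow> (real \<Rightarrow> (real^'n) \<Rightarrow>\<^sub>L (real^'n)) \<Rightarrow>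
     (real^'n) set \<Rightarrow> (real^'n \<Rightarrow> real^'n \<Rightarrow> real) \<Rightarrow> bool" where
  "admissible_quadruple a b g R P S \<longleftrightarrow>
     (\<forall>x y. g x y = g y x) \<and> nondegenerate_on UNIV g \<and>
     continuous_on {a..b} R \<and> (\<forall>t\<in>{a..b}. \<forall>x y. g (R t x) y = g x (R t y)) \<and>
     subspace P \<and> nondegenerate_on P g \<and>
     sym_bilinear_on P S"

definition form_perp :: "('v::real_normed_vector \<Rightarrow>\<^sub>L 'v \<Rightarrow>\<^sub>L real) \<Rightarrow> 'v set \<Rightarrow> 'v set" where
  "form_perp g P = {x. \<forall>y\<in>P. g x y = 0}"

text \<open>The operator on \<open>P\<close> representing the form \<open>S\<close> with respect to \<open>g\<close>.\<close>

definition form_op ::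
  "('v::real_normed_vector \<Rightarrow>\<^sub>L 'v \<Rightarrow>\<^sub>L real) \<Rightarrow> 'v set \<Rightarrow> ('v \<Rightarrow> 'v \<Rightarrow> real) \<Rightarrow> 'v \<Rightarrow> 'v" where
  "form_op g P S v = (THE u. u \<in> P \<and> (\<forall>w\<in>P. S v w = g u w))"

definition ode_solution ::
  "real \<Rightarrow> real \<Rightarrow> (real \<Rightarrow> 'v::real_normed_vector \<Rightarrow>\<^sub>L 'v) \<Rightarrow> (real \<Rightarrow> 'v) \<Rightarrow> (real \<Rightarrow> 'v) \<Rightarrow> bool" where
  "ode_solution a b R J J' \<longleftrightarrow>
     (\<forall>t\<in>{a..b}. (J has_vector_derivative J' t) (at t within {a..b}) \<and>
                (J' has_vector_derivative R t (J t)) (at t within {a..b}))"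

definition PS_solution ::
  "real \<Rightarrow> real \<Rightarrow> ('v::real_normed_vector \<Rightarrow>\<^sub>L 'v \<Rightarrow>\<^sub>L real) \<Rightarrow> (real \<Rightarrow> 'v \<Rightarrow>\<^sub>L 'v) \<Rightarrow>
     'v set \<Rightarrow> ('v \<Rightarrow> 'v \<Rightarrow> real) \<Rightarrow> (real \<Rightarrow> 'v) \<Rightarrow> (real \<Rightarrow> 'v) \<Rightarrow> bool" where
  "PS_solution a b g R P S J J' \<longleftrightarrow>
     ode_solution a b R J J' \<and> J a \<in> P \<and> J' a + form_op g P S (J a) \<in> form_perp g P"

definition PS_focal ::
  "real \<Rightarrow> real \<Rightarrow> ('v::real_normed_vector \<Rightarrow>\<^sub>L 'v \<Rightarrow>\<^sub>L real) \<Rightarrow> (real \<Rightarrow> 'v \<Rightarrow>\<^sub>L 'v) \<Rightarrow>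
     'v set \<Rightarrow> ('v \<Rightarrow> 'v \<Rightarrow> real) \<Rightarrow> real \<Rightarrow> bool" where
  "PS_focal a b g R P S t\<^sub>0 \<longleftrightarrow>
     t\<^sub>0 \<in> {a<..b} \<and>
     (\<exists>J J'. PS_solution a b g R P S J J' \<and> (\<exists>t\<in>{a..b}. J t \<noteq> 0) \<and> J t\<^sub>0 = 0)"

definition sympl_form ::
  "('v::real_normed_vector \<Rightarrow>\<^sub>L 'v \<Rightarrow>\<^sub>L real) \<Rightarrow> 'v \<times> 'v \<Rightarrow> 'v \<times> 'v \<Rightarrow> real" where
  "sympl_form g p q = g (fst p) (snd q) - g (snd p) (fst q)"

definition flow ::
  "real \<Rightarrow> real \<Rightarrow> (real \<Rightarrow> 'v::real_normed_vector \<Rightarrow>\<^sub>L 'v) \<Rightarrow> real \<Rightarrow> 'v \<times> 'v \<Rightarrow> 'v \<times> 'v" where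
  "flow a b R t p = (THE q. \<exists>J J'. ode_solution a b R J J' \<and> (J a, J' a) = p \<and> (J t, J' t) = q)"

definition initial_lagrangian ::
  "('v::real_normed_vector \<Rightarrow>\<^sub>L 'v \<Rightarrow>\<^sub>L real) \<Rightarrow> 'v set \<Rightarrow> ('v \<Rightarrow> 'v \<Rightarrow> real) \<Rightarrow> ('v \<times> 'v) set" where
  "initial_lagrangian g P S = {(x, y). x \<in> P \<and> y + form_op g P S x \<in> form_perp g P}"

definition quadruple_maslov_index ::
  "real \<Rightarrow> real \<Rightarrow> ((real^'n) \<Rightarrow>\<^sub>L (real^'n) \<Rightarrow>\<^sub>L real) \<Rightarrow> (real \<Rightarrow> (real^'n) \<Rightarrow>\<^sub>L (real^'n)) \<Rightarrow>
     (real^'n) set \<Rightarrow> (real^'n \<Rightarrow> real^'n \<Rightarrow> real) \<Rightarrow> int" where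
  "quadruple_maslov_index a b g R P S =
     maslov_index (sympl_form g) ({0} \<times> UNIV) a b
       (\<lambda>t. flow a b R t ` initial_lagrangian g P S)"

end

theory Submission
  imports Defs
begin

text \<open>
  A homotopy that keeps its endpoints off the Maslov cycle does not change the relative homology
  class of a curve of Lagrangians, hence not its Maslov index.  So it is enough to deform the curve
  of the \<open>j\<close>-th quadruple into the limit curve in this way, for \<open>j\<close> large.  Three points need care.

  The symplectic form depends on \<open>j\<close>.  If \<open>G\<close> is the Gram operator of \<open>g\<close>, so that
  \<open>g x y = x \<bullet> G y\<close>, then \<open>(x, y) \<mapsto> (x, G y)\<close> carries the symplectic form of \<open>g\<close> to the
  standard form of \<open>\<real>\<^sup>n \<times> \<real>\<^sup>n\<close> and fixes \<open>L\<^sub>0 = {0} \<times> \<real>\<^sup>n\<close>.  The Maslov index is natural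
  under such maps (\<open>sympl_iso.maslov_index_image\<close>), because they transport the isomorphisms
  that define it bijectively.

  The curve starts on the Maslov cycle as soon as \<open>P\<close> is a proper subspace, so the index is
  taken on a subinterval \<open>[c, d]\<close>, and one subinterval must serve all large \<open>j\<close>.  Near \<open>b\<close> this
  is continuity.  Near \<open>a\<close>, a solution with \<open>J a = x\<close> and \<open>J' a = y\<close> satisfies
  \<open>J (a + \<tau>) = x + \<tau> y + o(\<bar>x\<bar> + \<tau>\<bar>y\<bar>)\<close>, while \<open>x \<in> P\<close> and \<open>\<tau> y\<close> is nearly
  orthogonal to \<open>P\<close>; since \<open>g\<close> is nondegenerate on \<open>P\<close>, the sum cannot vanish
  (\<open>no_crossing_near_start\<close>).  These uniformity statements, and the closeness of the curves on
  \<open>[c, d]\<close>, come from one compactness principle (\<open>zero_sets_trivial_near\<close>): a sequence of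
  unit vectors that contradicts the claim has a limit, which contradicts the hypothesis on the
  limit quadruple.

  The homotopy must stay among Lagrangians.  Let \<open>\<Phi> t L\<close> be the limit curve, with \<open>\<Phi> t\<close>
  symplectic, and let \<open>Q t\<close> be the projection onto \<open>\<Phi> t L\<close> along \<open>\<Phi> t (L\<^sup>\<bottom>)\<close>.  Both
  subspaces are Lagrangian, so \<open>s + (1 - s) Q t\<close> multiplies the symplectic form by \<open>s\<close>.  It
  therefore deforms a nearby curve of Lagrangians (\<open>s = 1\<close>) into the limit curve (\<open>s = 0\<close>)
  through isotropic subspaces (\<open>near_curves_homologous\<close>).

  The flow itself is obtained from the Picard series of the linear system, and depends
  continuously on the data by an energy estimate (\<open>flow_tendsto\<close>).
\<close>

section \<open>Linear differential equations and their flow\<close>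

lemma continuous_on_Icc_norm_bound:
  fixes f :: "real \<Rightarrow> 'w::real_normed_vector"
  assumes "continuous_on {a..b} f"
  obtains C where "\<And>t. t \<in> {a..b} \<Longrightarrow> norm (f t) \<le> C"
proof -
  have "bounded (f ` {a..b})"
    using assms by (intro compact_imp_bounded compact_continuous_image) auto
  then show ?thesis using that unfolding bounded_iff by blast
qed

primrec picard_term :: "(real \<Rightarrow> 'w::banach \<Rightarrow> 'w) \<Rightarrow> real \<Rightarrow> 'w \<Rightarrow> nat \<Rightarrow> real \<Rightarrow> 'w" where
  "picard_term A a u\<^sub>0 0 = (\<lambda>t. u\<^sub>0)"
| "picard_term A a u\<^sub>0 (Suc m) = (\<lambda>t. integral {a..t} (\<lambda>s. A s (picard_term A a u\<^sub>0 m s)))"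

text \<open>
  Each term is dominated by the corresponding term of \<open>norm u\<^sub>0 * exp (K * (t - a))\<close>, by
  induction: integrating the bound for \<open>m\<close>, multiplied by \<open>K\<close>, gives the bound for \<open>Suc m\<close>.
\<close>

lemma picard_term_bound:
  fixes A :: "real \<Rightarrow> 'w::banach \<Rightarrow> 'w"
  assumes bnd: "\<And>t x. t \<in> {a..b} \<Longrightarrow> norm (A t x) \<le> K * norm x"
    and cont: "\<And>m. continuous_on {a..b} (\<lambda>t. A t (picard_term A a u\<^sub>0 m t))"
    and "0 \<le> K" "t \<in> {a..b}"
  shows "norm (picard_term A a u\<^sub>0 m t) \<le> norm u\<^sub>0 * (K * (t - a)) ^ m / fact m"
  using \<open>t \<in> {a..b}\<close>
proof (induction m arbitrary: t)
  case 0
  then show ?case by simp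
next
  case (Suc m)
  let ?h = "\<lambda>s. norm u\<^sub>0 * (K * (s - a)) ^ Suc m / fact (Suc m)"
  let ?h' = "\<lambda>s. K * (norm u\<^sub>0 * (K * (s - a)) ^ m / fact m)"
  have "(?h has_vector_derivative ?h' s) (at s within {a..t})" for s
  proof -
    have e: "norm u\<^sub>0 * ((1 + real m) * (K * (s - a)) ^ m * K) / ((1 + real m) * fact m)
      = K * (norm u\<^sub>0 * (K * (s - a)) ^ m / fact m)"
      by (simp add: divide_simps)
    have "(?h has_real_derivative ?h' s) (at s within {a..t})"
      by (auto intro!: derivative_eq_intros simp: e[symmetric] simp del: power_Suc)
    then show ?thesis
      by (simp add: has_real_derivative_iff_has_vector_derivative)
  qed
  then have int: "(?h' has_integral (?h t - ?h a)) {a..t}"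
    using Suc.prems by (intro fundamental_theorem_of_calculus) auto
  have "norm (integral {a..t} (\<lambda>s. A s (picard_term A a u\<^sub>0 m s))) \<le> integral {a..t} ?h'"
  proof (rule integral_norm_bound_integral)
    show "(\<lambda>s. A s (picard_term A a u\<^sub>0 m s)) integrable_on {a..t}"
      using Suc.prems cont[of m]
      by (intro integrable_continuous_interval) (auto elim: continuous_on_subset)
    show "?h' integrable_on {a..t}" using int by blast
    fix s assume "s \<in> {a..t}"
    then have s: "s \<in> {a..b}" using Suc.prems by auto
    show "norm (A s (picard_term A a u\<^sub>0 m s)) \<le> ?h' s"
      using bnd[OF s, of "picard_term A a u\<^sub>0 m s"] mult_left_mono[OF Suc.IH[OF s] \<open>0 \<le> K\<close>]
      by linarith
  qed
  also have "\<dots> = ?h t"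
    using integral_unique[OF int] by simp
  finally show ?case by simp
qed

text \<open>
  The solution is the sum of the Picard series.  Applying \<open>A t\<close> to a partial sum gives the
  derivative of the next partial sum; both sequences converge uniformly, so the series may be
  differentiated term by term.
\<close>

lemma linear_ode_exists:
  fixes A :: "real \<Rightarrow> 'w::banach \<Rightarrow> 'w"
  assumes lin: "\<And>t. t \<in> {a..b} \<Longrightarrow> linear (A t)"
    and bnd: "\<And>t x. t \<in> {a..b} \<Longrightarrow> norm (A t x) \<le> K * norm x" and "0 \<le> K" "a \<le> b"
    and cont: "\<And>u. continuous_on {a..b} u \<Longrightarrow> continuous_on {a..b} (\<lambda>t. A t (u t))"
  obtains u where "u a = u\<^sub>0"
    "\<And>t. t \<in> {a..b} \<Longrightarrow> (u has_vector_derivative A t (u t)) (at t within {a..b})"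
proof -
  define d where "d = picard_term A a u\<^sub>0"
  \<comment> \<open>the derivative of the \<open>n\<close>-th term; the constant term contributes \<open>0\<close>\<close>
  define d' where "d' n t = (case n of 0 \<Rightarrow> 0 | Suc m \<Rightarrow> A t (d m t))" for n t
  have cd: "continuous_on {a..b} (d m)" for m
  proof (induction m)
    case (Suc m)
    then have "(d (Suc m) has_vector_derivative A t (d m t)) (at t within {a..b})" if "t \<in> {a..b}" for t
      using that integral_has_vector_derivative[OF cont[OF Suc]] by (simp add: d_def)
    then show ?case
      by (meson continuous_on_eq_continuous_within has_vector_derivative_continuous)
  qed (simp add: d_def)
  have der: "(d n has_vector_derivative d' n t) (at t within {a..b})" if "t \<in> {a..b}" for n t
    using integral_has_vector_derivative[OF cont[OF cd], of t] that
    by (cases n) (auto simp: d_def d'_def)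
  have bd: "norm (d m t) \<le> norm u\<^sub>0 * (K * (b - a)) ^ m / fact m" if "t \<in> {a..b}" for m t
  proof -
    have "norm (d m t) \<le> norm u\<^sub>0 * (K * (t - a)) ^ m / fact m"
      unfolding d_def using cont[OF cd] that
      by (intro picard_term_bound[OF bnd _ \<open>0 \<le> K\<close>]) (auto simp: d_def)
    also have "\<dots> \<le> norm u\<^sub>0 * (K * (b - a)) ^ m / fact m"
      using that \<open>0 \<le> K\<close> by (intro divide_right_mono mult_left_mono power_mono) auto
    finally show ?thesis .
  qed
  have summ: "summable (\<lambda>m. norm u\<^sub>0 * (K * (b - a)) ^ m / fact m)"
    using summable_mult[OF summable_exp[of "K * (b - a)"], of "norm u\<^sub>0"]
    by (simp add: divide_inverse mult_ac)
  define U where "U t = suminf (\<lambda>n. d n t)" for t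
  have sums: "(\<lambda>n. d n t) sums U t" if "t \<in> {a..b}" for t
    unfolding U_def using bd[OF that] summ
    by (intro summable_sums summable_comparison_test'[OF summ]) auto
  have ul: "uniform_limit {a..b} (\<lambda>n t. \<Sum>i<n. d i t) U sequentially"
    unfolding U_def using bd summ by (rule Weierstrass_m_test)
  have s': "(\<Sum>i<Suc n. d' i t) = A t (\<Sum>i<n. d i t)" if "t \<in> {a..b}" for n t
    by (simp add: sum.lessThan_Suc_shift d'_def linear_sum[OF lin[OF that]] del: sum.lessThan_Suc)
  have "\<exists>g. \<forall>t\<in>{a..b}. (\<lambda>n. d n t) sums (g t) \<and>
      (g has_derivative (\<lambda>h. h *\<^sub>R A t (U t))) (at t within {a..b})"
  proof (rule has_derivative_series)
    show "(d n has_derivative (\<lambda>h. h *\<^sub>R d' n t)) (at t within {a..b})" if "t \<in> {a..b}" for n t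
      using der[OF that] by (simp add: has_vector_derivative_def)
    show "\<forall>\<^sub>F n in sequentially. \<forall>t\<in>{a..b}. \<forall>h. norm ((\<Sum>i<n. h *\<^sub>R d' i t) - h *\<^sub>R A t (U t)) \<le> e * norm h"
      if "0 < e" for e
    proof -
      have "\<forall>\<^sub>F n in sequentially. \<forall>t\<in>{a..b}. dist (\<Sum>i<n. d i t) (U t) < e / (K + 1)"
        using uniform_limitD[OF ul, of "e / (K + 1)"] \<open>0 \<le> K\<close> \<open>0 < e\<close> by simp
      then have "\<forall>\<^sub>F n in sequentially. \<forall>t\<in>{a..b}. \<forall>h. norm ((\<Sum>i<Suc n. h *\<^sub>R d' i t) - h *\<^sub>R A t (U t)) \<le> e * norm h"
      proof (eventually_elim, intro ballI allI)
        fix n t h assume *: "\<forall>t\<in>{a..b}. dist (\<Sum>i<n. d i t) (U t) < e / (K + 1)" and t: "t \<in> {a..b}"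
        have "norm ((\<Sum>i<Suc n. h *\<^sub>R d' i t) - h *\<^sub>R A t (U t)) = \<bar>h\<bar> * norm (A t ((\<Sum>i<n. d i t) - U t))"
          unfolding scaleR_sum_right[symmetric] s'[OF t] scaleR_diff_right[symmetric]
            linear_diff[OF lin[OF t], symmetric] by simp
        also have "\<dots> \<le> \<bar>h\<bar> * (K * (e / (K + 1)))"
          using bnd[OF t, of "(\<Sum>i<n. d i t) - U t"] *[rule_format, OF t]
            mult_left_mono[of "norm ((\<Sum>i<n. d i t) - U t)" "e / (K + 1)" K] \<open>0 \<le> K\<close>
          by (intro mult_left_mono) (auto simp: dist_norm)
        also have "\<dots> \<le> \<bar>h\<bar> * e"
          using \<open>0 \<le> K\<close> \<open>0 < e\<close> by (intro mult_left_mono) (auto simp: field_simps)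
        finally show "norm ((\<Sum>i<Suc n. h *\<^sub>R d' i t) - h *\<^sub>R A t (U t)) \<le> e * norm h"
          by (simp add: mult.commute)
      qed
      then show ?thesis using eventually_sequentially_Suc by blast
    qed
    show "a \<in> {a..b}" using \<open>a \<le> b\<close> by simp
    then show "(\<lambda>n. d n a) sums U a" by (rule sums)
  qed simp
  then obtain g where g: "\<And>t. t \<in> {a..b} \<Longrightarrow> (\<lambda>n. d n t) sums g t"
    "\<And>t. t \<in> {a..b} \<Longrightarrow> (g has_vector_derivative A t (U t)) (at t within {a..b})"
    unfolding has_vector_derivative_def by blast
  have gU: "g t = U t" if "t \<in> {a..b}" for t
    using g(1)[OF that] sums[OF that] by (rule sums_unique2)
  have da: "d n a = (if n = 0 then u\<^sub>0 else 0)" for n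
    by (cases n) (auto simp: d_def)
  have "(\<lambda>n. d n a) sums u\<^sub>0"
    unfolding da using sums_If_finite[of "\<lambda>n. n = 0" "\<lambda>_. u\<^sub>0"] by simp
  moreover have "(\<lambda>n. d n a) sums g a"
    using g(1)[of a] \<open>a \<le> b\<close> by simp
  ultimately have "g a = u\<^sub>0"
    using sums_unique2 by blast
  then show ?thesis
  proof (rule that)
    fix t assume "t \<in> {a..b}"
    then show "(g has_vector_derivative A t (g t)) (at t within {a..b})"
      using g(2) gU by simp
  qed
qed

text \<open>
  Gronwall's inequality for the energy \<open>(norm (w t))\<^sup>2\<close>: the function
  \<open>exp (- M * (t - a)) * (norm (w t))\<^sup>2 - \<delta> * (t - a)\<close> has nonpositive derivative.  The inner
  product makes the energy differentiable where the norm need not be.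
\<close>

lemma energy_estimate:
  fixes w :: "real \<Rightarrow> 'w::real_inner"
  assumes w: "\<And>t. t \<in> {a..b} \<Longrightarrow> (w has_vector_derivative f t) (at t within {a..b})"
    and f: "\<And>t. t \<in> {a..b} \<Longrightarrow> 2 * (w t \<bullet> f t) \<le> M * (norm (w t))\<^sup>2 + \<delta>"
    and "0 \<le> M" "0 \<le> \<delta>" "t \<in> {a..b}"
  shows "(norm (w t))\<^sup>2 \<le> exp (M * (t - a)) * ((norm (w a))\<^sup>2 + \<delta> * (t - a))"
proof -
  define \<phi> where "\<phi> s = exp (- M * (s - a)) * (w s \<bullet> w s) - \<delta> * (s - a)" for s
  define \<phi>' where "\<phi>' s = exp (- M * (s - a)) * (2 * (w s \<bullet> f s) - M * (w s \<bullet> w s)) - \<delta>" for s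
  have der: "(\<phi> has_real_derivative \<phi>' s) (at s within {a..b})" if "s \<in> {a..b}" for s
  proof -
    have "((\<lambda>s. w s \<bullet> w s) has_vector_derivative w s \<bullet> f s + f s \<bullet> w s) (at s within {a..b})"
      by (rule bounded_bilinear.has_vector_derivative[OF bounded_bilinear_inner w[OF that] w[OF that]])
    then have "((\<lambda>s. w s \<bullet> w s) has_real_derivative 2 * (w s \<bullet> f s)) (at s within {a..b})"
      by (simp add: has_real_derivative_iff_has_vector_derivative inner_commute)
    then show ?thesis
      unfolding \<phi>_def \<phi>'_def by (auto intro!: derivative_eq_intros simp: algebra_simps)
  qed
  have le0: "\<phi>' s \<le> 0" if "s \<in> {a..b}" for s
  proof -
    have "2 * (w s \<bullet> f s) - M * (w s \<bullet> w s) \<le> \<delta>"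
      using f[OF that] by (simp add: power2_norm_eq_inner)
    then have "exp (- M * (s - a)) * (2 * (w s \<bullet> f s) - M * (w s \<bullet> w s)) \<le> exp (- M * (s - a)) * \<delta>"
      by (intro mult_left_mono) auto
    also have "\<dots> \<le> 1 * \<delta>"
      using \<open>0 \<le> M\<close> \<open>0 \<le> \<delta>\<close> that by (intro mult_right_mono) auto
    finally show ?thesis by (simp add: \<phi>'_def)
  qed
  have "\<phi> t \<le> \<phi> a"
  proof (rule DERIV_nonpos_imp_decreasing_open[where f = \<phi> and a = a and b = t])
    show "a \<le> t" using \<open>t \<in> {a..b}\<close> by simp
    show "continuous_on {a..t} \<phi>"
    proof (rule continuous_on_subset)
      show "continuous_on {a..b} \<phi>"
        unfolding continuous_on_eq_continuous_within using DERIV_continuous[OF der] by blast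
      show "{a..t} \<subseteq> {a..b}" using \<open>t \<in> {a..b}\<close> by simp
    qed
    fix s assume "a < s" "s < t"
    then have s: "s \<in> {a..b}" "a < s" "s < b" using \<open>t \<in> {a..b}\<close> by auto
    then show "\<exists>y. (\<phi> has_real_derivative y) (at s) \<and> y \<le> 0"
      using der[OF s(1)] le0[OF s(1)] by (auto simp: at_within_Icc_at[OF s(2,3)])
  qed
  then have "exp (- M * (t - a)) * (norm (w t))\<^sup>2 \<le> (norm (w a))\<^sup>2 + \<delta> * (t - a)"
    by (simp add: \<phi>_def power2_norm_eq_inner)
  from mult_left_mono[OF this, of "exp (M * (t - a))"]
  show ?thesis by (simp add: mult.assoc[symmetric] exp_add[symmetric])
qed

lemma ode_solution_system:
  "ode_solution a b R J J' \<longleftrightarrow>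
     (\<forall>t\<in>{a..b}. ((\<lambda>t. (J t, J' t)) has_vector_derivative (J' t, R t (J t))) (at t within {a..b}))"
  (is "?L = ?R")
proof
  assume ?L then show ?R
    by (auto simp: ode_solution_def intro: has_vector_derivative_Pair)
next
  assume R: ?R
  show ?L
    unfolding ode_solution_def
  proof
    fix t assume "t \<in> {a..b}"
    with R have *: "((\<lambda>t. (J t, J' t)) has_vector_derivative (J' t, R t (J t))) (at t within {a..b})"
      by blast
    show "(J has_vector_derivative J' t) (at t within {a..b}) \<and>
      (J' has_vector_derivative R t (J t)) (at t within {a..b})"
      using bounded_linear.has_vector_derivative[OF bounded_linear_fst *]
        bounded_linear.has_vector_derivative[OF bounded_linear_snd *] by simp
  qed
qed

lemma norm_system_le:
  fixes x y :: "'v::real_inner"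
  assumes "norm z \<le> M * norm x" "0 \<le> M"
  shows "norm (y, z) \<le> (1 + M) * norm (x, y)"
proof -
  have "norm (y, z) \<le> norm y + M * norm x"
    using norm_Pair_le[of y z] assms(1) by linarith
  also have "\<dots> \<le> norm (x, y) + M * norm (x, y)"
    using norm_fst_le[of x y] norm_snd_le[of y x] assms(2) by (intro add_mono mult_left_mono) auto
  finally show ?thesis by (simp add: algebra_simps)
qed

lemma ode_solution_exists:
  fixes R :: "real \<Rightarrow> 'v::euclidean_space \<Rightarrow>\<^sub>L 'v"
  assumes R: "continuous_on {a..b} R" and "a \<le> b"
  obtains J J' where "ode_solution a b R J J'" "(J a, J' a) = p"
proof -
  obtain M where M: "\<And>t. t \<in> {a..b} \<Longrightarrow> norm (R t) \<le> M"
    using continuous_on_Icc_norm_bound[OF R] by blast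
  then have "0 \<le> M" using \<open>a \<le> b\<close> norm_ge_zero order_trans by (metis atLeastAtMost_iff order_refl)
  define A where "A t q = (snd q, R t (fst q))" for t and q :: "'v \<times> 'v"
  have "norm (R t x) \<le> M * norm x" if "t \<in> {a..b}" for t x
    using norm_blinfun[of "R t" x] mult_right_mono[OF M[OF that], of "norm x"] by simp
  then have bnd: "norm (A t q) \<le> (1 + M) * norm q" if "t \<in> {a..b}" for t q
    using norm_system_le[of "R t (fst q)" M "fst q" "snd q"] that \<open>0 \<le> M\<close> by (simp add: A_def)
  have lin: "linear (A t)" for t
    by (rule linearI) (auto simp: A_def blinfun.add_right blinfun.scaleR_right)
  have cont: "continuous_on {a..b} (\<lambda>t. A t (u t))" if "continuous_on {a..b} u" for u
    unfolding A_def using that R by (intro continuous_intros)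
  obtain u where u: "u a = p"
    "\<And>t. t \<in> {a..b} \<Longrightarrow> (u has_vector_derivative A t (u t)) (at t within {a..b})"
    using linear_ode_exists[OF lin bnd _ \<open>a \<le> b\<close> cont, of p] \<open>0 \<le> M\<close> by auto
  show ?thesis
  proof
    show "ode_solution a b R (\<lambda>t. fst (u t)) (\<lambda>t. snd (u t))"
      using u(2) by (auto simp: ode_solution_system A_def)
    show "(fst (u a), snd (u a)) = p" using u(1) by simp
  qed
qed

text \<open>
  The difference of the two solutions solves the equation of \<open>R\<close> with forcing term
  \<open>(R - R') J\<^sub>2\<close>, of size at most \<open>\<delta> * C\<close>.  The summand \<open>1\<close> in the exponent pays for splitting
  the product of forcing term and difference into two squares.
\<close>

lemma ode_solution_perturbation:
  fixes R R' :: "real \<Rightarrow> 'v::euclidean_space \<Rightarrow>\<^sub>L 'v"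
  assumes J: "ode_solution a b R J\<^sub>1 J\<^sub>1'" and J': "ode_solution a b R' J\<^sub>2 J\<^sub>2'"
    and M: "\<And>t. t \<in> {a..b} \<Longrightarrow> norm (R t) \<le> M"
    and \<delta>: "\<And>t. t \<in> {a..b} \<Longrightarrow> norm (R t - R' t) \<le> \<delta>"
    and C: "\<And>t. t \<in> {a..b} \<Longrightarrow> norm (J\<^sub>2 t) \<le> C"
    and t: "t \<in> {a..b}"
  shows "(norm ((J\<^sub>1 t, J\<^sub>1' t) - (J\<^sub>2 t, J\<^sub>2' t)))\<^sup>2 \<le>
    exp ((2 * (1 + M) + 1) * (t - a)) *
      ((norm ((J\<^sub>1 a, J\<^sub>1' a) - (J\<^sub>2 a, J\<^sub>2' a)))\<^sup>2 + (\<delta> * C)\<^sup>2 * (t - a))"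
proof -
  define w where "w t = (J\<^sub>1 t, J\<^sub>1' t) - (J\<^sub>2 t, J\<^sub>2' t)" for t
  define f where "f t = (J\<^sub>1' t, R t (J\<^sub>1 t)) - (J\<^sub>2' t, R' t (J\<^sub>2 t))" for t
  have "0 \<le> M" using M[OF t] norm_ge_zero order_trans by blast
  have "0 \<le> \<delta>" using \<delta>[OF t] norm_ge_zero order_trans by blast
  have "(norm (w t))\<^sup>2 \<le> exp ((2 * (1 + M) + 1) * (t - a)) * ((norm (w a))\<^sup>2 + (\<delta> * C)\<^sup>2 * (t - a))"
  proof (rule energy_estimate[OF _ _ _ _ t])
    fix s assume s: "s \<in> {a..b}"
    show "(w has_vector_derivative f s) (at s within {a..b})"
      unfolding w_def f_def using J J' s
      by (intro has_vector_derivative_diff) (auto simp: ode_solution_system)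
    have "f s = (snd (w s), R s (fst (w s))) + (0, (R s - R' s) (J\<^sub>2 s))"
      by (simp add: f_def w_def blinfun.diff_left blinfun.diff_right)
    then have "w s \<bullet> f s \<le> w s \<bullet> (snd (w s), R s (fst (w s))) + w s \<bullet> (0, (R s - R' s) (J\<^sub>2 s))"
      by (simp only: inner_add_right order_refl)
    also have "w s \<bullet> (snd (w s), R s (fst (w s))) \<le> norm (w s) * ((1 + M) * norm (w s))"
    proof -
      have "norm (R s (fst (w s))) \<le> M * norm (fst (w s))"
        using norm_blinfun[of "R s" "fst (w s)"] mult_right_mono[OF M[OF s], of "norm (fst (w s))"] by simp
      from norm_system_le[OF this \<open>0 \<le> M\<close>, of "snd (w s)"]
      show ?thesis
        using norm_cauchy_schwarz[of "w s" "(snd (w s), R s (fst (w s)))"]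
          mult_left_mono[of "norm (snd (w s), R s (fst (w s)))" "(1 + M) * norm (w s)" "norm (w s)"] by simp
    qed
    also have "w s \<bullet> (0, (R s - R' s) (J\<^sub>2 s)) \<le> norm (w s) * (\<delta> * C)"
    proof -
      have "norm ((R s - R' s) (J\<^sub>2 s)) \<le> \<delta> * C"
        using norm_blinfun[of "R s - R' s" "J\<^sub>2 s"] mult_mono[OF \<delta>[OF s] C[OF s]] \<open>0 \<le> \<delta>\<close> by simp
      then show ?thesis
        using norm_cauchy_schwarz[of "w s" "(0, (R s - R' s) (J\<^sub>2 s))"]
          mult_left_mono[of "norm ((R s - R' s) (J\<^sub>2 s))" "\<delta> * C" "norm (w s)"]
        by (simp add: norm_Pair) linarith?
    qed
    finally have "w s \<bullet> f s \<le> norm (w s) * ((1 + M) * norm (w s)) + norm (w s) * (\<delta> * C)" by simp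
    moreover have "2 * (norm (w s) * (\<delta> * C)) \<le> (norm (w s))\<^sup>2 + (\<delta> * C)\<^sup>2"
      using sum_squares_bound[of "norm (w s)" "\<delta> * C"] by simp
    ultimately show "2 * (w s \<bullet> f s) \<le> (2 * (1 + M) + 1) * (norm (w s))\<^sup>2 + (\<delta> * C)\<^sup>2"
      by (simp add: power2_eq_square algebra_simps)
  qed (use \<open>0 \<le> M\<close> in auto)
  then show ?thesis by (simp add: w_def)
qed

lemma ode_solution_unique:
  fixes R :: "real \<Rightarrow> 'v::euclidean_space \<Rightarrow>\<^sub>L 'v"
  assumes R: "continuous_on {a..b} R"
    and J: "ode_solution a b R J\<^sub>1 J\<^sub>1'" "ode_solution a b R J\<^sub>2 J\<^sub>2'"
    and "(J\<^sub>1 a, J\<^sub>1' a) = (J\<^sub>2 a, J\<^sub>2' a)" and t: "t \<in> {a..b}"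
  shows "(J\<^sub>1 t, J\<^sub>1' t) = (J\<^sub>2 t, J\<^sub>2' t)"
proof -
  obtain M where M: "\<And>t. t \<in> {a..b} \<Longrightarrow> norm (R t) \<le> M"
    using continuous_on_Icc_norm_bound[OF R] by blast
  have "continuous_on {a..b} J\<^sub>2"
    using J(2) unfolding ode_solution_def continuous_on_eq_continuous_within
    by (meson has_vector_derivative_continuous)
  then obtain C where C: "\<And>t. t \<in> {a..b} \<Longrightarrow> norm (J\<^sub>2 t) \<le> C"
    using continuous_on_Icc_norm_bound[of a b J\<^sub>2] by blast
  have "(norm ((J\<^sub>1 t, J\<^sub>1' t) - (J\<^sub>2 t, J\<^sub>2' t)))\<^sup>2 \<le>
    exp ((2 * (1 + M) + 1) * (t - a)) *
      ((norm ((J\<^sub>1 a, J\<^sub>1' a) - (J\<^sub>2 a, J\<^sub>2' a)))\<^sup>2 + (0 * C)\<^sup>2 * (t - a))"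
    using M C by (intro ode_solution_perturbation[OF J _ _ _ t]) auto
  then have "(norm ((J\<^sub>1 t, J\<^sub>1' t) - (J\<^sub>2 t, J\<^sub>2' t)))\<^sup>2 \<le> 0"
    unfolding assms(4) by simp
  then show ?thesis by (simp add: zero_prod_def)
qed

context
  fixes R :: "real \<Rightarrow> 'v::euclidean_space \<Rightarrow>\<^sub>L 'v" and a b :: real
  assumes R: "continuous_on {a..b} R"
begin

lemma flow_ode_solution:
  assumes J: "ode_solution a b R J J'" and t: "t \<in> {a..b}"
  shows "flow a b R t (J a, J' a) = (J t, J' t)"
  unfolding flow_def
proof (rule the_equality)
  show "\<exists>K K'. ode_solution a b R K K' \<and> (K a, K' a) = (J a, J' a) \<and> (K t, K' t) = (J t, J' t)"
    using J by blast
  fix q assume "\<exists>K K'. ode_solution a b R K K' \<and> (K a, K' a) = (J a, J' a) \<and> (K t, K' t) = q"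
  then obtain K K' where K: "ode_solution a b R K K'" "(K a, K' a) = (J a, J' a)" "(K t, K' t) = q"
    by blast
  show "q = (J t, J' t)"
    using ode_solution_unique[OF R K(1) J K(2) t] K(3) by simp
qed

lemma ode_solution_flow:
  assumes "a \<le> b"
  shows "ode_solution a b R (\<lambda>t. fst (flow a b R t p)) (\<lambda>t. snd (flow a b R t p))"
    and "flow a b R a p = p"
proof -
  obtain J J' where J: "ode_solution a b R J J'" "(J a, J' a) = p"
    by (rule ode_solution_exists[OF R assms])
  have *: "flow a b R t p = (J t, J' t)" if "t \<in> {a..b}" for t
    using flow_ode_solution[OF J(1) that] unfolding J(2) .
  show "flow a b R a p = p" using *[of a] assms unfolding J(2) by simp
  have "\<forall>t\<in>{a..b}. ((\<lambda>t. (fst (flow a b R t p), snd (flow a b R t p))) has_vector_derivative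
      (snd (flow a b R t p), R t (fst (flow a b R t p)))) (at t within {a..b})"
  proof
    fix t assume t: "t \<in> {a..b}"
    have "((\<lambda>t. (J t, J' t)) has_vector_derivative (J' t, R t (J t))) (at t within {a..b})"
      using J(1) t by (auto simp: ode_solution_system)
    then have "((\<lambda>t. (J t, J' t)) has_vector_derivative
      (snd (flow a b R t p), R t (fst (flow a b R t p)))) (at t within {a..b})"
      unfolding *[OF t] by simp
    then show "((\<lambda>t. (fst (flow a b R t p), snd (flow a b R t p))) has_vector_derivative
      (snd (flow a b R t p), R t (fst (flow a b R t p)))) (at t within {a..b})"
    proof (rule has_vector_derivative_transform[OF t, rotated])
      fix s assume "s \<in> {a..b}"
      then show "(fst (flow a b R s p), snd (flow a b R s p)) = (J s, J' s)"
        by (subst (1 2) *) simp_all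
    qed
  qed
  then show "ode_solution a b R (\<lambda>t. fst (flow a b R t p)) (\<lambda>t. snd (flow a b R t p))"
    by (simp add: ode_solution_system)
qed

lemma flow_derivative:
  assumes "t \<in> {a..b}"
  shows "((\<lambda>t. flow a b R t p) has_vector_derivative
    (snd (flow a b R t p), R t (fst (flow a b R t p)))) (at t within {a..b})"
  using ode_solution_flow(1)[of p] assms by (auto simp: ode_solution_system)

lemma flow_continuous: "continuous_on {a..b} (\<lambda>t. flow a b R t p)"
  unfolding continuous_on_eq_continuous_within
  using has_vector_derivative_continuous[OF flow_derivative] by blast

lemma flow_linear:
  assumes t: "t \<in> {a..b}"
  shows "linear (flow a b R t)"
proof (rule linearI)
  have "a \<le> b" using t by simp
  fix p q :: "'v \<times> 'v" and c :: real
  have *: "flow a b R t r = u t"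
    if "\<And>t. t \<in> {a..b} \<Longrightarrow> (u has_vector_derivative (snd (u t), R t (fst (u t)))) (at t within {a..b})"
      and "u a = r" for u r
  proof -
    have "ode_solution a b R (\<lambda>t. fst (u t)) (\<lambda>t. snd (u t))"
      using that(1) by (simp add: ode_solution_system)
    from flow_ode_solution[OF this t] that(2) show ?thesis by simp
  qed
  show "flow a b R t (p + q) = flow a b R t p + flow a b R t q"
  proof (rule *)
    fix s assume "s \<in> {a..b}"
    then show "((\<lambda>t. flow a b R t p + flow a b R t q) has_vector_derivative
      (snd (flow a b R s p + flow a b R s q), R s (fst (flow a b R s p + flow a b R s q)))) (at s within {a..b})"
      using has_vector_derivative_add[OF flow_derivative[of s p] flow_derivative[of s q]]
      by (simp add: blinfun.add_right)
  qed (simp add: ode_solution_flow(2)[OF \<open>a \<le> b\<close>])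
  show "flow a b R t (c *\<^sub>R p) = c *\<^sub>R flow a b R t p"
  proof (rule *)
    fix s assume "s \<in> {a..b}"
    then show "((\<lambda>t. c *\<^sub>R flow a b R t p) has_vector_derivative
      (snd (c *\<^sub>R flow a b R s p), R s (fst (c *\<^sub>R flow a b R s p)))) (at s within {a..b})"
      using bounded_linear.has_vector_derivative[OF bounded_linear_scaleR_right[of c] flow_derivative[of s p]]
      by (simp add: blinfun.scaleR_right)
  qed (simp add: ode_solution_flow(2)[OF \<open>a \<le> b\<close>])
qed

end

text \<open>
  Joint continuity of the flow in the potential, the time and the initial value.  The estimate
  compares both flows at the time \<open>\<tau> i\<close>; the limit flow is then continuous in time.
\<close>

lemma flow_tendsto:
  fixes R :: "nat \<Rightarrow> real \<Rightarrow> 'v::euclidean_space \<Rightarrow>\<^sub>L 'v"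
  assumes R: "\<And>i. continuous_on {a..b} (R i)" and R': "continuous_on {a..b} R'"
    and lim: "uniform_limit {a..b} R R' sequentially"
    and p: "p \<longlonglongrightarrow> p'" and \<tau>: "\<tau> \<longlonglongrightarrow> \<tau>'" "\<And>i. \<tau> i \<in> {a..b}"
  shows "(\<lambda>i. flow a b (R i) (\<tau> i) (p i)) \<longlonglongrightarrow> flow a b R' \<tau>' p'"
proof -
  have "a \<le> b" using \<tau>(2)[of 0] by simp
  have \<tau>': "\<tau>' \<in> {a..b}"
    using closed_sequentially[OF closed_atLeastAtMost \<tau>(2) \<tau>(1)] .
  obtain M where M: "\<And>t. t \<in> {a..b} \<Longrightarrow> norm (R' t) \<le> M"
    using continuous_on_Icc_norm_bound[OF R'] by blast
  have "0 \<le> M" using M[OF \<tau>'] norm_ge_zero order_trans by blast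
  have "continuous_on {a..b} (\<lambda>t. fst (flow a b R' t p'))"
    using flow_continuous[OF R'] by (rule continuous_on_fst)
  then obtain C where C: "\<And>t. t \<in> {a..b} \<Longrightarrow> norm (fst (flow a b R' t p')) \<le> C"
    using continuous_on_Icc_norm_bound[of a b "\<lambda>t. fst (flow a b R' t p')"] by blast
  define E where "E = exp ((2 * (1 + (M + 1)) + 1) * (b - a))"
  have "E > 0" by (simp add: E_def)
  have est: "\<forall>\<^sub>F i in sequentially. (norm (flow a b (R i) (\<tau> i) (p i) - flow a b R' (\<tau> i) p'))\<^sup>2
      \<le> E * ((norm (p i - p'))\<^sup>2 + (\<delta> * C)\<^sup>2 * (b - a))" if "0 < \<delta>" "\<delta> \<le> 1" for \<delta>
    using uniform_limitD[OF lim \<open>0 < \<delta>\<close>]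
  proof eventually_elim
    case (elim i)
    then have le: "norm (R i t - R' t) \<le> \<delta>" if "t \<in> {a..b}" for t
      using that by (auto simp: dist_norm intro: less_imp_le)
    have M': "norm (R i t) \<le> M + 1" if "t \<in> {a..b}" for t
      using M[OF that] le[OF that] \<open>\<delta> \<le> 1\<close> norm_triangle_ineq2[of "R i t" "R' t"] by linarith
    have "(norm (flow a b (R i) (\<tau> i) (p i) - flow a b R' (\<tau> i) p'))\<^sup>2
      \<le> exp ((2 * (1 + (M + 1)) + 1) * (\<tau> i - a)) * ((norm (p i - p'))\<^sup>2 + (\<delta> * C)\<^sup>2 * (\<tau> i - a))"
      using ode_solution_perturbation[where M = "M + 1" and \<delta> = \<delta> and C = C and t = "\<tau> i",
          OF ode_solution_flow(1)[where R = "R i" and p = "p i", OF R \<open>a \<le> b\<close>]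
          ode_solution_flow(1)[where R = R' and p = p', OF R' \<open>a \<le> b\<close>]] M' le C \<tau>(2)[of i]
      by (simp add: ode_solution_flow(2)[OF R \<open>a \<le> b\<close>] ode_solution_flow(2)[OF R' \<open>a \<le> b\<close>])
    also have "\<dots> \<le> E * ((norm (p i - p'))\<^sup>2 + (\<delta> * C)\<^sup>2 * (b - a))"
      unfolding E_def using \<tau>(2)[of i] \<open>0 \<le> M\<close>
      by (intro mult_mono add_left_mono mult_left_mono) (auto intro!: mult_left_mono)
    finally show ?case .
  qed
  have "(\<lambda>i. (norm (flow a b (R i) (\<tau> i) (p i) - flow a b R' (\<tau> i) p'))\<^sup>2) \<longlonglongrightarrow> 0"
  proof (rule tendstoI)
    fix e :: real assume "0 < e"
    \<comment> \<open>chosen so that the error of the potential contributes at most \<open>e / 2\<close>, using \<open>\<delta>\<^sup>2 \<le> \<delta>\<close>\<close>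
    define \<delta> where "\<delta> = min 1 (e / (2 * (E * C\<^sup>2 * (b - a) + 1)))"
    have pos: "0 < E * C\<^sup>2 * (b - a) + 1"
      using \<open>E > 0\<close> \<open>a \<le> b\<close> by (simp add: add_nonneg_pos)
    have \<delta>: "0 < \<delta>" "\<delta> \<le> 1" using pos \<open>0 < e\<close> by (auto simp: \<delta>_def)
    have "\<delta>\<^sup>2 \<le> \<delta>" using \<delta> by (simp add: power2_eq_square mult_left_le_one_le)
    have "E * ((\<delta> * C)\<^sup>2 * (b - a)) = \<delta>\<^sup>2 * (E * C\<^sup>2 * (b - a))"
      by (simp add: power_mult_distrib)
    also have "\<dots> \<le> \<delta> * (E * C\<^sup>2 * (b - a))"
      using \<open>\<delta>\<^sup>2 \<le> \<delta>\<close> \<open>E > 0\<close> \<open>a \<le> b\<close> by (intro mult_right_mono) auto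
    also have "\<dots> < \<delta> * (E * C\<^sup>2 * (b - a) + 1)" using \<delta> by simp
    also have "\<dots> \<le> e / (2 * (E * C\<^sup>2 * (b - a) + 1)) * (E * C\<^sup>2 * (b - a) + 1)"
      using pos by (intro mult_right_mono) (auto simp: \<delta>_def)
    also have "\<dots> = e / 2" using pos by (simp add: field_simps)
    finally have small: "E * ((\<delta> * C)\<^sup>2 * (b - a)) < e / 2" .
    have "(\<lambda>i. E * (norm (p i - p'))\<^sup>2) \<longlonglongrightarrow> E * (norm (p' - p'))\<^sup>2"
      by (intro tendsto_intros p)
    then have "\<forall>\<^sub>F i in sequentially. E * (norm (p i - p'))\<^sup>2 < e / 2"
      using \<open>0 < e\<close> by (intro order_tendstoD(2)) auto
    with est[OF \<delta>] show "\<forall>\<^sub>F i in sequentially.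
      dist ((norm (flow a b (R i) (\<tau> i) (p i) - flow a b R' (\<tau> i) p'))\<^sup>2) 0 < e"
      by eventually_elim (use small in \<open>simp add: distrib_left\<close>)
  qed
  then have "(\<lambda>i. flow a b (R i) (\<tau> i) (p i) - flow a b R' (\<tau> i) p') \<longlonglongrightarrow> 0"
    using tendsto_real_sqrt by (force simp: tendsto_norm_zero_iff)
  moreover have "(\<lambda>i. flow a b R' (\<tau> i) p') \<longlonglongrightarrow> flow a b R' \<tau>' p'"
    using continuous_on_tendsto_compose[OF flow_continuous[OF R'] \<tau>(1) \<tau>'] \<tau>(2) by auto
  ultimately have "(\<lambda>i. (flow a b (R i) (\<tau> i) (p i) - flow a b R' (\<tau> i) p') + flow a b R' (\<tau> i) p')
      \<longlonglongrightarrow> 0 + flow a b R' \<tau>' p'"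
    by (rule tendsto_add)
  then show ?thesis by simp
qed

section \<open>Frames and the topology of the Grassmannian\<close>

text \<open>
  An orthonormal basis of \<open>L\<close> enters only through its expansion formula, which says that
  \<open>x \<mapsto> \<Sum>b\<in>B. (x \<bullet> b) *\<^sub>R b\<close> is the orthogonal projection onto \<open>L\<close>.
\<close>

lemma orthonormal_expansion:
  fixes L :: "'v::euclidean_space set"
  assumes "subspace L"
  shows "\<exists>B. finite B \<and> span B = L \<and> (\<forall>x\<in>L. (\<Sum>b\<in>B. (x \<bullet> b) *\<^sub>R b) = x)"
proof (rule orthonormal_basis_subspace[OF assms])
  fix B :: "'v set"
  assume B: "pairwise orthogonal B" "\<And>x. x \<in> B \<Longrightarrow> norm x = 1" "independent B" "span B = L"
  have "finite B" using B(3) by (rule independent_imp_finite)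
  then show ?thesis
    using B orthonormal_basis_expand[OF B(1,2)] by (intro exI[of _ B]) auto
qed

text \<open>
  Independence is an open condition with uniform constants.  The coordinate functionals dual to
  \<open>e\<close> are bounded, which gives the inequality for \<open>f = e\<close> with some constant \<open>1 / C\<close>; a
  perturbation of the frame by \<open>\<delta> = 1 / (2 * C)\<close> loses at most half of it.
\<close>

lemma frame_stability:
  fixes e :: "nat \<Rightarrow> 'v::euclidean_space"
  assumes inj: "inj_on e {..<k}" and ind: "independent (e ` {..<k})"
  obtains m \<delta> where "0 < m" "0 < \<delta>"
    "\<And>f c. (\<And>i. i < k \<Longrightarrow> dist (f i) (e i) < \<delta>) \<Longrightarrow>
       m * (\<Sum>i<k. \<bar>c i\<bar>) \<le> norm (\<Sum>i<k. c i *\<^sub>R f i)"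
proof -
  have "\<exists>\<phi>::'v \<Rightarrow> real. linear \<phi> \<and> (\<forall>i<k. \<phi> (e i) = (if i = l then 1 else 0))" for l
  proof -
    obtain \<phi> :: "'v \<Rightarrow> real" where "linear \<phi>" "\<forall>x\<in>e ` {..<k}. \<phi> x = (if the_inv_into {..<k} e x = l then 1 else 0)"
      using linear_independent_extend[OF ind, of "\<lambda>x. if the_inv_into {..<k} e x = l then 1 else 0"] by blast
    then show ?thesis
      using the_inv_into_f_f[OF inj] by (intro exI[of _ \<phi>]) auto
  qed
  then obtain \<phi> :: "nat \<Rightarrow> 'v \<Rightarrow> real" where
    lin: "\<And>l. linear (\<phi> l)" and \<phi>: "\<And>l i. i < k \<Longrightarrow> \<phi> l (e i) = (if i = l then 1 else 0)"
    by metis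
  have "\<exists>B. \<forall>x. \<bar>\<phi> l x\<bar> \<le> B * norm x" for l
    using linear_bounded[OF lin[of l]] by auto
  then obtain B where B: "\<And>l x. \<bar>\<phi> l x\<bar> \<le> B l * norm x" by metis
  define C where "C = 1 + (\<Sum>l<k. \<bar>B l\<bar>)"
  have "0 < C" by (simp add: C_def add_pos_nonneg sum_nonneg)
  have e: "(\<Sum>i<k. \<bar>c i\<bar>) \<le> C * norm (\<Sum>i<k. c i *\<^sub>R e i)" for c
  proof -
    let ?x = "\<Sum>i<k. c i *\<^sub>R e i"
    have cl: "c l = \<phi> l ?x" if "l < k" for l
    proof -
      have "\<phi> l ?x = (\<Sum>i<k. c i * \<phi> l (e i))"
        by (simp add: linear_sum[OF lin] linear_scale[OF lin])
      also have "\<dots> = (\<Sum>i<k. if i = l then c l else 0)"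
        by (intro sum.cong) (auto simp: \<phi>)
      finally show ?thesis using that by simp
    qed
    have "(\<Sum>i<k. \<bar>c i\<bar>) \<le> (\<Sum>i<k. \<bar>B i\<bar> * norm ?x)"
    proof (rule sum_mono)
      fix l assume "l \<in> {..<k}"
      then have "\<bar>c l\<bar> \<le> B l * norm ?x" using B[of l ?x] cl[of l] by simp
      also have "\<dots> \<le> \<bar>B l\<bar> * norm ?x" by (intro mult_right_mono) auto
      finally show "\<bar>c l\<bar> \<le> \<bar>B l\<bar> * norm ?x" .
    qed
    also have "\<dots> \<le> C * norm ?x"
      by (simp add: C_def sum_distrib_right[symmetric] mult_right_mono)
    finally show ?thesis .
  qed
  define \<delta> where "\<delta> = 1 / (2 * C)"
  have "0 < \<delta>" using \<open>0 < C\<close> by (simp add: \<delta>_def)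
  show ?thesis
  proof
    \<comment> \<open>the same number serves as \<open>m\<close> and as \<open>\<delta>\<close>\<close>
    show "0 < \<delta>" "0 < \<delta>" by fact+
    fix f c assume f: "\<And>i. i < k \<Longrightarrow> dist (f i) (e i) < \<delta>"
    have "norm (\<Sum>i<k. c i *\<^sub>R (e i - f i)) \<le> (\<Sum>i<k. \<bar>c i\<bar> * \<delta>)"
    proof (intro order_trans[OF norm_sum] sum_mono)
      fix i assume "i \<in> {..<k}"
      then have "norm (e i - f i) \<le> \<delta>"
        using f[of i] by (simp add: dist_norm norm_minus_commute)
      then show "norm (c i *\<^sub>R (e i - f i)) \<le> \<bar>c i\<bar> * \<delta>"
        by (simp add: mult_left_mono)
    qed
    also have "\<dots> = \<delta> * (\<Sum>i<k. \<bar>c i\<bar>)"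
      by (simp add: sum_distrib_left mult.commute)
    finally have 1: "norm (\<Sum>i<k. c i *\<^sub>R (e i - f i)) \<le> \<delta> * (\<Sum>i<k. \<bar>c i\<bar>)" .
    have "(\<Sum>i<k. c i *\<^sub>R e i) = (\<Sum>i<k. c i *\<^sub>R f i) + (\<Sum>i<k. c i *\<^sub>R (e i - f i))"
      by (simp add: sum.distrib[symmetric] algebra_simps)
    then have "norm (\<Sum>i<k. c i *\<^sub>R e i) \<le> norm (\<Sum>i<k. c i *\<^sub>R f i) + \<delta> * (\<Sum>i<k. \<bar>c i\<bar>)"
      using 1 norm_triangle_ineq[of "\<Sum>i<k. c i *\<^sub>R f i" "\<Sum>i<k. c i *\<^sub>R (e i - f i)"] by simp
    moreover have "2 * \<delta> * (\<Sum>i<k. \<bar>c i\<bar>) \<le> norm (\<Sum>i<k. c i *\<^sub>R e i)"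
      using e[of c] \<open>0 < C\<close> by (simp add: \<delta>_def field_simps)
    ultimately show "\<delta> * (\<Sum>i<k. \<bar>c i\<bar>) \<le> norm (\<Sum>i<k. c i *\<^sub>R f i)"
      by linarith
  qed
qed

lemma independent_frameI:
  fixes f :: "nat \<Rightarrow> 'v::euclidean_space"
  assumes "\<And>c. (\<Sum>i<k. c i *\<^sub>R f i) = 0 \<Longrightarrow> \<forall>i<k. c i = 0"
  shows "inj_on f {..<k}" "independent (f ` {..<k})"
proof -
  show inj: "inj_on f {..<k}"
  proof (rule inj_onI, rule ccontr)
    fix i j assume ij: "i \<in> {..<k}" "j \<in> {..<k}" "f i = f j" "i \<noteq> j"
    let ?c = "\<lambda>l. (if l = i then 1 else 0) - (if l = j then 1 else 0) :: real"
    have "(\<Sum>l<k. ?c l *\<^sub>R f l) = (\<Sum>l<k. if l = i then f l else 0) - (\<Sum>l<k. if l = j then f l else 0)"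
      unfolding sum_subtractf[symmetric] by (intro sum.cong) auto
    also have "\<dots> = 0" using ij by simp
    finally have "?c i = 0" using assms[of ?c] ij by blast
    then show False using ij by simp
  qed
  show "independent (f ` {..<k})"
  proof (rule independent_if_scalars_zero)
    fix u x assume u: "(\<Sum>x\<in>f ` {..<k}. u x *\<^sub>R x) = 0" and x: "x \<in> f ` {..<k}"
    from u have "(\<Sum>i<k. u (f i) *\<^sub>R f i) = 0"
      by (simp add: sum.reindex[OF inj])
    with x show "u x = 0" using assms[of "\<lambda>i. u (f i)"] by auto
  qed simp
qed

lemma frame_sum_eq_0:
  fixes f :: "nat \<Rightarrow> 'v::real_vector"
  assumes "inj_on f {..<k}" "independent (f ` {..<k})" "(\<Sum>i<k. c i *\<^sub>R f i) = 0" "i < k"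
  shows "c i = 0"
proof -
  have "(\<Sum>x\<in>f ` {..<k}. c (the_inv_into {..<k} f x) *\<^sub>R x) = 0"
    using assms(3) by (simp add: sum.reindex[OF assms(1)] the_inv_into_f_f[OF assms(1)])
  then have "c (the_inv_into {..<k} f (f i)) = 0"
    using independentD[OF assms(2), of "f ` {..<k}" "\<lambda>x. c (the_inv_into {..<k} f x)" "f i"] assms(4) by simp
  then show ?thesis using assms(1,4) by (simp add: the_inv_into_f_f)
qed

lemma frame_sum_in_span:
  fixes f :: "nat \<Rightarrow> 'v::real_vector"
  shows "(\<Sum>i<k. c i *\<^sub>R f i) \<in> span (f ` {..<k})"
  by (intro span_sum span_scale span_base) auto

lemma in_span_frame_iff:
  fixes f :: "nat \<Rightarrow> 'v::real_vector"
  assumes "inj_on f {..<k}"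
  shows "x \<in> span (f ` {..<k}) \<longleftrightarrow> (\<exists>c. x = (\<Sum>i<k. c i *\<^sub>R f i))"
proof
  assume "x \<in> span (f ` {..<k})"
  then obtain u where "x = (\<Sum>v\<in>f ` {..<k}. u v *\<^sub>R v)"
    by (auto simp: span_finite)
  then show "\<exists>c. x = (\<Sum>i<k. c i *\<^sub>R f i)"
    by (intro exI[of _ "\<lambda>i. u (f i)"]) (simp add: sum.reindex[OF assms])
qed (auto simp: frame_sum_in_span)

lemma frame_exists:
  fixes W :: "'v::euclidean_space set"
  assumes "subspace W" "dim W = k"
  obtains e where "is_frame k e W"
proof -
  obtain B where B: "B \<subseteq> W" "independent B" "W \<subseteq> span B" "card B = dim W"
    using basis_exists[of W] by blast
  have "finite B" using B(2) by (rule independent_imp_finite)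
  obtain e where e: "bij_betw e {..<k} B"
    using ex_bij_betw_nat_finite[OF \<open>finite B\<close>] B(4) assms(2) by (auto simp: atLeast0LessThan)
  have "span B = W"
    using B(1,3) assms(1) by (simp add: span_subspace)
  then show ?thesis
    using that[of e] e B(2) by (auto simp: is_frame_def bij_betw_def)
qed

lemma is_frame_subspace: "is_frame k e W \<Longrightarrow> subspace W \<and> dim W = k"
  unfolding is_frame_def
  by (metis card_image card_lessThan dim_eq_card_independent dim_span subspace_span)

lemma is_frame_stiefel: "is_frame k e W \<Longrightarrow> e \<in> stiefel k \<and> span (e ` {..<k}) = W"
  by (auto simp: is_frame_def stiefel_def)

lemma is_frame_linear_image:
  fixes D :: "'v::euclidean_space \<Rightarrow> 'v"
  assumes D: "linear D" "\<And>v. v \<in> W \<Longrightarrow> D v = 0 \<Longrightarrow> v = 0" and e: "is_frame k e W"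
  shows "is_frame k (\<lambda>i. D (e i)) (D ` W)"
proof -
  have W: "span (e ` {..<k}) = W" and ie: "inj_on e {..<k}" "independent (e ` {..<k})"
    using e by (auto simp: is_frame_def)
  have "\<forall>i<k. c i = 0" if "(\<Sum>i<k. c i *\<^sub>R D (e i)) = 0" for c
  proof -
    have "(\<Sum>i<k. c i *\<^sub>R e i) \<in> W"
      unfolding W[symmetric] by (rule frame_sum_in_span)
    moreover have "D (\<Sum>i<k. c i *\<^sub>R e i) = 0"
      using that by (simp add: linear_sum[OF D(1)] linear_scale[OF D(1)])
    ultimately show ?thesis
      using D(2) frame_sum_eq_0[OF ie] by blast
  qed
  note * = independent_frameI[where f = "\<lambda>i. D (e i)" and k = k, OF this]
  show ?thesis
    using * linear_span_image[OF D(1), of "e ` {..<k}"] W by (simp add: is_frame_def image_image)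
qed

lemma continuous_on_coordinate:
  fixes A :: "(nat \<Rightarrow> 'v::topological_space) set"
  shows "continuous_on A (\<lambda>e. e i)"
  by (rule continuous_on_subset[OF continuous_on_product_coordinates]) simp

text \<open>
  The Grassmannian is a quotient of the Stiefel space, so a continuous choice of frames makes a
  family of subspaces continuous.
\<close>

lemma continuous_map_grassmannian:
  fixes F :: "'a \<Rightarrow> nat \<Rightarrow> 'v::euclidean_space"
  assumes F: "\<And>x. x \<in> topspace X \<Longrightarrow> is_frame k (F x) (W x)"
    and cont: "\<And>i. continuous_map X euclidean (\<lambda>x. F x i)"
  shows "continuous_map X (grassmannian k) W"
proof -
  have F': "F x \<in> stiefel k" "span (F x ` {..<k}) = W x" if "x \<in> topspace X" for x
    using is_frame_stiefel[OF F[OF that]] by auto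
  have "continuous_map X (product_topology (\<lambda>i. euclidean) UNIV) F"
    using cont by (simp add: continuous_map_componentwise_UNIV)
  then have cF: "continuous_map X (top_of_set (stiefel k)) F"
    using F'(1) by (auto simp: continuous_map_in_subtopology euclidean_product_topology)
  show ?thesis
    unfolding continuous_map_def
  proof (intro conjI allI impI Pi_I)
    fix x assume "x \<in> topspace X"
    then show "W x \<in> topspace (grassmannian k)"
      using F[of x] by (simp add: topspace_grassmannian is_frame_subspace)
  next
    fix U :: "'v set set" assume "openin (grassmannian k) U"
    then have "openin (top_of_set (stiefel k)) {e \<in> stiefel k. span (e ` {..<k}) \<in> U}"
      by (simp add: openin_grassmannian)
    from openin_continuous_map_preimage[OF cF this]
    have "openin X {x \<in> topspace X. F x \<in> {e \<in> stiefel k. span (e ` {..<k}) \<in> U}}" .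
    also have "{x \<in> topspace X. F x \<in> {e \<in> stiefel k. span (e ` {..<k}) \<in> U}} = {x \<in> topspace X. W x \<in> U}"
      using F' by auto
    finally show "openin X {x \<in> topspace X. W x \<in> U}" .
  qed
qed

lemma continuous_map_grassmannian_image:
  fixes D :: "'v::euclidean_space \<Rightarrow> 'v"
  assumes "linear D" "inj D"
  shows "continuous_map (grassmannian k) (grassmannian k) ((`) D)"
  unfolding continuous_map_def
proof (intro conjI allI impI Pi_I)
  fix W :: "'v set" assume "W \<in> topspace (grassmannian k)"
  then show "D ` W \<in> topspace (grassmannian k)"
    using assms by (auto simp: topspace_grassmannian linear_subspace_image dim_image_eq inj_on_subset)
next
  fix U :: "'v set set" assume U: "openin (grassmannian k) U"
  let ?c = "\<lambda>e i. D (e i)"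
  have "is_frame k (?c e) (D ` span (e ` {..<k}))" if "e \<in> stiefel k" for e
    using that assms linear_injective_0[OF assms(1)]
    by (intro is_frame_linear_image) (auto simp: stiefel_def)
  then have st: "?c e \<in> stiefel k" "span (?c e ` {..<k}) = D ` span (e ` {..<k})" if "e \<in> stiefel k" for e
    using that is_frame_stiefel by metis+
  have D: "bounded_linear D" using assms(1) by (simp add: linear_conv_bounded_linear)
  have "continuous_on (stiefel k) ?c"
  proof (rule continuous_on_coordinatewise_then_product)
    fix i
    show "continuous_on (stiefel k) (\<lambda>e. D (e i))"
      by (rule continuous_on_compose2[OF linear_continuous_on[OF D, of UNIV] continuous_on_coordinate]) simp
  qed
  then have c: "continuous_map (top_of_set (stiefel k)) (top_of_set (stiefel k)) ?c"
    using st(1) by auto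
  have "openin (top_of_set (stiefel k)) {e \<in> stiefel k. ?c e \<in> {e \<in> stiefel k. span (e ` {..<k}) \<in> U}}"
    using openin_continuous_map_preimage[OF c, of "{e \<in> stiefel k. span (e ` {..<k}) \<in> U}"] U
    unfolding openin_grassmannian by simp
  also have "{e \<in> stiefel k. ?c e \<in> {e \<in> stiefel k. span (e ` {..<k}) \<in> U}} =
    {e \<in> stiefel k. span (e ` {..<k}) \<in> {W \<in> topspace (grassmannian k). D ` W \<in> U}}"
    using st by (auto simp: topspace_grassmannian dim_eq_card_independent card_image stiefel_def is_frame_def)
  finally show "openin (grassmannian k) {W \<in> topspace (grassmannian k). D ` W \<in> U}"
    unfolding openin_grassmannian by (auto simp: topspace_grassmannian)
qed

text \<open>
  A linear map \<open>q\<close> with kernel \<open>L\<close> turns transversality of \<open>W\<close> to \<open>L\<close> into independence of the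
  image under \<open>q\<close> of a frame of \<open>W\<close>, which is an open condition by \<open>frame_stability\<close>.
\<close>

lemma openin_grassmannian_transverse:
  fixes L :: "'v::euclidean_space set"
  assumes L: "subspace L"
  shows "openin (grassmannian k) {W \<in> topspace (grassmannian k). W \<inter> L = {0}}"
proof -
  obtain B where B: "finite B" "span B = L" "\<And>x. x \<in> L \<Longrightarrow> (\<Sum>b\<in>B. (x \<bullet> b) *\<^sub>R b) = x"
    using orthonormal_expansion[OF L] by blast
  define q where "q x = x - (\<Sum>b\<in>B. (x \<bullet> b) *\<^sub>R b)" for x
  have q: "linear q"
    unfolding q_def
    by (rule linearI) (auto simp: inner_add_left scaleR_add_left sum.distrib scaleR_right_diff_distrib scaleR_sum_right)
  then have q': "bounded_linear q" by (simp add: linear_conv_bounded_linear)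
  have q0: "q x = 0 \<longleftrightarrow> x \<in> L" for x
  proof
    assume "q x = 0"
    then have "x = (\<Sum>b\<in>B. (x \<bullet> b) *\<^sub>R b)" by (simp add: q_def)
    also have "\<dots> \<in> span B" by (intro span_sum span_scale span_base)
    finally show "x \<in> L" using B(2) by simp
  next
    assume "x \<in> L"
    then show "q x = 0"
      using B(3) by (simp add: q_def)
  qed
  show ?thesis
    unfolding openin_grassmannian
  proof (intro conjI)
    let ?U = "{e \<in> stiefel k. span (e ` {..<k}) \<in> {W \<in> topspace (grassmannian k). W \<inter> L = {0}}}"
    have eq: "span (e ` {..<k}) \<inter> L = {0} \<longleftrightarrow> (\<forall>c. (\<Sum>i<k. c i *\<^sub>R q (e i)) = 0 \<longrightarrow> (\<forall>i<k. c i = 0))"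
      if e: "e \<in> stiefel k" for e
    proof -
      have ie: "inj_on e {..<k}" "independent (e ` {..<k})"
        using e by (auto simp: stiefel_def is_frame_def)
      have *: "(\<Sum>i<k. c i *\<^sub>R q (e i)) = 0 \<longleftrightarrow> (\<Sum>i<k. c i *\<^sub>R e i) \<in> L" for c
        unfolding q0[symmetric] by (simp add: linear_sum[OF q] linear_scale[OF q])
      have "0 \<in> span (e ` {..<k})" "0 \<in> L" using span_zero subspace_0[OF L] by auto
      then have "span (e ` {..<k}) \<inter> L = {0} \<longleftrightarrow> (\<forall>x\<in>span (e ` {..<k}). x \<in> L \<longrightarrow> x = 0)"
        by blast
      also have "\<dots> \<longleftrightarrow> (\<forall>c. (\<Sum>i<k. c i *\<^sub>R e i) \<in> L \<longrightarrow> (\<Sum>i<k. c i *\<^sub>R e i) = 0)"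
        unfolding Ball_def in_span_frame_iff[OF ie(1)] by blast
      also have "\<dots> \<longleftrightarrow> (\<forall>c. (\<Sum>i<k. c i *\<^sub>R e i) \<in> L \<longrightarrow> (\<forall>i<k. c i = 0))"
      proof -
        have "(\<Sum>i<k. c i *\<^sub>R e i) = 0 \<longleftrightarrow> (\<forall>i<k. c i = 0)" for c
          using frame_sum_eq_0[OF ie, of c] by auto
        then show ?thesis by simp
      qed
      finally show ?thesis unfolding * .
    qed
    show "openin (top_of_set (stiefel k)) ?U"
    proof (subst openin_subopen, intro ballI)
      fix e assume "e \<in> ?U"
      then have e: "e \<in> stiefel k" "span (e ` {..<k}) \<inter> L = {0}" by auto
      then have "\<forall>i<k. c i = 0" if "(\<Sum>i<k. c i *\<^sub>R q (e i)) = 0" for c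
        using eq that by blast
      note * = independent_frameI[where f = "\<lambda>i. q (e i)" and k = k, OF this]
      obtain m \<delta> where m: "0 < m" "0 < \<delta>"
        "\<And>f c. (\<And>i. i < k \<Longrightarrow> dist (f i) (q (e i)) < \<delta>) \<Longrightarrow>
          m * (\<Sum>i<k. \<bar>c i\<bar>) \<le> norm (\<Sum>i<k. c i *\<^sub>R f i)"
        using frame_stability[OF *] by blast
      \<comment> \<open>only the first \<open>k\<close> entries of a sequence count, so this neighbourhood is open in the product topology\<close>
      define O' where "O' = (\<Inter>i\<in>{..<k}. {f::nat \<Rightarrow> 'v. dist (q (f i)) (q (e i)) < \<delta>})"
      have "open O'"
        unfolding O'_def
      proof (intro open_INT ballI open_Collect_less continuous_on_dist continuous_on_const)
        fix i :: nat
        show "continuous_on UNIV (\<lambda>f. q (f i))"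
          by (rule continuous_on_compose2[OF linear_continuous_on[OF q', of UNIV] continuous_on_coordinate]) simp
      qed simp
      moreover have "e \<in> O'" using m(2) by (simp add: O'_def)
      moreover have "f \<in> ?U" if "f \<in> stiefel k" "f \<in> O'" for f
      proof -
        have "\<forall>i<k. c i = 0" if "(\<Sum>i<k. c i *\<^sub>R q (f i)) = 0" for c
        proof -
          have "m * (\<Sum>i<k. \<bar>c i\<bar>) \<le> 0"
            using m(3)[of "\<lambda>i. q (f i)" c] \<open>f \<in> O'\<close> that by (simp add: O'_def)
          then have "(\<Sum>i<k. \<bar>c i\<bar>) \<le> 0" using \<open>0 < m\<close> by (simp add: mult_le_0_iff)
          then have "(\<Sum>i<k. \<bar>c i\<bar>) = 0" by (simp add: order_antisym sum_nonneg)
          then show ?thesis by (simp add: sum_nonneg_eq_0_iff)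
        qed
        then have "span (f ` {..<k}) \<inter> L = {0}" using eq[OF \<open>f \<in> stiefel k\<close>] by blast
        then show ?thesis
          using \<open>f \<in> stiefel k\<close> by (auto simp: topspace_grassmannian stiefel_def is_frame_def dim_eq_card_independent card_image)
      qed
      ultimately show "\<exists>T. openin (top_of_set (stiefel k)) T \<and> e \<in> T \<and> T \<subseteq> ?U"
        using e by (intro exI[of _ "stiefel k \<inter> O'"]) auto
    qed
  qed (auto simp: topspace_grassmannian)
qed

section \<open>Homotopy invariance of the class of a curve\<close>

text \<open>
  Every curve is the image of one universal relative cycle, the identity of the 1-simplex modulo
  its ends.  General facts about chain maps therefore apply to classes of curves.
\<close>

lemma curve_class_chain_map:
  "curve_class \<omega> L\<^sub>0 c d \<gamma> =
    homologous_rel_set 1 (lagr_grassmannian \<omega>) (lagr_stratum \<omega> L\<^sub>0 0)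
      (chain_map 1 (\<lambda>x. \<gamma> (c + x 1 * (d - c))) (frag_of (restrict id (standard_simplex 1))))"
proof -
  have "simplex_map 1 (\<lambda>x. \<gamma> (c + x 1 * (d - c))) (restrict id (standard_simplex 1)) =
    restrict (\<lambda>x. \<gamma> (c + x 1 * (d - c))) (standard_simplex 1)"
    unfolding simplex_map_def by (intro ext) (auto simp: restrict_def)
  then show ?thesis unfolding curve_class_def by simp
qed

abbreviation simplex1 :: "(nat \<Rightarrow> real) topology" where
  "simplex1 \<equiv> subtopology (powertop_real UNIV) (standard_simplex 1)"

abbreviation simplex1_ends :: "(nat \<Rightarrow> real) set" where
  "simplex1_ends \<equiv> {x. x 1 = 0 \<or> x 1 = 1}"

lemma simplex1_relcycle:
  "singular_relcycle 1 simplex1 simplex1_ends (frag_of (restrict id (standard_simplex 1)))"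
proof -
  have id: "singular_simplex 1 simplex1 (restrict id (standard_simplex 1))"
    unfolding singular_simplex_def by (auto simp: continuous_map_eq[OF continuous_map_id])
  have face: "singular_simplex 0 (subtopology simplex1 simplex1_ends)
      (singular_face 1 k (restrict id (standard_simplex 1)))" if "k \<le> 1" for k
  proof -
    have "singular_simplex 0 simplex1 (singular_face 1 k (restrict id (standard_simplex 1)))"
      using singular_simplex_singular_face[OF id _ that] by simp
    moreover have "singular_face 1 k (restrict id (standard_simplex 1)) x \<in> simplex1_ends"
      if x: "x \<in> standard_simplex 0" for x
    proof -
      have "simplical_face k x \<in> standard_simplex 1"
        using simplical_face_in_standard_simplex[of 1 k x] x \<open>k \<le> 1\<close> by simp
      moreover have "x 0 = 1" using x by (simp add: standard_simplex_def)
      ultimately show ?thesis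
        using x \<open>k \<le> 1\<close> by (auto simp: singular_face_def simplical_face_def)
    qed
    ultimately show ?thesis
      by (auto simp: singular_simplex_def continuous_map_in_subtopology)
  qed
  have "singular_chain 0 (subtopology simplex1 simplex1_ends)
      (chain_boundary 1 (frag_of (restrict id (standard_simplex 1))))"
    using face[of 0] face[of 1]
    by (simp add: chain_boundary_of singular_chain_diff singular_chain_of)
  with id show ?thesis
    by (simp add: singular_relcycle singular_chain_of)
qed

lemma continuous_map_simplex1: "continuous_map simplex1 (top_of_set {0..1}) (\<lambda>x. x 1)"
proof -
  have "continuous_map (powertop_real UNIV) euclideanreal (\<lambda>x. x (1::nat))"
    by (rule continuous_map_product_projection) simp
  then have "continuous_map simplex1 euclideanreal (\<lambda>x. x 1)"
    by (rule continuous_map_from_subtopology)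
  then show ?thesis
    by (auto simp: continuous_map_in_subtopology standard_simplex_def)
qed

text \<open>
  A homotopy of curves with ends off the cycle is a homotopy of maps of pairs from the 1-simplex
  and its ends, and homotopic maps of pairs induce homologous relative chains.
\<close>

lemma curve_class_homotopic:
  fixes H :: "real \<times> real \<Rightarrow> 'v::euclidean_space set"
  assumes H: "continuous_map (top_of_set ({0..1} \<times> {0..1})) (lagr_grassmannian \<omega>) H"
    and ends: "\<And>s. s \<in> {0..1} \<Longrightarrow> H (s, 0) \<in> lagr_stratum \<omega> L\<^sub>0 0" "\<And>s. s \<in> {0..1} \<Longrightarrow> H (s, 1) \<in> lagr_stratum \<omega> L\<^sub>0 0"
    and \<gamma>: "\<And>x. x \<in> {0..1} \<Longrightarrow> H (0, x) = \<gamma> (c + x * (d - c))"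
      "\<And>x. x \<in> {0..1} \<Longrightarrow> H (1, x) = \<gamma>' (c' + x * (d' - c'))"
  shows "curve_class \<omega> L\<^sub>0 c d \<gamma> = curve_class \<omega> L\<^sub>0 c' d' \<gamma>'"
proof -
  let ?f = "\<lambda>x::nat \<Rightarrow> real. \<gamma> (c + x 1 * (d - c))" and ?g = "\<lambda>x::nat \<Rightarrow> real. \<gamma>' (c' + x 1 * (d' - c'))"
  let ?h = "\<lambda>p::real \<times> (nat \<Rightarrow> real). H (fst p, snd p 1)"
  have 1: "x 1 \<in> {0..1}" if "x \<in> standard_simplex 1" for x :: "nat \<Rightarrow> real"
    using that by (simp add: standard_simplex_def)
  have c: "continuous_map (prod_topology (top_of_set {0..1}) simplex1)
      (top_of_set ({0..1::real} \<times> {0..1::real})) (\<lambda>p. (fst p, snd p 1))"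
    unfolding prod_topology_subtopology_eu[symmetric] continuous_map_paired
    using continuous_map_compose[OF continuous_map_snd continuous_map_simplex1]
    by (auto simp: continuous_map_fst o_def)
  have "homotopic_with (\<lambda>h. h \<in> (standard_simplex 1 \<inter> simplex1_ends) \<rightarrow> lagr_stratum \<omega> L\<^sub>0 0) simplex1 (lagr_grassmannian \<omega>)
      (\<lambda>x. ?h (0, x)) (\<lambda>x. ?h (1, x))"
    unfolding homotopic_with_def
  proof (rule exI[of _ ?h], intro conjI ballI allI)
    show "continuous_map (prod_topology (top_of_set {0..1}) simplex1) (lagr_grassmannian \<omega>) ?h"
      using continuous_map_compose[OF c H] by (simp add: o_def)
    fix s :: real assume "s \<in> {0..1}"
    then show "(\<lambda>x. ?h (s, x)) \<in> (standard_simplex 1 \<inter> simplex1_ends) \<rightarrow> lagr_stratum \<omega> L\<^sub>0 0"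
      using ends by auto
  qed simp_all
  then have "homotopic_with (\<lambda>h. h \<in> (standard_simplex 1 \<inter> simplex1_ends) \<rightarrow> lagr_stratum \<omega> L\<^sub>0 0) simplex1 (lagr_grassmannian \<omega>) ?f ?g"
    by (rule homotopic_with_eq) (use \<gamma> 1 in \<open>auto simp: Pi_iff\<close>)
  moreover have "singular_relcycle 1 simplex1 (standard_simplex 1 \<inter> simplex1_ends) (frag_of (restrict id (standard_simplex 1)))"
    using simplex1_relcycle singular_relcycle_restrict[of 1 simplex1 simplex1_ends] by simp
  ultimately show ?thesis
    unfolding curve_class_chain_map homologous_rel_set_eq
    by (rule homotopic_imp_homologous_rel_chain_maps)
qed

lemma continuous_map_lagrangian:
  assumes "continuous_map X (lagr_grassmannian \<omega>) \<gamma>" "x \<in> topspace X"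
  shows "lagrangian \<omega> (\<gamma> x)"
  using assms by (auto simp: lagr_grassmannian_def continuous_map_in_subtopology)

lemma maslov_cycle_iff:
  "W \<in> maslov_cycle \<omega> L\<^sub>0 \<longleftrightarrow> lagrangian \<omega> W \<and> W \<notin> lagr_stratum \<omega> L\<^sub>0 0"
  by (auto simp: maslov_cycle_def lagr_stratum_def Bex_def simp del: dim_eq_0)

text \<open>
  Slide the ends of the interval linearly from \<open>c\<close> to \<open>c'\<close> and from \<open>d\<close> to \<open>d'\<close>.
\<close>

lemma curve_class_subinterval:
  assumes \<gamma>: "continuous_map (top_of_set {a..b}) (lagr_grassmannian \<omega>) \<gamma>"
    and "a \<le> c" "c \<le> d" "d \<le> b" "a \<le> c'" "c' \<le> d'" "d' \<le> b"
    and c: "\<And>t. t \<in> closed_segment c c' \<Longrightarrow> \<gamma> t \<in> lagr_stratum \<omega> L\<^sub>0 0"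
    and d: "\<And>t. t \<in> closed_segment d d' \<Longrightarrow> \<gamma> t \<in> lagr_stratum \<omega> L\<^sub>0 0"
  shows "curve_class \<omega> L\<^sub>0 c d \<gamma> = curve_class \<omega> L\<^sub>0 c' d' \<gamma>"
proof -
  define l where "l s = (1 - s) * c + s * c'" for s
  define r where "r s = (1 - s) * d + s * d'" for s
  let ?\<tau> = "\<lambda>p. (1 - snd p) * l (fst p) + snd p * r (fst p)"
  have seg: "l s \<in> closed_segment c c'" "r s \<in> closed_segment d d'" if "s \<in> {0..1}" for s
    using that by (auto simp: l_def r_def closed_segment_def)
  have lr: "l s \<in> {a..b}" "r s \<in> {a..b}" if "s \<in> {0..1}" for s
    using seg[OF that] assms(2-7) by (auto simp: closed_segment_eq_real_ivl split: if_splits)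
  have "?\<tau> p \<in> {a..b}" if "p \<in> {0..1} \<times> {0..1}" for p
    using convexD[OF convex_real_interval(5), of "l (fst p)" a b "r (fst p)" "1 - snd p" "snd p"] lr that by auto
  moreover have "continuous_on ({0..1} \<times> {0..1}) ?\<tau>"
    unfolding l_def r_def by (intro continuous_intros)
  ultimately have \<tau>: "continuous_map (top_of_set ({0..1} \<times> {0..1})) (top_of_set {a..b}) ?\<tau>"
    by auto
  show ?thesis
  proof (rule curve_class_homotopic[where H = "\<lambda>p. \<gamma> (?\<tau> p)"])
    show "continuous_map (top_of_set ({0..1} \<times> {0..1})) (lagr_grassmannian \<omega>) (\<lambda>p. \<gamma> (?\<tau> p))"
      using continuous_map_compose[OF \<tau> \<gamma>] by (simp add: o_def)
  qed (use c d seg in \<open>auto simp: l_def r_def algebra_simps\<close>)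
qed

text \<open>
  The choice of the subinterval does not matter: all crossings lie in both candidates, so the
  ends can be slid from one to the other without meeting a crossing.
\<close>

lemma maslov_index_eq_rel:
  assumes \<gamma>: "continuous_map (top_of_set {a..b}) (lagr_grassmannian \<omega>) \<gamma>"
    and "a < c" "c < d" "d < b"
    and cross: "{t \<in> {a<..<b}. \<gamma> t \<in> maslov_cycle \<omega> L\<^sub>0} \<subseteq> {c..d}"
    and c: "\<gamma> c \<notin> maslov_cycle \<omega> L\<^sub>0" and d: "\<gamma> d \<notin> maslov_cycle \<omega> L\<^sub>0"
  shows "maslov_index \<omega> L\<^sub>0 a b \<gamma> = maslov_index_rel \<omega> L\<^sub>0 c d \<gamma>"
  unfolding maslov_index_def
proof (rule the_equality)
  have lag: "lagrangian \<omega> (\<gamma> t)" if "t \<in> {a..b}" for t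
    using continuous_map_lagrangian[OF \<gamma>] that by simp
  fix m assume "\<exists>c d. a < c \<and> c < d \<and> d < b \<and> {t \<in> {a<..<b}. \<gamma> t \<in> maslov_cycle \<omega> L\<^sub>0} \<subseteq> {c..d} \<and>
    \<gamma> c \<notin> maslov_cycle \<omega> L\<^sub>0 \<and> \<gamma> d \<notin> maslov_cycle \<omega> L\<^sub>0 \<and> m = maslov_index_rel \<omega> L\<^sub>0 c d \<gamma>"
  then obtain c' d' where *: "a < c'" "c' < d'" "d' < b"
    "{t \<in> {a<..<b}. \<gamma> t \<in> maslov_cycle \<omega> L\<^sub>0} \<subseteq> {c'..d'}"
    "\<gamma> c' \<notin> maslov_cycle \<omega> L\<^sub>0" "\<gamma> d' \<notin> maslov_cycle \<omega> L\<^sub>0" and m: "m = maslov_index_rel \<omega> L\<^sub>0 c' d' \<gamma>"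
    by blast
  have no: "\<gamma> t \<in> lagr_stratum \<omega> L\<^sub>0 0" if "t \<in> closed_segment c c' \<or> t \<in> closed_segment d d'" for t
  proof -
    have t: "t \<in> {a<..<b}"
      using that assms(2-4) *(1-3) by (auto simp: closed_segment_eq_real_ivl split: if_splits)
    have "\<gamma> t \<notin> maslov_cycle \<omega> L\<^sub>0"
    proof
      assume "\<gamma> t \<in> maslov_cycle \<omega> L\<^sub>0"
      \<comment> \<open>a crossing between \<open>c\<close> and \<open>c'\<close> would have to be the larger of the two, which is no crossing; likewise at the other end\<close>
      then have "t \<in> {c..d}" "t \<in> {c'..d'}" "t \<noteq> c" "t \<noteq> d" "t \<noteq> c'" "t \<noteq> d'"
        using t cross c d * by auto
      then show False using that by (auto simp: closed_segment_eq_real_ivl split: if_splits)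
    qed
    then show ?thesis using lag[of t] t by (simp add: maslov_cycle_iff)
  qed
  have "curve_class \<omega> L\<^sub>0 c d \<gamma> = curve_class \<omega> L\<^sub>0 c' d' \<gamma>"
    using assms(2-4) *(1-3) by (intro curve_class_subinterval[OF \<gamma>] no) auto
  then show "m = maslov_index_rel \<omega> L\<^sub>0 c d \<gamma>"
    by (simp add: m maslov_index_rel_def)
qed (use assms in blast)

section \<open>Naturality of the Maslov index\<close>

text \<open>
  A linear isomorphism between two symplectic structures on the same vector space that carries
  one reference subspace to the other.  The hypotheses are symmetric, so every transport lemma
  also holds for the inverse map, under the prefix \<open>converse\<close>.
\<close>

locale sympl_iso =
  fixes \<omega> \<omega>' :: "'v::euclidean_space \<Rightarrow> 'v \<Rightarrow> real" and D D' :: "'v \<Rightarrow> 'v" and L\<^sub>0 L\<^sub>0' :: "'v set"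
  assumes lin: "linear D" "linear D'"
    and inv: "\<And>v. D' (D v) = v" "\<And>v. D (D' v) = v"
    and form: "\<And>u v. \<omega>' (D u) (D v) = \<omega> u v"
    and L\<^sub>0: "D ` L\<^sub>0 = L\<^sub>0'"
begin

lemma inverse: "sympl_iso \<omega>' \<omega> D' D L\<^sub>0' L\<^sub>0"
proof (rule sympl_iso.intro)
  show "\<omega> (D' u) (D' v) = \<omega>' u v" for u v using form[of "D' u" "D' v"] by (simp add: inv)
  show "D' ` L\<^sub>0' = L\<^sub>0" unfolding L\<^sub>0[symmetric] by (simp add: image_image inv)
qed (simp_all add: lin inv)

lemma inj: "inj D"
  by (rule inj_on_inverseI[where g = D']) (rule inv(1))

lemma image_inverse: "D' ` D ` A = A" "D ` D' ` A = A"
  by (simp_all add: image_image inv)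

lemma dim_image: "dim (D ` A) = dim A"
  by (rule dim_image_eq[OF lin(1) inj_on_subset[OF inj subset_UNIV]])

lemma lagrangian_image: "lagrangian \<omega> L \<Longrightarrow> lagrangian \<omega>' (D ` L)"
  by (auto simp: lagrangian_def dim_image form linear_subspace_image[OF lin(1)])

lemma stratum_image: "L \<in> lagr_stratum \<omega> L\<^sub>0 k \<Longrightarrow> D ` L \<in> lagr_stratum \<omega>' L\<^sub>0' k"
  unfolding lagr_stratum_def L\<^sub>0[symmetric]
  using lagrangian_image dim_image[of "L \<inter> L\<^sub>0"] by (simp add: image_Int[OF inj])

lemma continuous_image: "continuous_map (lagr_grassmannian \<omega>) (lagr_grassmannian \<omega>') ((`) D)"
  unfolding lagr_grassmannian_def
  using continuous_map_grassmannian_image[OF lin(1) inj] lagrangian_image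
  by (auto simp: continuous_map_in_subtopology continuous_map_from_subtopology)

lemma transverse_image: "W \<inter> L = {0} \<Longrightarrow> D ` W \<inter> D ` L = {0}"
  using linear_0[OF lin(1)] by (simp add: image_Int[OF inj, symmetric])

end

sublocale sympl_iso \<subseteq> converse: sympl_iso \<omega>' \<omega> D' D L\<^sub>0' L\<^sub>0
  by (rule inverse)

context sympl_iso
begin

lemma stratum_image_iff: "D ` L \<in> lagr_stratum \<omega>' L\<^sub>0' k \<longleftrightarrow> L \<in> lagr_stratum \<omega> L\<^sub>0 k"
  using stratum_image[of L k] converse.stratum_image[of "D ` L" k] unfolding image_inverse by blast

lemma lagrangian_image_iff: "lagrangian \<omega>' (D ` L) \<longleftrightarrow> lagrangian \<omega> L"
  using lagrangian_image[of L] converse.lagrangian_image[of "D ` L"] unfolding image_inverse by blast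

lemma cycle_image_iff: "D ` L \<in> maslov_cycle \<omega>' L\<^sub>0' \<longleftrightarrow> L \<in> maslov_cycle \<omega> L\<^sub>0"
  by (simp add: maslov_cycle_iff stratum_image_iff lagrangian_image_iff)

lemma transverse_image_iff: "D ` W \<inter> D ` L = {0} \<longleftrightarrow> W \<inter> L = {0}"
  using transverse_image[of W L] converse.transverse_image[of "D ` W" "D ` L"] unfolding image_inverse by blast

text \<open>
  \<open>graph_map\<close> is a definite description, so its value is unspecified unless the described vector
  exists uniquely.  For transverse Lagrangians it does, on both sides.
\<close>

lemma graph_map_image:
  assumes L: "lagrangian \<omega> L" and W: "lagrangian \<omega> W" and "W \<inter> L = {0}"
  shows "graph_map (D ` L) (D ` W) (D v) = D (graph_map L W v)"
proof -
  have s: "subspace L" "subspace W" using L W by (auto simp: lagrangian_def)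
  have "dim W + dim L = DIM('v)" using L W by (auto simp: lagrangian_def)
  then have "dim {x + y |x y. x \<in> W \<and> y \<in> L} = DIM('v)"
    using dim_sums_Int[OF s(2,1)] \<open>W \<inter> L = {0}\<close> by simp
  then have "{x + y |x y. x \<in> W \<and> y \<in> L} = UNIV"
    using span_eq_iff[THEN iffD2, OF subspace_sums[OF s(2,1)]] dim_eq_full[of "{x + y |x y. x \<in> W \<and> y \<in> L}"]
    by simp
  then obtain x y where xy: "v = x + y" "x \<in> W" "y \<in> L" by blast
  have u: "- y \<in> L \<and> v + - y \<in> W"
    using xy s by (simp add: subspace_neg)
  have uniq: "u = - y" if "u \<in> L \<and> v + u \<in> W" for u
  proof -
    have "(v + u) - (v + - y) \<in> W" using that u s(2) by (intro subspace_diff) auto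
    moreover have "u - - y \<in> L" using that u s(1) by (intro subspace_diff) auto
    ultimately have "u - - y \<in> W \<inter> L" by simp
    then have "u - - y = 0" using \<open>W \<inter> L = {0}\<close> by blast
    then show ?thesis by (simp add: eq_neg_iff_add_eq_0)
  qed
  have "graph_map L W v = - y"
    unfolding graph_map_def by (rule the_equality) (fact u, rule uniq)
  moreover have "graph_map (D ` L) (D ` W) (D v) = D (- y)"
    unfolding graph_map_def
  proof (rule the_equality)
    show "D (- y) \<in> D ` L \<and> D v + D (- y) \<in> D ` W"
      unfolding linear_add[OF lin(1), symmetric] using u by blast
    fix u assume u': "u \<in> D ` L \<and> D v + u \<in> D ` W"
    have "D' (D v + u) = v + D' u" by (simp add: linear_add[OF lin(2)] inv)
    moreover have "D' u \<in> D' ` D ` L" "D' (D v + u) \<in> D' ` D ` W" using u' by blast+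
    ultimately have "D' u \<in> L \<and> v + D' u \<in> W" by (simp only: image_inverse)
    from uniq[OF this] show "u = D (- y)" using inv(2)[of u] by simp
  qed
  ultimately show ?thesis by simp
qed

lemma lagr_chart_image:
  assumes "lagrangian \<omega> L" "lagrangian \<omega> W" "W \<inter> L = {0}"
  shows "lagr_chart \<omega>' (D ` L) (D ` W) (D v) (D w) = lagr_chart \<omega> L W v w"
  by (simp add: lagr_chart_def graph_map_image[OF assms] form)

lemma smooth_lagr_curve_image:
  assumes \<gamma>: "smooth_lagr_curve \<omega> c d \<gamma>"
  shows "smooth_lagr_curve \<omega>' c d (\<lambda>t. D ` \<gamma> t)"
  unfolding smooth_lagr_curve_def
proof (intro conjI allI impI ballI)
  have cont: "continuous_map (top_of_set {c..d}) (lagr_grassmannian \<omega>) \<gamma>"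
    using \<gamma> by (simp add: smooth_lagr_curve_def)
  then show "continuous_map (top_of_set {c..d}) (lagr_grassmannian \<omega>') (\<lambda>t. D ` \<gamma> t)"
    using continuous_map_compose[OF _ continuous_image] by (simp add: o_def)
  have lag: "lagrangian \<omega> (\<gamma> t)" if "t \<in> {c..d}" for t
    using continuous_map_lagrangian[OF cont] that by simp
  fix L L\<^sub>1 v w
  assume L: "lagrangian \<omega>' L" and L\<^sub>1: "lagrangian \<omega>' L\<^sub>1" and i: "L \<inter> L\<^sub>1 = {0}" and v: "v \<in> L" and w: "w \<in> L"
  have LL: "lagrangian \<omega> (D' ` L)" "lagrangian \<omega> (D' ` L\<^sub>1)" "D' ` L \<inter> D' ` L\<^sub>1 = {0}"
    using converse.lagrangian_image[OF L] converse.lagrangian_image[OF L\<^sub>1] converse.transverse_image[OF i] by auto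
  have tr: "D ` \<gamma> t \<inter> L\<^sub>1 = {0} \<longleftrightarrow> \<gamma> t \<inter> D' ` L\<^sub>1 = {0}" for t
    using transverse_image_iff[of "\<gamma> t" "D' ` L\<^sub>1"] by (simp add: image_inverse)
  obtain F where F: "\<forall>t\<in>{t \<in> {c..d}. \<gamma> t \<inter> D' ` L\<^sub>1 = {0}}. F 0 t = lagr_chart \<omega> (D' ` L\<^sub>1) (\<gamma> t) (D' v) (D' w)"
    "\<forall>k. \<forall>t\<in>{t \<in> {c..d}. \<gamma> t \<inter> D' ` L\<^sub>1 = {0}}.
       (F k has_real_derivative F (Suc k) t) (at t within {t \<in> {c..d}. \<gamma> t \<inter> D' ` L\<^sub>1 = {0}})"
  proof -
    have "smooth_real_on {t \<in> {c..d}. \<gamma> t \<inter> D' ` L\<^sub>1 = {0}} (\<lambda>t. lagr_chart \<omega> (D' ` L\<^sub>1) (\<gamma> t) (D' v) (D' w))"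
      using \<gamma> LL v w unfolding smooth_lagr_curve_def by simp
    then show ?thesis using that unfolding smooth_real_on_def by blast
  qed
  show "smooth_real_on {t \<in> {c..d}. D ` \<gamma> t \<inter> L\<^sub>1 = {0}} (\<lambda>t. lagr_chart \<omega>' L\<^sub>1 (D ` \<gamma> t) v w)"
    unfolding smooth_real_on_def tr
  proof (intro exI[of _ F] conjI F(2) ballI)
    fix t assume t: "t \<in> {t \<in> {c..d}. \<gamma> t \<inter> D' ` L\<^sub>1 = {0}}"
    then have "lagr_chart \<omega>' (D ` D' ` L\<^sub>1) (D ` \<gamma> t) (D (D' v)) (D (D' w)) =
      lagr_chart \<omega> (D' ` L\<^sub>1) (\<gamma> t) (D' v) (D' w)"
      using LL lag by (intro lagr_chart_image) auto
    then show "F 0 t = lagr_chart \<omega>' L\<^sub>1 (D ` \<gamma> t) v w"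
      using F(1) t by (simp add: image_inverse inv)
  qed
qed

text \<open>
  The charts of the two curves are known to agree at times where the curve is transverse to the
  reference Lagrangian.  These times form a neighbourhood of \<open>t\<close>, since transversality is open,
  and the derivative at \<open>t\<close> sees nothing else.
\<close>

lemma lagr_tangent_image:
  assumes cont: "continuous_map (top_of_set {c..d}) (lagr_grassmannian \<omega>) \<gamma>" and t: "t \<in> {c..d}"
    and B: "lagr_tangent \<omega> c d \<gamma> t B"
  shows "lagr_tangent \<omega>' c d (\<lambda>t. D ` \<gamma> t) t (\<lambda>v w. B (D' v) (D' w))"
  unfolding lagr_tangent_def
proof (intro allI impI ballI)
  fix L\<^sub>1 v w
  assume L\<^sub>1: "lagrangian \<omega>' L\<^sub>1" and i: "D ` \<gamma> t \<inter> L\<^sub>1 = {0}" and v: "v \<in> D ` \<gamma> t" and w: "w \<in> D ` \<gamma> t"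
  have lag: "lagrangian \<omega> (\<gamma> t)" if "t \<in> {c..d}" for t
    using continuous_map_lagrangian[OF cont] that by simp
  have L: "lagrangian \<omega> (D' ` L\<^sub>1)" using converse.lagrangian_image[OF L\<^sub>1] .
  have tr: "\<gamma> t \<inter> D' ` L\<^sub>1 = {0}"
    using transverse_image_iff[of "\<gamma> t" "D' ` L\<^sub>1"] i by (simp add: image_inverse)
  let ?U = "{s \<in> {c..d}. \<gamma> s \<in> {W \<in> topspace (grassmannian (DIM('v) div 2)). W \<inter> D' ` L\<^sub>1 = {0}}}"
  have cg: "continuous_map (top_of_set {c..d}) (grassmannian (DIM('v) div 2)) \<gamma>"
    using cont by (simp add: lagr_grassmannian_def continuous_map_in_subtopology)
  have "subspace (D' ` L\<^sub>1)" using L by (simp add: lagrangian_def)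
  then have op: "openin (top_of_set {c..d}) ?U"
    using openin_continuous_map_preimage[OF cg openin_grassmannian_transverse[of "D' ` L\<^sub>1" "DIM('v) div 2"]] by simp
  have tU: "t \<in> ?U"
    using t tr continuous_map_image_subset_topspace[OF cg] by auto
  obtain T where T: "open T" "?U = {c..d} \<inter> T" using op unfolding openin_open by blast
  have der: "((\<lambda>s. lagr_chart \<omega> (D' ` L\<^sub>1) (\<gamma> s) (D' v) (D' w)) has_real_derivative B (D' v) (D' w)) (at t within {c..d})"
  proof -
    have "D' v \<in> \<gamma> t" "D' w \<in> \<gamma> t" using v w inv(1) by auto
    then show ?thesis using B L tr unfolding lagr_tangent_def by blast
  qed
    have "lagr_chart \<omega> (D' ` L\<^sub>1) (\<gamma> s) (D' v) (D' w) = lagr_chart \<omega>' L\<^sub>1 (D ` \<gamma> s) v w" if "s \<in> {c..d} \<inter> T" for s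
    proof -
      have "lagr_chart \<omega>' (D ` D' ` L\<^sub>1) (D ` \<gamma> s) (D (D' v)) (D (D' w)) =
        lagr_chart \<omega> (D' ` L\<^sub>1) (\<gamma> s) (D' v) (D' w)"
        using that L lag[of s] unfolding T(2)[symmetric] by (intro lagr_chart_image) auto
      then show ?thesis by (simp add: image_inverse inv)
    qed
    moreover have "\<forall>\<^sub>F s in nhds t. s \<in> T"
      using T tU by (intro eventually_nhds_in_open) auto
    ultimately have "\<forall>\<^sub>F s in nhds t. s \<in> {c..d} \<longrightarrow>
      lagr_chart \<omega> (D' ` L\<^sub>1) (\<gamma> s) (D' v) (D' w) = lagr_chart \<omega>' L\<^sub>1 (D ` \<gamma> s) v w"
      by (auto elim!: eventually_mono)
    from has_field_derivative_cong_ev[OF refl this refl refl t] der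
    show "((\<lambda>s. lagr_chart \<omega>' L\<^sub>1 (D ` \<gamma> s) v w) has_real_derivative B (D' v) (D' w)) (at t within {c..d})"
      by blast
qed

lemma positive_crossing_curve_image:
  assumes \<gamma>: "positive_crossing_curve \<omega> L\<^sub>0 c d \<gamma>"
  shows "positive_crossing_curve \<omega>' L\<^sub>0' c d (\<lambda>t. D ` \<gamma> t)"
proof -
  have sm: "smooth_lagr_curve \<omega> c d \<gamma>" using \<gamma> by (simp add: positive_crossing_curve_def)
  then have cont: "continuous_map (top_of_set {c..d}) (lagr_grassmannian \<omega>) \<gamma>"
    by (simp add: smooth_lagr_curve_def)
  obtain t B where t: "t \<in> {c<..<d}" "{s \<in> {c..d}. \<gamma> s \<in> maslov_cycle \<omega> L\<^sub>0} = {t}"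
    "\<gamma> t \<in> lagr_stratum \<omega> L\<^sub>0 1" "lagr_tangent \<omega> c d \<gamma> t B" "\<forall>v\<in>\<gamma> t \<inter> L\<^sub>0. v \<noteq> 0 \<longrightarrow> 0 < B v v"
    using \<gamma> unfolding positive_crossing_curve_def by blast
  have "0 < B (D' v) (D' v)" if "v \<in> D ` \<gamma> t \<inter> L\<^sub>0'" "v \<noteq> 0" for v
  proof -
    have "v \<in> D ` (\<gamma> t \<inter> L\<^sub>0)" using that(1) by (simp add: image_Int[OF inj] L\<^sub>0)
    then have "D' v \<in> \<gamma> t \<inter> L\<^sub>0" using inv(1) by auto
    moreover have "D' v \<noteq> 0" using inv(2)[of v] linear_0[OF lin(1)] that(2) by auto
    ultimately show ?thesis using t(5) by blast
  qed
  moreover have "lagr_tangent \<omega>' c d (\<lambda>t. D ` \<gamma> t) t (\<lambda>v w. B (D' v) (D' w))"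
    using t(1,4) by (intro lagr_tangent_image[OF cont]) auto
  ultimately have "\<exists>B. lagr_tangent \<omega>' c d (\<lambda>t. D ` \<gamma> t) t B \<and> (\<forall>v\<in>D ` \<gamma> t \<inter> L\<^sub>0'. v \<noteq> 0 \<longrightarrow> 0 < B v v)"
    by (intro exI[of _ "\<lambda>v w. B (D' v) (D' w)"]) simp
  then show ?thesis
    unfolding positive_crossing_curve_def cycle_image_iff stratum_image_iff
    using smooth_lagr_curve_image[OF sm] t(1-3) by blast
qed

abbreviation induced :: "'v set chain set \<Rightarrow> 'v set chain set" where
  "induced \<equiv> hom_induced 1 (lagr_grassmannian \<omega>) (lagr_stratum \<omega> L\<^sub>0 0)
    (lagr_grassmannian \<omega>') (lagr_stratum \<omega>' L\<^sub>0' 0) ((`) D)"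

lemma stratum_0_Pi: "(`) D \<in> lagr_stratum \<omega> L\<^sub>0 0 \<rightarrow> lagr_stratum \<omega>' L\<^sub>0' 0"
  using stratum_image by blast

lemma induced_iso:
  "induced \<in> iso (relative_homology_group 1 (lagr_grassmannian \<omega>) (lagr_stratum \<omega> L\<^sub>0 0))
    (relative_homology_group 1 (lagr_grassmannian \<omega>') (lagr_stratum \<omega>' L\<^sub>0' 0))"
proof (rule homotopy_equivalence_relative_homology_group_isomorphism)
  show "continuous_map (lagr_grassmannian \<omega>) (lagr_grassmannian \<omega>') ((`) D)" by (rule continuous_image)
  show "continuous_map (lagr_grassmannian \<omega>') (lagr_grassmannian \<omega>) ((`) D')" by (rule converse.continuous_image)
  show "(`) D \<in> lagr_stratum \<omega> L\<^sub>0 0 \<rightarrow> lagr_stratum \<omega>' L\<^sub>0' 0" by (rule stratum_0_Pi)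
  show "(`) D' \<in> lagr_stratum \<omega>' L\<^sub>0' 0 \<rightarrow> lagr_stratum \<omega> L\<^sub>0 0" using converse.stratum_image by blast
  have id: "(`) D' \<circ> (`) D = id" "(`) D \<circ> (`) D' = id"
    by (simp_all add: fun_eq_iff image_inverse)
  show "homotopic_with (\<lambda>h. h \<in> lagr_stratum \<omega> L\<^sub>0 0 \<rightarrow> lagr_stratum \<omega> L\<^sub>0 0)
      (lagr_grassmannian \<omega>) (lagr_grassmannian \<omega>) ((`) D' \<circ> (`) D) id"
    unfolding id by (simp add: homotopic_with_refl)
  show "homotopic_with (\<lambda>k. k \<in> lagr_stratum \<omega>' L\<^sub>0' 0 \<rightarrow> lagr_stratum \<omega>' L\<^sub>0' 0)
      (lagr_grassmannian \<omega>') (lagr_grassmannian \<omega>') ((`) D \<circ> (`) D') id"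
    unfolding id by (simp add: homotopic_with_refl)
qed

lemma induced_curve_class:
  assumes \<gamma>: "continuous_map (top_of_set {c..d}) (lagr_grassmannian \<omega>) \<gamma>" and "c \<le> d"
    and ends: "\<gamma> c \<in> lagr_stratum \<omega> L\<^sub>0 0" "\<gamma> d \<in> lagr_stratum \<omega> L\<^sub>0 0"
  shows "induced (curve_class \<omega> L\<^sub>0 c d \<gamma>) = curve_class \<omega>' L\<^sub>0' c d (\<lambda>t. D ` \<gamma> t)"
proof -
  let ?f = "\<lambda>x::nat \<Rightarrow> real. \<gamma> (c + x 1 * (d - c))" and ?\<iota> = "frag_of (restrict id (standard_simplex 1)) :: (nat \<Rightarrow> real) chain"
  have "c + x * (d - c) \<in> {c..d}" if "x \<in> {0..1}" for x :: real
    using that \<open>c \<le> d\<close> mult_left_le_one_le[of "d - c" x] by auto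
  then have "continuous_map (top_of_set {0..1}) (top_of_set {c..d}) (\<lambda>x. c + x * (d - c))"
    by (auto intro!: continuous_intros)
  from continuous_map_compose[OF continuous_map_compose[OF continuous_map_simplex1 this] \<gamma>]
  have f: "continuous_map simplex1 (lagr_grassmannian \<omega>) ?f" by (simp add: o_def)
  have e: "?f \<in> simplex1_ends \<rightarrow> lagr_stratum \<omega> L\<^sub>0 0" using ends by auto
  have cyc: "singular_relcycle 1 (lagr_grassmannian \<omega>) (lagr_stratum \<omega> L\<^sub>0 0) (chain_map 1 ?f ?\<iota>)"
    using simplex1_relcycle f e by (rule singular_relcycle_chain_map)
  have "induced (curve_class \<omega> L\<^sub>0 c d \<gamma>) =
    homologous_rel_set 1 (lagr_grassmannian \<omega>') (lagr_stratum \<omega>' L\<^sub>0' 0) (chain_map 1 ((`) D) (chain_map 1 ?f ?\<iota>))"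
    unfolding curve_class_chain_map
    using hom_induced_chain_map[OF continuous_image stratum_0_Pi cyc] by simp
  also have "chain_map 1 ((`) D) (chain_map 1 ?f ?\<iota>) = chain_map 1 (\<lambda>x. D ` ?f x) ?\<iota>"
    using fun_cong[OF chain_map_compose[of 1 "(`) D" ?f], of ?\<iota>] by (simp add: o_def del: chain_map_of)
  finally show ?thesis unfolding curve_class_chain_map .
qed

lemma positive_crossing_curve_ends:
  assumes \<gamma>: "positive_crossing_curve \<omega> L\<^sub>0 c d \<gamma>"
  shows "continuous_map (top_of_set {c..d}) (lagr_grassmannian \<omega>) \<gamma>"
    and "\<gamma> c \<in> lagr_stratum \<omega> L\<^sub>0 0" "\<gamma> d \<in> lagr_stratum \<omega> L\<^sub>0 0"
proof -
  show cont: "continuous_map (top_of_set {c..d}) (lagr_grassmannian \<omega>) \<gamma>"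
    using \<gamma> by (simp add: positive_crossing_curve_def smooth_lagr_curve_def)
  obtain t where t: "t \<in> {c<..<d}" "{s \<in> {c..d}. \<gamma> s \<in> maslov_cycle \<omega> L\<^sub>0} = {t}"
    using \<gamma> unfolding positive_crossing_curve_def by blast
  have "lagrangian \<omega> (\<gamma> s)" if "s \<in> {c..d}" for s
    using continuous_map_lagrangian[OF cont] that by simp
  moreover have "c \<in> {c..d}" "d \<in> {c..d}" "c \<notin> {t}" "d \<notin> {t}" using t(1) by auto
  ultimately show "\<gamma> c \<in> lagr_stratum \<omega> L\<^sub>0 0" "\<gamma> d \<in> lagr_stratum \<omega> L\<^sub>0 0"
    unfolding t(2)[symmetric] maslov_cycle_iff by blast+
qed

text \<open>
  A normalized isomorphism for the target pulls back to one for the source: the induced map is an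
  isomorphism, and it sends classes of positive crossing curves to classes of such curves.
\<close>

lemma maslov_iso_pullback:
  assumes \<phi>: "maslov_iso \<omega>' L\<^sub>0' \<phi>"
  shows "maslov_iso \<omega> L\<^sub>0 (\<phi> \<circ> induced)"
  unfolding maslov_iso_def
proof (intro conjI allI impI)
  show "\<phi> \<circ> induced \<in> iso (relative_homology_group 1 (lagr_grassmannian \<omega>) (lagr_stratum \<omega> L\<^sub>0 0)) integer_group"
    using iso_set_trans[OF induced_iso] \<phi> unfolding maslov_iso_def by blast
next
  fix c d :: real and \<gamma> assume "c < d" and \<gamma>: "positive_crossing_curve \<omega> L\<^sub>0 c d \<gamma>"
  then have "induced (curve_class \<omega> L\<^sub>0 c d \<gamma>) = curve_class \<omega>' L\<^sub>0' c d (\<lambda>t. D ` \<gamma> t)"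
    using positive_crossing_curve_ends[OF \<gamma>] by (intro induced_curve_class) auto
  then show "(\<phi> \<circ> induced) (curve_class \<omega> L\<^sub>0 c d \<gamma>) = 1"
    using \<phi> positive_crossing_curve_image[OF \<gamma>] \<open>c < d\<close> unfolding maslov_iso_def by simp
qed

text \<open>
  The values that compete for the Maslov index of the image curve also compete for that of the
  original curve.  With the converse inclusion the two definite descriptions coincide.
\<close>

lemma maslov_value_pullback:
  assumes "continuous_map (top_of_set {c..d}) (lagr_grassmannian \<omega>) \<gamma>" "c \<le> d"
    and "\<gamma> c \<in> lagr_stratum \<omega> L\<^sub>0 0" "\<gamma> d \<in> lagr_stratum \<omega> L\<^sub>0 0"
    and "\<exists>\<phi>. maslov_iso \<omega>' L\<^sub>0' \<phi> \<and> m = \<phi> (curve_class \<omega>' L\<^sub>0' c d (\<lambda>t. D ` \<gamma> t))"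
  shows "\<exists>\<phi>. maslov_iso \<omega> L\<^sub>0 \<phi> \<and> m = \<phi> (curve_class \<omega> L\<^sub>0 c d \<gamma>)"
proof -
  obtain \<phi> where \<phi>: "maslov_iso \<omega>' L\<^sub>0' \<phi>" "m = \<phi> (curve_class \<omega>' L\<^sub>0' c d (\<lambda>t. D ` \<gamma> t))"
    using assms(5) by blast
  have "m = (\<phi> \<circ> induced) (curve_class \<omega> L\<^sub>0 c d \<gamma>)"
    using induced_curve_class[OF assms(1-4)] \<phi>(2) by simp
  then show ?thesis using maslov_iso_pullback[OF \<phi>(1)] by blast
qed

end

(* reopened to have the converse versions of the preceding lemmas *)
context sympl_iso
begin

lemma continuous_curve_image:
  assumes "continuous_map X (lagr_grassmannian \<omega>) \<gamma>"
  shows "continuous_map X (lagr_grassmannian \<omega>') (\<lambda>t. D ` \<gamma> t)"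
  using continuous_map_compose[OF assms continuous_image] by (simp add: o_def)

lemma maslov_index_rel_image:
  assumes \<gamma>: "continuous_map (top_of_set {c..d}) (lagr_grassmannian \<omega>) \<gamma>" "c \<le> d"
    and ends: "\<gamma> c \<in> lagr_stratum \<omega> L\<^sub>0 0" "\<gamma> d \<in> lagr_stratum \<omega> L\<^sub>0 0"
  shows "maslov_index_rel \<omega>' L\<^sub>0' c d (\<lambda>t. D ` \<gamma> t) = maslov_index_rel \<omega> L\<^sub>0 c d \<gamma>"
proof -
  have "(\<exists>\<phi>. maslov_iso \<omega>' L\<^sub>0' \<phi> \<and> m = \<phi> (curve_class \<omega>' L\<^sub>0' c d (\<lambda>t. D ` \<gamma> t))) \<longleftrightarrow>
    (\<exists>\<phi>. maslov_iso \<omega> L\<^sub>0 \<phi> \<and> m = \<phi> (curve_class \<omega> L\<^sub>0 c d \<gamma>))" (is "?L m \<longleftrightarrow> ?R m") for m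
  proof
    show "?L m \<Longrightarrow> ?R m" by (rule maslov_value_pullback[OF \<gamma> ends])
    assume R: "?R m"
    show "?L m"
    proof (rule converse.maslov_value_pullback)
      show "continuous_map (top_of_set {c..d}) (lagr_grassmannian \<omega>') (\<lambda>t. D ` \<gamma> t)"
        by (rule continuous_curve_image[OF \<gamma>(1)])
    qed (use R ends \<gamma>(2) in \<open>simp_all add: stratum_image_iff image_inverse\<close>)
  qed
  then show ?thesis unfolding maslov_index_rel_def by simp
qed

lemma maslov_index_image:
  assumes \<gamma>: "continuous_map (top_of_set {a..b}) (lagr_grassmannian \<omega>) \<gamma>"
  shows "maslov_index \<omega>' L\<^sub>0' a b (\<lambda>t. D ` \<gamma> t) = maslov_index \<omega> L\<^sub>0 a b \<gamma>"
proof -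
  have lag: "lagrangian \<omega> (\<gamma> t)" if "t \<in> {a..b}" for t
    using continuous_map_lagrangian[OF \<gamma>] that by simp
  have "maslov_index_rel \<omega>' L\<^sub>0' c d (\<lambda>t. D ` \<gamma> t) = maslov_index_rel \<omega> L\<^sub>0 c d \<gamma>"
    if "a < c" "c < d" "d < b" "\<gamma> c \<notin> maslov_cycle \<omega> L\<^sub>0" "\<gamma> d \<notin> maslov_cycle \<omega> L\<^sub>0" for c d
  proof (rule maslov_index_rel_image)
    show "continuous_map (top_of_set {c..d}) (lagr_grassmannian \<omega>) \<gamma>"
      using continuous_map_from_subtopology_mono[OF \<gamma>, of "{c..d}"] that by auto
  qed (use that lag[of c] lag[of d] in \<open>auto simp: maslov_cycle_iff\<close>)
  then show ?thesis
    unfolding maslov_index_def cycle_image_iff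
    by (intro arg_cong[where f = The] ext iff_exI conj_cong refl) simp_all
qed

end

section \<open>Deforming nearby curves of Lagrangians\<close>

definition std_form :: "'v::euclidean_space \<times> 'v \<Rightarrow> 'v \<times> 'v \<Rightarrow> real" where
  "std_form p q = fst p \<bullet> snd q - snd p \<bullet> fst q"

text \<open>
  The complex structure of \<open>\<real>\<^sup>n \<times> \<real>\<^sup>n\<close> that relates the standard symplectic form to the inner
  product: \<open>std_form p q = p \<bullet> std_J q\<close>.
\<close>

definition std_J :: "'v::euclidean_space \<times> 'v \<Rightarrow> 'v \<times> 'v" where
  "std_J p = (snd p, - fst p)"

lemma std_J_linear: "linear std_J"
  by (rule linearI) (auto simp: std_J_def)

lemma std_form_J: "std_form p q = p \<bullet> std_J q"
  by (cases p; cases q) (simp add: std_form_def std_J_def inner_commute)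

lemma std_J_J: "std_J (std_J p) = - p"
  by (cases p) (simp add: std_J_def)

lemma std_J_inner: "std_J p \<bullet> std_J q = p \<bullet> q"
  by (cases p; cases q) (simp add: std_J_def)

lemma std_form_simps:
  "std_form (p + q) r = std_form p r + std_form q r"
  "std_form r (p + q) = std_form r p + std_form r q"
  "std_form (c *\<^sub>R p) r = c * std_form p r"
  "std_form r (c *\<^sub>R p) = c * std_form r p"
  "std_form (p - q) r = std_form p r - std_form q r"
  "std_form r (p - q) = std_form r p - std_form r q"
  "std_form 0 r = 0" "std_form r 0 = 0"
  by (simp_all add: std_form_def inner_add_left inner_add_right inner_diff_left inner_diff_right algebra_simps)

lemma std_form_nondegenerate: "(\<And>q. std_form p q = 0) \<Longrightarrow> p = 0"
proof -
  assume "\<And>q. std_form p q = 0"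
  from this[of "std_J p"] show "p = 0" by (simp add: std_form_J std_J_J)
qed

lemma dim_std_annihilator:
  fixes L :: "('v::euclidean_space \<times> 'v) set"
  assumes "subspace L"
  shows "dim {v. \<forall>w\<in>L. std_form v w = 0} + dim L = DIM('v \<times> 'v)"
proof -
  have "inj std_J" by (metis injI std_J_J neg_equal_iff_equal)
  then have d: "dim (std_J ` L) = dim L"
    by (rule dim_image_eq[OF std_J_linear inj_on_subset[OF _ subset_UNIV]])
  have "{v. \<forall>w\<in>L. std_form v w = 0} = {v \<in> UNIV. \<forall>x\<in>std_J ` L. orthogonal x v}"
    by (auto simp: std_form_J orthogonal_def inner_commute)
  then show ?thesis
    using dim_subspace_orthogonal_to_vectors[OF linear_subspace_image[OF std_J_linear assms] subspace_UNIV subset_UNIV]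
    by (simp add: d)
qed

lemma subspace_std_annihilator: "subspace {v. \<forall>w\<in>L. std_form v w = 0}"
  by (rule subspaceI) (simp_all add: std_form_simps)

text \<open>
  A subspace and its symplectic annihilator have complementary dimensions, so an isotropic
  subspace has half the dimension exactly when it equals its annihilator.
\<close>

lemma lagrangian_std_iff:
  fixes L :: "('v::euclidean_space \<times> 'v) set"
  shows "lagrangian std_form L \<longleftrightarrow> subspace L \<and> L = {v. \<forall>w\<in>L. std_form v w = 0}"
proof (intro iffI conjI)
  assume L: "lagrangian std_form L"
  then show s: "subspace L" by (simp add: lagrangian_def)
  show "L = {v. \<forall>w\<in>L. std_form v w = 0}"
  proof (rule subspace_dim_equal[OF s subspace_std_annihilator])
    show "L \<subseteq> {v. \<forall>w\<in>L. std_form v w = 0}" using L by (auto simp: lagrangian_def)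
    show "dim {v. \<forall>w\<in>L. std_form v w = 0} \<le> dim L"
      using dim_std_annihilator[OF s] L by (simp add: lagrangian_def)
  qed
next
  assume L: "subspace L \<and> L = {v. \<forall>w\<in>L. std_form v w = 0}"
  then have "dim L + dim L = DIM('v \<times> 'v)" using dim_std_annihilator[of L] by simp
  then show "lagrangian std_form L"
    unfolding lagrangian_def using L by auto
qed

text \<open>
  \<open>std_J\<close> preserves the form and maps the orthogonal complement of a Lagrangian into the
  Lagrangian.
\<close>

lemma std_form_orthogonal_complement:
  assumes L: "lagrangian std_form L"
    and u: "\<And>l. l \<in> L \<Longrightarrow> u \<bullet> l = 0" and v: "\<And>l. l \<in> L \<Longrightarrow> v \<bullet> l = 0"
  shows "std_form u v = 0"
proof -
  have "std_J w \<in> L" if "\<And>l. l \<in> L \<Longrightarrow> w \<bullet> l = 0" for w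
  proof -
    have "std_form (std_J w) l = 0" if "l \<in> L" for l
      using \<open>\<And>l. l \<in> L \<Longrightarrow> w \<bullet> l = 0\<close>[OF that] by (simp add: std_form_J std_J_inner)
    then show ?thesis using L unfolding lagrangian_std_iff by blast
  qed
  then have "std_form (std_J u) (std_J v) = 0"
    using u v L unfolding lagrangian_def by blast
  then show ?thesis by (simp add: std_form_J std_J_inner)
qed

lemma std_sympl_inj:
  assumes "linear A" "\<And>u v. std_form (A u) (A v) = std_form u v"
  shows "inj A"
  unfolding linear_injective_0[OF assms(1)]
proof (intro allI impI)
  fix u assume "A u = 0"
  have "std_form u v = 0" for v
    using assms(2)[of u v] \<open>A u = 0\<close> by (simp add: std_form_def)
  then show "u = 0" by (rule std_form_nondegenerate)
qed

lemma std_sympl_lagrangian: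
  fixes A :: "'v::euclidean_space \<times> 'v \<Rightarrow> 'v \<times> 'v"
  assumes "linear A" "\<And>u v. std_form (A u) (A v) = std_form u v" "lagrangian std_form L"
  shows "lagrangian std_form (A ` L)"
  unfolding lagrangian_def
proof (intro conjI)
  have "dim (A ` L) = dim L"
    by (rule dim_image_eq[OF assms(1) inj_on_subset[OF std_sympl_inj[OF assms(1,2)] subset_UNIV]])
  then show "2 * dim (A ` L) = DIM('v \<times> 'v)" using assms(3) by (simp add: lagrangian_def)
qed (use assms in \<open>auto simp: lagrangian_def linear_subspace_image\<close>)

definition sympl_path :: "real \<Rightarrow> real \<Rightarrow> (real \<Rightarrow> 'v::euclidean_space \<times> 'v \<Rightarrow> 'v \<times> 'v) \<Rightarrow> bool" where
  "sympl_path a b \<Phi> \<longleftrightarrow>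
     (\<forall>t\<in>{a..b}. linear (\<Phi> t) \<and> (\<forall>u v. std_form (\<Phi> t u) (\<Phi> t v) = std_form u v)) \<and>
     (\<forall>v. continuous_on {a..b} (\<lambda>t. \<Phi> t v))"

lemma sympl_pathD:
  assumes "sympl_path a b \<Phi>"
  shows "t \<in> {a..b} \<Longrightarrow> linear (\<Phi> t)"
    and "t \<in> {a..b} \<Longrightarrow> std_form (\<Phi> t u) (\<Phi> t v) = std_form u v"
    and "continuous_on {a..b} (\<lambda>t. \<Phi> t v)"
  using assms unfolding sympl_path_def by blast+

lemma sympl_path_lagrangian:
  assumes "sympl_path a b \<Phi>" "lagrangian std_form L" "t \<in> {a..b}"
  shows "lagrangian std_form (\<Phi> t ` L)"
  using sympl_pathD(1,2)[OF assms(1,3)] assms(2) by (rule std_sympl_lagrangian)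

lemma sympl_path_eq_0:
  assumes "sympl_path a b \<Phi>" "t \<in> {a..b}" "\<Phi> t v = 0"
  shows "v = 0"
proof -
  have "inj (\<Phi> t)"
    using sympl_pathD(1,2)[OF assms(1,2)] by (rule std_sympl_inj)
  then show ?thesis
    using assms(3) linear_injective_0[OF sympl_pathD(1)[OF assms(1,2)]] by blast
qed

text \<open>
  A frame of \<open>M\<close> is mapped to frames of the image subspaces, and these depend continuously on
  \<open>x\<close>.
\<close>

lemma continuous_map_lagr_grassmannian:
  fixes A :: "'a \<Rightarrow> 'v::euclidean_space \<Rightarrow> 'v"
  assumes M: "subspace M" "2 * dim M = DIM('v)"
    and lin: "\<And>x. x \<in> topspace X \<Longrightarrow> linear (A x)"
    and ker: "\<And>x v. x \<in> topspace X \<Longrightarrow> v \<in> M \<Longrightarrow> A x v = 0 \<Longrightarrow> v = 0"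
    and iso: "\<And>x u v. x \<in> topspace X \<Longrightarrow> u \<in> M \<Longrightarrow> v \<in> M \<Longrightarrow> \<omega> (A x u) (A x v) = 0"
    and cont: "\<And>v. continuous_map X euclidean (\<lambda>x. A x v)"
  shows "continuous_map X (lagr_grassmannian \<omega>) (\<lambda>x. A x ` M)"
proof -
  have k: "dim M = DIM('v) div 2" using M(2) by simp
  obtain e where e: "is_frame (DIM('v) div 2) e M"
    by (rule frame_exists[OF M(1) k])
  have fr: "is_frame (DIM('v) div 2) (\<lambda>i. A x (e i)) (A x ` M)" if "x \<in> topspace X" for x
    using is_frame_linear_image[OF lin[OF that] _ e] ker[OF that] by blast
  have "continuous_map X (grassmannian (DIM('v) div 2)) (\<lambda>x. A x ` M)"
    by (rule continuous_map_grassmannian[OF fr cont])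
  moreover have "lagrangian \<omega> (A x ` M)" if "x \<in> topspace X" for x
    using is_frame_subspace[OF fr[OF that]] iso[OF that] M(2) k by (auto simp: lagrangian_def)
  ultimately show ?thesis
    by (auto simp: lagr_grassmannian_def continuous_map_in_subtopology)
qed

lemma sympl_path_continuous:
  assumes "sympl_path a b \<Phi>" "lagrangian std_form L"
  shows "continuous_map (top_of_set {a..b}) (lagr_grassmannian std_form) (\<lambda>t. \<Phi> t ` L)"
proof (rule continuous_map_lagr_grassmannian)
  fix t u v assume t: "t \<in> topspace (top_of_set {a..b})" and uv: "u \<in> L" "v \<in> L"
  then have "std_form (\<Phi> t u) (\<Phi> t v) = std_form u v" using sympl_pathD(2)[OF assms(1)] by simp
  then show "std_form (\<Phi> t u) (\<Phi> t v) = 0" using assms(2) uv by (simp add: lagrangian_def)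
qed (use assms(2) sympl_path_eq_0[OF assms(1)] sympl_pathD(1,3)[OF assms(1)] in \<open>simp_all add: lagrangian_def\<close>)

text \<open>
  For an orthonormal basis \<open>B\<close> of a Lagrangian \<open>L\<close> and symplectic \<open>\<Phi>\<close>, this is
  \<open>\<Phi> \<circ> \<pi> \<circ> \<Phi>\<^sup>-\<^sup>1\<close> with \<open>\<pi>\<close> the orthogonal projection onto \<open>L\<close>.  Written through the form it
  avoids the inverse of \<open>\<Phi>\<close> and is visibly continuous in \<open>\<Phi>\<close>.
\<close>

definition moving_proj ::
  "('v::euclidean_space \<times> 'v) set \<Rightarrow> ('v \<times> 'v \<Rightarrow> 'v \<times> 'v) \<Rightarrow> 'v \<times> 'v \<Rightarrow> 'v \<times> 'v" where
  "moving_proj B \<Phi> v = (\<Sum>e\<in>B. std_form (\<Phi> (std_J e)) v *\<^sub>R \<Phi> e)"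

lemma moving_proj_linear: "linear (moving_proj B \<Phi>)"
  by (rule linearI)
    (simp_all add: moving_proj_def std_form_simps scaleR_left_distrib scaleR_sum_right sum.distrib)

lemma moving_proj_image:
  assumes "linear \<Phi>" "\<And>u v. std_form (\<Phi> u) (\<Phi> v) = std_form u v"
  shows "moving_proj B \<Phi> (\<Phi> v) = \<Phi> (\<Sum>e\<in>B. (v \<bullet> e) *\<^sub>R e)"
proof -
  have "std_form (std_J e) v = v \<bullet> e" for e
    by (simp add: std_form_J std_J_inner inner_commute)
  then show ?thesis
    by (simp add: moving_proj_def assms(2) linear_sum[OF assms(1)] linear_scale[OF assms(1)])
qed

context
  fixes a b :: real and \<Phi> F :: "real \<Rightarrow> 'v::euclidean_space \<times> 'v \<Rightarrow> 'v \<times> 'v" and L M B :: "('v \<times> 'v) set"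
  assumes \<Phi>: "sympl_path a b \<Phi>" and F: "sympl_path a b F"
    and L: "lagrangian std_form L" and M: "lagrangian std_form M"
    and B: "finite B" "span B = L" "\<And>x. x \<in> L \<Longrightarrow> (\<Sum>e\<in>B. (x \<bullet> e) *\<^sub>R e) = x"
begin

abbreviation interp :: "real \<Rightarrow> real \<Rightarrow> 'v \<times> 'v \<Rightarrow> 'v \<times> 'v" where
  "interp s t v \<equiv> s *\<^sub>R F t v + (1 - s) *\<^sub>R moving_proj B (\<Phi> t) (F t v)"

lemma orthogonal_projection:
  fixes v :: "'v \<times> 'v"
  shows "(\<Sum>e\<in>B. (v \<bullet> e) *\<^sub>R e) \<in> L"
    and "l \<in> L \<Longrightarrow> (v - (\<Sum>e\<in>B. (v \<bullet> e) *\<^sub>R e)) \<bullet> l = 0"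
proof -
  show "(\<Sum>e\<in>B. (v \<bullet> e) *\<^sub>R e) \<in> L"
    unfolding B(2)[symmetric] by (intro span_sum span_scale span_base)
  assume "l \<in> L"
  then have "v \<bullet> l = v \<bullet> (\<Sum>e\<in>B. (l \<bullet> e) *\<^sub>R e)" using B(3) by simp
  also have "\<dots> = (\<Sum>e\<in>B. (v \<bullet> e) *\<^sub>R e) \<bullet> l"
    by (simp add: inner_sum_right inner_sum_left mult.commute inner_commute)
  finally show "(v - (\<Sum>e\<in>B. (v \<bullet> e) *\<^sub>R e)) \<bullet> l = 0" by (simp add: inner_diff_left)
qed

text \<open>
  In the coordinates given by \<open>\<Phi> t\<close>, the interpolation keeps the component along \<open>L\<close> and
  multiplies the orthogonal component by \<open>s\<close>.
\<close>

lemma interp_pullback: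
  assumes t: "t \<in> {a..b}"
  obtains v' where "F t v = \<Phi> t v'"
    and "interp s t v = \<Phi> t ((\<Sum>e\<in>B. (v' \<bullet> e) *\<^sub>R e) + s *\<^sub>R (v' - (\<Sum>e\<in>B. (v' \<bullet> e) *\<^sub>R e)))"
proof -
  have lin: "linear (\<Phi> t)" and sy: "\<And>u v. std_form (\<Phi> t u) (\<Phi> t v) = std_form u v"
    using sympl_pathD(1,2)[OF \<Phi> t] by simp_all
  have "surj (\<Phi> t)"
    using linear_injective_imp_surjective[OF lin std_sympl_inj[OF lin sy]] by simp
  then obtain v' where v': "F t v = \<Phi> t v'" by (rule surjE)
  show ?thesis
  proof (rule that[OF v'])
    show "interp s t v = \<Phi> t ((\<Sum>e\<in>B. (v' \<bullet> e) *\<^sub>R e) + s *\<^sub>R (v' - (\<Sum>e\<in>B. (v' \<bullet> e) *\<^sub>R e)))"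
      unfolding v' moving_proj_image[OF lin sy]
      by (simp add: linear_add[OF lin] linear_scale[OF lin] linear_diff[OF lin] algebra_simps)
  qed
qed

lemma interp_linear: "t \<in> {a..b} \<Longrightarrow> linear (interp s t)"
proof -
  assume "t \<in> {a..b}"
  then have lin: "linear (F t)" by (rule sympl_pathD(1)[OF F])
  show ?thesis
    by (rule linearI) (simp_all add: linear_add[OF lin] linear_scale[OF lin] linear_add[OF moving_proj_linear]
        linear_scale[OF moving_proj_linear] algebra_simps)
qed

text \<open>
  Both \<open>L\<close> and its orthogonal complement are isotropic, so only the mixed terms of the form
  survive, and each of them carries one factor \<open>s\<close>: the interpolation multiplies the form by
  \<open>s\<close>, and on \<open>M\<close> the form vanishes.
\<close>

lemma interp_isotropic:
  assumes t: "t \<in> {a..b}" and uv: "u \<in> M" "v \<in> M"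
  shows "std_form (interp s t u) (interp s t v) = 0"
proof -
  obtain u' where u': "F t u = \<Phi> t u'"
    "interp s t u = \<Phi> t ((\<Sum>e\<in>B. (u' \<bullet> e) *\<^sub>R e) + s *\<^sub>R (u' - (\<Sum>e\<in>B. (u' \<bullet> e) *\<^sub>R e)))"
    by (rule interp_pullback[OF t])
  obtain v' where v': "F t v = \<Phi> t v'"
    "interp s t v = \<Phi> t ((\<Sum>e\<in>B. (v' \<bullet> e) *\<^sub>R e) + s *\<^sub>R (v' - (\<Sum>e\<in>B. (v' \<bullet> e) *\<^sub>R e)))"
    by (rule interp_pullback[OF t])
  define p q where "p = (\<Sum>e\<in>B. (u' \<bullet> e) *\<^sub>R e)" and "q = (\<Sum>e\<in>B. (v' \<bullet> e) *\<^sub>R e)"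
  have sy: "std_form (\<Phi> t x) (\<Phi> t y) = std_form x y" "std_form (F t x) (F t y) = std_form x y" for x y
    using sympl_pathD(2)[OF \<Phi> t] sympl_pathD(2)[OF F t] by simp_all
  have "p \<in> L" "q \<in> L" unfolding p_def q_def by (rule orthogonal_projection(1))+
  then have 1: "std_form p q = 0" using L by (simp add: lagrangian_def)
  have 2: "std_form (u' - p) (v' - q) = 0"
    by (rule std_form_orthogonal_complement[OF L]) (simp_all only: p_def q_def orthogonal_projection(2))
  have "std_form u' v' = std_form u v" using sy(1)[of u' v'] sy(2)[of u v] u'(1) v'(1) by simp
  also have "\<dots> = 0" using M uv by (simp add: lagrangian_def)
  finally have 3: "std_form u' v' = 0" .
  have "std_form (interp s t u) (interp s t v) = std_form (p + s *\<^sub>R (u' - p)) (q + s *\<^sub>R (v' - q))"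
    unfolding u'(2) v'(2) sy p_def q_def ..
  also have "\<dots> = std_form p q + s * (std_form p (v' - q) + std_form (u' - p) q) + s * s * std_form (u' - p) (v' - q)"
    by (simp only: std_form_simps) (simp add: algebra_simps)
  also have "std_form p (v' - q) + std_form (u' - p) q = std_form u' v' - std_form (u' - p) (v' - q) - std_form p q"
    by (simp add: std_form_simps)
  finally show ?thesis using 1 2 3 by simp
qed

text \<open>
  The component along \<open>L\<close> does not depend on \<open>s\<close>.  Injectivity for \<open>s = 0\<close> therefore gives
  injectivity for all \<open>s\<close>.
\<close>

lemma interp_kernel:
  assumes t: "t \<in> {a..b}" and 0: "interp s t v = 0"
  shows "moving_proj B (\<Phi> t) (F t v) = 0"
proof -
  obtain v' where v': "F t v = \<Phi> t v'"
    "interp s t v = \<Phi> t ((\<Sum>e\<in>B. (v' \<bullet> e) *\<^sub>R e) + s *\<^sub>R (v' - (\<Sum>e\<in>B. (v' \<bullet> e) *\<^sub>R e)))"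
    by (rule interp_pullback[OF t])
  have lin: "linear (\<Phi> t)" and sy: "\<And>u v. std_form (\<Phi> t u) (\<Phi> t v) = std_form u v"
    using sympl_pathD(1,2)[OF \<Phi> t] by simp_all
  define q where "q = (\<Sum>e\<in>B. (v' \<bullet> e) *\<^sub>R e)"
  have "q + s *\<^sub>R (v' - q) = 0"
    using sympl_path_eq_0[OF \<Phi> t, of "q + s *\<^sub>R (v' - q)"] v'(2) 0 unfolding q_def by simp
  moreover have "q \<in> L" unfolding q_def by (rule orthogonal_projection)
  moreover from this have "(v' - q) \<bullet> q = 0" unfolding q_def by (rule orthogonal_projection)
  ultimately have "q \<bullet> q = 0"
    using inner_add_left[of q "s *\<^sub>R (v' - q)" q] by simp
  then have "q = 0" by simp
  then show ?thesis
    unfolding v'(1) moving_proj_image[OF lin sy] q_def[symmetric] by (simp add: linear_0[OF lin])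
qed

lemma interp_continuous:
  "continuous_on ({0..1} \<times> {a..b}) (\<lambda>p. interp (fst p) (snd p) v)"
proof -
  have c: "continuous_on ({0..1} \<times> {a..b}) (\<lambda>p. G (snd p) u)" if "sympl_path a b G" for G u
  proof -
    show ?thesis
      by (rule continuous_on_compose2[OF sympl_pathD(3)[OF that] continuous_on_snd[OF continuous_on_id]]) auto
  qed
  show ?thesis
    unfolding moving_proj_def std_form_def
    by (intro continuous_intros c F \<Phi>)
qed

text \<open>
  The homotopy is \<open>(s, t) \<mapsto> interp s t ` M\<close>.  The two conditions make it consist of Lagrangians
  and keep its ends off the cycle; they are open conditions, satisfied when \<open>F t ` M\<close> is close to
  \<open>\<Phi> t ` L\<close>.
\<close>

lemma near_curves_homologous:
  assumes cd: "a \<le> c" "c \<le> d" "d \<le> b"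
    and inj: "\<And>t v. t \<in> {c..d} \<Longrightarrow> v \<in> M \<Longrightarrow> moving_proj B (\<Phi> t) (F t v) = 0 \<Longrightarrow> v = 0"
    and ends: "\<And>s t v. s \<in> {0..1} \<Longrightarrow> t \<in> {c, d} \<Longrightarrow> v \<in> M \<Longrightarrow> fst (interp s t v) = 0 \<Longrightarrow> v = 0"
  shows "curve_class std_form ({0} \<times> UNIV) c d (\<lambda>t. \<Phi> t ` L) = curve_class std_form ({0} \<times> UNIV) c d (\<lambda>t. F t ` M)"
proof -
  let ?\<tau> = "\<lambda>x. c + x * (d - c)"
  have \<tau>: "?\<tau> x \<in> {c..d}" if "x \<in> {0..1}" for x :: real
    using that \<open>c \<le> d\<close> mult_left_le_one_le[of "d - c" x] by auto
  have "{c..d} \<subseteq> {a..b}" using cd by auto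
  with \<tau> have \<tau>': "?\<tau> x \<in> {a..b}" if "x \<in> {0..1}" for x :: real
    using that by blast
  have M': "subspace M" "2 * dim M = DIM('v \<times> 'v)" using M by (auto simp: lagrangian_def)
  have H: "continuous_map (top_of_set ({0..1} \<times> {0..1})) (lagr_grassmannian std_form)
      (\<lambda>p. interp (fst p) (?\<tau> (snd p)) ` M)"
  proof (rule continuous_map_lagr_grassmannian[OF M'])
    fix p :: "real \<times> real" assume "p \<in> topspace (top_of_set ({0..1} \<times> {0..1}))"
    then have p: "snd p \<in> {0..1}" by auto
    show "linear (interp (fst p) (?\<tau> (snd p)))" by (rule interp_linear[OF \<tau>'[OF p]])
    show "v = 0" if "v \<in> M" "interp (fst p) (?\<tau> (snd p)) v = 0" for v
      using inj[OF \<tau>[OF p] that(1) interp_kernel[OF \<tau>'[OF p] that(2)]] .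
    show "std_form (interp (fst p) (?\<tau> (snd p)) u) (interp (fst p) (?\<tau> (snd p)) v) = 0"
      if "u \<in> M" "v \<in> M" for u v
      by (rule interp_isotropic[OF \<tau>'[OF p] that])
  next
    fix v
    have "continuous_on ({0..1} \<times> {0..1}) (\<lambda>p. (fst p, ?\<tau> (snd p)))"
      by (intro continuous_intros)
    moreover have "(\<lambda>p. (fst p, ?\<tau> (snd p))) ` ({0..1} \<times> {0..1}) \<subseteq> {0..1} \<times> {a..b}"
      using \<tau>' by auto
    ultimately show "continuous_map (top_of_set ({0..1} \<times> {0..1})) euclidean (\<lambda>p. interp (fst p) (?\<tau> (snd p)) v)"
      using continuous_on_compose2[OF interp_continuous, of "{0..1} \<times> {0..1}" "\<lambda>p. (fst p, ?\<tau> (snd p))" v] by simp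
  qed
  have lag: "lagrangian std_form (interp s (?\<tau> x) ` M)" if "s \<in> {0..1}" "x \<in> {0..1}" for s x
  proof -
    have "(s, x) \<in> topspace (top_of_set ({0..1::real} \<times> {0..1::real}))" using that by simp
    then show ?thesis
      using continuous_map_lagrangian[OF H, of "(s, x)"] by simp
  qed
  have st: "interp s (?\<tau> x) ` M \<in> lagr_stratum std_form ({0} \<times> UNIV) 0"
    if s: "s \<in> {0..1}" and x: "x = 0 \<or> x = 1" for s x
  proof -
    have t: "?\<tau> x \<in> {c, d}" "x \<in> {0..1}" using x by auto
    have *: "interp s (?\<tau> x) v = 0" if "v \<in> M" "fst (interp s (?\<tau> x) v) = 0" for v
      using ends[OF s t(1) that] linear_0[OF interp_linear[OF \<tau>'[OF t(2)]]] by simp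
    have "interp s (?\<tau> x) ` M \<inter> ({0} \<times> UNIV) \<subseteq> {0}"
    proof
      fix w assume "w \<in> interp s (?\<tau> x) ` M \<inter> ({0} \<times> UNIV)"
      then have "w \<in> interp s (?\<tau> x) ` M" "fst w = 0" by (simp_all add: mem_Times_iff)
      then obtain v where "w = interp s (?\<tau> x) v" "v \<in> M" "fst (interp s (?\<tau> x) v) = 0" by blast
      then show "w \<in> {0}" using * by simp
    qed
    then show ?thesis
      using lag[OF s t(2)] unfolding lagr_stratum_def by (simp add: dim_eq_0)
  qed
  show ?thesis
  proof (rule curve_class_homotopic[OF H])
    fix x :: real assume x: "x \<in> {0..1}"
    \<comment> \<open>one inclusion is clear, and both sides are Lagrangian, hence of the same dimension\<close>
    have "interp 0 (?\<tau> x) ` M = \<Phi> (?\<tau> x) ` L"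
    proof (rule subspace_dim_equal)
      show "interp 0 (?\<tau> x) ` M \<subseteq> \<Phi> (?\<tau> x) ` L"
      proof
        fix w assume "w \<in> interp 0 (?\<tau> x) ` M"
        then obtain v where w: "w = interp 0 (?\<tau> x) v" by blast
        obtain v' where "interp 0 (?\<tau> x) v =
          \<Phi> (?\<tau> x) ((\<Sum>e\<in>B. (v' \<bullet> e) *\<^sub>R e) + 0 *\<^sub>R (v' - (\<Sum>e\<in>B. (v' \<bullet> e) *\<^sub>R e)))"
          by (rule interp_pullback[OF \<tau>'[OF x]])
        then show "w \<in> \<Phi> (?\<tau> x) ` L" using orthogonal_projection(1) unfolding w by simp
      qed
      show "dim (\<Phi> (?\<tau> x) ` L) \<le> dim (interp 0 (?\<tau> x) ` M)" "subspace (\<Phi> (?\<tau> x) ` L)" "subspace (interp 0 (?\<tau> x) ` M)"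
        using lag[of 0 x] sympl_path_lagrangian[OF \<Phi> L \<tau>'[OF x]] x unfolding lagrangian_def by auto
    qed
    then show "interp (fst (0, x)) (?\<tau> (snd (0, x))) ` M = \<Phi> (?\<tau> x) ` L" by simp
    show "interp (fst (1, x)) (?\<tau> (snd (1, x))) ` M = F (?\<tau> x) ` M" by simp
  qed (use st[of _ 0] st[of _ 1] in auto)
qed

end

section \<open>A compactness principle for zero sets\<close>

text \<open>
  If this fails, then the cones contain unit vectors for suitable indices tending to infinity and
  parameters tending to \<open>\<kappa>\<^sub>0\<close>, and a subsequence of these converges to a unit vector.  The cones
  of interest are zero sets of linear maps that depend on \<open>j\<close> and \<open>\<kappa>\<close>.
\<close>

lemma zero_sets_trivial_near:
  fixes Z :: "nat \<Rightarrow> 'k::metric_space \<Rightarrow> 'v::euclidean_space set"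
  assumes cone: "\<And>j \<kappa> v c. v \<in> Z j \<kappa> \<Longrightarrow> c *\<^sub>R v \<in> Z j \<kappa>"
    and lim: "\<And>r \<kappa> v v\<^sub>0. filterlim r at_top sequentially \<Longrightarrow> \<kappa> \<longlonglongrightarrow> \<kappa>\<^sub>0 \<Longrightarrow> (\<And>i. \<kappa> i \<in> X) \<Longrightarrow>
      (\<And>i. v i \<in> Z (r i) (\<kappa> i)) \<Longrightarrow> v \<longlonglongrightarrow> v\<^sub>0 \<Longrightarrow> v\<^sub>0 = 0"
  obtains \<epsilon> where "0 < \<epsilon>" "\<forall>\<^sub>F j in sequentially. \<forall>\<kappa>\<in>X. dist \<kappa> \<kappa>\<^sub>0 < \<epsilon> \<longrightarrow> Z j \<kappa> \<subseteq> {0}"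
proof (rule ccontr)
  assume neg: "\<not> thesis"
  have "\<exists>j\<ge>m. \<exists>\<kappa>\<in>X. dist \<kappa> \<kappa>\<^sub>0 < inverse (Suc m) \<and> (\<exists>v\<in>Z j \<kappa>. norm v = 1)" for m :: nat
  proof (rule ccontr)
    assume *: "\<not> ?thesis"
    have "Z j \<kappa> \<subseteq> {0}" if j: "j \<ge> m" and \<kappa>: "\<kappa> \<in> X" "dist \<kappa> \<kappa>\<^sub>0 < inverse (Suc m)" for j \<kappa>
    proof
      fix v assume v: "v \<in> Z j \<kappa>"
      show "v \<in> {0}"
      proof (rule ccontr)
        assume "v \<notin> {0}"
        then have "norm ((1 / norm v) *\<^sub>R v) = 1" by simp
        moreover have "(1 / norm v) *\<^sub>R v \<in> Z j \<kappa>" using v by (rule cone)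
        ultimately show False using * j \<kappa> by blast
      qed
    qed
    then have "\<forall>\<^sub>F j in sequentially. \<forall>\<kappa>\<in>X. dist \<kappa> \<kappa>\<^sub>0 < inverse (Suc m) \<longrightarrow> Z j \<kappa> \<subseteq> {0}"
      unfolding eventually_sequentially by blast
    moreover have "0 < inverse (real (Suc m))" by simp
    ultimately show False using neg that by blast
  qed
  then obtain r \<kappa> v where r: "\<And>m. m \<le> r m" and \<kappa>: "\<And>m. \<kappa> m \<in> X" "\<And>m. dist (\<kappa> m) \<kappa>\<^sub>0 < inverse (Suc m)"
    and v: "\<And>m. v m \<in> Z (r m) (\<kappa> m)" "\<And>m. norm (v m) = 1"
    by metis
  have "compact (sphere (0::'v) 1)" by simp
  then obtain v\<^sub>0 q where q: "strict_mono q" "(v \<circ> q) \<longlonglongrightarrow> v\<^sub>0" "v\<^sub>0 \<in> sphere 0 1"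
    using v(2) unfolding compact_def by (metis dist_0_norm mem_sphere)
  have "\<kappa> \<longlonglongrightarrow> \<kappa>\<^sub>0"
    unfolding tendsto_dist_iff[of \<kappa>]
    by (rule tendsto_sandwich[OF _ _ tendsto_const LIMSEQ_inverse_real_of_nat])
      (use \<kappa>(2) in \<open>auto intro!: always_eventually less_imp_le\<close>)
  then have 1: "(\<kappa> \<circ> q) \<longlonglongrightarrow> \<kappa>\<^sub>0"
    using q(1) by (simp add: LIMSEQ_subseq_LIMSEQ)
  have "filterlim r at_top sequentially"
    by (rule filterlim_at_top_mono[OF filterlim_ident]) (simp add: r)
  then have 2: "filterlim (r \<circ> q) at_top sequentially"
    unfolding comp_def using filterlim_compose filterlim_subseq[OF q(1)] by blast
  have "v\<^sub>0 = 0"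
    by (rule lim[OF 2 1 _ _ q(2)]) (use \<kappa>(1) v(1) in auto)
  with q(3) show False by simp
qed

text \<open>
  The local statement at each point of \<open>X\<close>, and a finite subcover.
\<close>

lemma zero_sets_trivial_compact:
  fixes Z :: "nat \<Rightarrow> 'k::metric_space \<Rightarrow> 'v::euclidean_space set"
  assumes cone: "\<And>j \<kappa> v c. v \<in> Z j \<kappa> \<Longrightarrow> c *\<^sub>R v \<in> Z j \<kappa>" and X: "compact X"
    and lim: "\<And>r \<kappa> \<kappa>\<^sub>0 v v\<^sub>0. filterlim r at_top sequentially \<Longrightarrow> \<kappa>\<^sub>0 \<in> X \<Longrightarrow> \<kappa> \<longlonglongrightarrow> \<kappa>\<^sub>0 \<Longrightarrow> (\<And>i. \<kappa> i \<in> X) \<Longrightarrow>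
      (\<And>i. v i \<in> Z (r i) (\<kappa> i)) \<Longrightarrow> v \<longlonglongrightarrow> v\<^sub>0 \<Longrightarrow> v\<^sub>0 = 0"
  shows "\<forall>\<^sub>F j in sequentially. \<forall>\<kappa>\<in>X. Z j \<kappa> \<subseteq> {0}"
proof -
  have "\<exists>\<epsilon>. 0 < \<epsilon> \<and> (\<forall>\<^sub>F j in sequentially. \<forall>\<kappa>\<in>X. dist \<kappa> \<kappa>\<^sub>0 < \<epsilon> \<longrightarrow> Z j \<kappa> \<subseteq> {0})" if "\<kappa>\<^sub>0 \<in> X" for \<kappa>\<^sub>0
  proof (rule zero_sets_trivial_near[of Z \<kappa>\<^sub>0 X])
    show "c *\<^sub>R v \<in> Z j \<kappa>" if "v \<in> Z j \<kappa>" for j \<kappa> v c by (rule cone[OF that])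
    show "v\<^sub>0 = 0" if "filterlim r at_top sequentially" "\<kappa> \<longlonglongrightarrow> \<kappa>\<^sub>0" "\<And>i. \<kappa> i \<in> X"
      "\<And>i. v i \<in> Z (r i) (\<kappa> i)" "v \<longlonglongrightarrow> v\<^sub>0" for r \<kappa> v v\<^sub>0
      by (rule lim[OF that(1) \<open>\<kappa>\<^sub>0 \<in> X\<close> that(2-5)])
  qed blast
  then obtain \<epsilon> where \<epsilon>: "\<forall>\<kappa>\<^sub>0\<in>X. 0 < \<epsilon> \<kappa>\<^sub>0 \<and>
      (\<forall>\<^sub>F j in sequentially. \<forall>\<kappa>\<in>X. dist \<kappa> \<kappa>\<^sub>0 < \<epsilon> \<kappa>\<^sub>0 \<longrightarrow> Z j \<kappa> \<subseteq> {0})"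
    using bchoice[of X "\<lambda>\<kappa>\<^sub>0 \<epsilon>. 0 < \<epsilon> \<and>
      (\<forall>\<^sub>F j in sequentially. \<forall>\<kappa>\<in>X. dist \<kappa> \<kappa>\<^sub>0 < \<epsilon> \<longrightarrow> Z j \<kappa> \<subseteq> {0})"] by blast
  obtain C where C: "C \<subseteq> X" "finite C" "X \<subseteq> (\<Union>\<kappa>\<in>C. ball \<kappa> (\<epsilon> \<kappa>))"
  proof (rule compactE_image[OF X, of X "\<lambda>\<kappa>. ball \<kappa> (\<epsilon> \<kappa>)"])
    show "X \<subseteq> (\<Union>\<kappa>\<in>X. ball \<kappa> (\<epsilon> \<kappa>))"
    proof
      fix \<kappa> assume "\<kappa> \<in> X"
      then have "\<kappa> \<in> ball \<kappa> (\<epsilon> \<kappa>)" using \<epsilon> by simp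
      then show "\<kappa> \<in> (\<Union>\<kappa>\<in>X. ball \<kappa> (\<epsilon> \<kappa>))" using \<open>\<kappa> \<in> X\<close> by blast
    qed
  qed auto
  have "\<forall>\<^sub>F j in sequentially. \<forall>\<kappa>\<^sub>0\<in>C. \<forall>\<kappa>\<in>X. dist \<kappa> \<kappa>\<^sub>0 < \<epsilon> \<kappa>\<^sub>0 \<longrightarrow> Z j \<kappa> \<subseteq> {0}"
    using \<epsilon> C(1) by (intro eventually_ball_finite[OF C(2)]) blast
  then show ?thesis
  proof eventually_elim
    case (elim j)
    show ?case
    proof
      fix \<kappa> assume \<kappa>: "\<kappa> \<in> X"
      then obtain \<kappa>\<^sub>0 where "\<kappa>\<^sub>0 \<in> C" "dist \<kappa> \<kappa>\<^sub>0 < \<epsilon> \<kappa>\<^sub>0"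
        using C(3) unfolding UN_iff subset_iff mem_ball by (metis dist_commute)
      then show "Z j \<kappa> \<subseteq> {0}" using elim \<kappa> by blast
    qed
  qed
qed

section \<open>Linear algebra of a quadruple\<close>

lemma sym_bilinear_on_sum:
  assumes S: "sym_bilinear_on P S" and P: "subspace P" and f: "\<And>i. i \<in> I \<Longrightarrow> f i \<in> P" and w: "w \<in> P"
  shows "S (\<Sum>i\<in>I. c i *\<^sub>R f i) w = (\<Sum>i\<in>I. c i * S (f i) w)"
proof -
  have scale: "S (r *\<^sub>R x) w = r * S x w" and add: "S (x + y) w = S x w + S y w"
    if "x \<in> P" "y \<in> P" for r x y
    using S w that by (auto simp: sym_bilinear_on_def)
  have zero: "S 0 w = 0" using scale[of 0 0 0] subspace_0[OF P] by simp
  show ?thesis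
  proof (cases "finite I")
    case True
    then show ?thesis using f
    proof (induction I)
      case empty
      then show ?case by (simp add: zero)
    next
      case (insert i I)
      then have "f i \<in> P" and I: "(\<Sum>i\<in>I. c i *\<^sub>R f i) \<in> P"
        by (auto intro!: subspace_sum[OF P] subspace_scale[OF P])
      then have "S (c i *\<^sub>R f i + (\<Sum>i\<in>I. c i *\<^sub>R f i)) w = c i * S (f i) w + S (\<Sum>i\<in>I. c i *\<^sub>R f i) w"
        using add[OF subspace_scale[OF P] I] scale by simp
      then show ?case using insert by simp
    qed
  qed (simp add: zero)
qed

lemma sym_bilinear_on_commute: "sym_bilinear_on P S \<Longrightarrow> x \<in> P \<Longrightarrow> y \<in> P \<Longrightarrow> S x y = S y x"
  by (simp add: sym_bilinear_on_def)

text \<open>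
  The operator \<open>G\<close> with \<open>g x y = x \<bullet> G y\<close>.
\<close>

definition gram_operator :: "('v::euclidean_space \<Rightarrow>\<^sub>L 'v \<Rightarrow>\<^sub>L real) \<Rightarrow> 'v \<Rightarrow> 'v" where
  "gram_operator g y = (\<Sum>e\<in>Basis. g e y *\<^sub>R e)"

lemma inner_gram_operator: "x \<bullet> gram_operator g y = g x y"
proof -
  have "g x y = g (\<Sum>e\<in>Basis. (x \<bullet> e) *\<^sub>R e) y" by (simp add: euclidean_representation)
  also have "\<dots> = (\<Sum>e\<in>Basis. (x \<bullet> e) * g e y)"
    by (simp add: blinfun.sum_right blinfun.scaleR_right blinfun.sum_left blinfun.scaleR_left)
  finally show ?thesis by (simp add: gram_operator_def inner_sum_right mult.commute)
qed

lemma linear_gram_operator: "linear (gram_operator g)"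
  by (rule linearI)
    (simp_all add: gram_operator_def blinfun.add_right blinfun.scaleR_right scaleR_add_left sum.distrib scaleR_sum_right)

lemma inj_gram_operator:
  fixes g :: "'v::euclidean_space \<Rightarrow>\<^sub>L 'v \<Rightarrow>\<^sub>L real"
  assumes "\<And>x y. g x y = g y x" "nondegenerate_on UNIV g"
  shows "inj (gram_operator g)"
  unfolding linear_injective_0[OF linear_gram_operator]
proof (intro allI impI)
  fix y assume 0: "gram_operator g y = 0"
  have "g y x = 0" for x
    using inner_gram_operator[of x g y] 0 assms(1)[of x y] by simp
  then show "y = 0" using assms(2) by (auto simp: nondegenerate_on_def)
qed

definition std_map :: "('v::euclidean_space \<Rightarrow>\<^sub>L 'v \<Rightarrow>\<^sub>L real) \<Rightarrow> 'v \<times> 'v \<Rightarrow> 'v \<times> 'v" where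
  "std_map g p = (fst p, gram_operator g (snd p))"

lemma linear_std_map: "linear (std_map g)"
  by (rule linearI) (simp_all add: std_map_def linear_add[OF linear_gram_operator] linear_scale[OF linear_gram_operator])

text \<open>
  Here \<open>std_form ((x\<^sub>1, G x\<^sub>2), (y\<^sub>1, G y\<^sub>2)) = g x\<^sub>1 y\<^sub>2 - g y\<^sub>1 x\<^sub>2\<close>, which is the symplectic form of \<open>g\<close>
  by symmetry.  The first component is untouched, so \<open>{0} \<times> UNIV\<close> is preserved.
\<close>

lemma std_map_iso:
  fixes g :: "'v::euclidean_space \<Rightarrow>\<^sub>L 'v \<Rightarrow>\<^sub>L real"
  assumes sym: "\<And>x y. g x y = g y x" and nd: "nondegenerate_on UNIV g"
  obtains D' where "sympl_iso (sympl_form g) std_form (std_map g) D' ({0} \<times> UNIV) ({0} \<times> UNIV)"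
proof -
  obtain G' where G': "linear G'" "\<forall>x. G' (gram_operator g x) = x" "\<forall>x. gram_operator g (G' x) = x"
    using linear_injective_isomorphism[OF linear_gram_operator inj_gram_operator[OF sym nd]] by blast
  show ?thesis
  proof (rule that, rule sympl_iso.intro)
    show "linear (std_map g)" by (rule linear_std_map)
    show "linear (\<lambda>p. (fst p, G' (snd p)))"
      by (rule linearI) (simp_all add: linear_add[OF G'(1)] linear_scale[OF G'(1)])
    show "std_form (std_map g u) (std_map g v) = sympl_form g u v" for u v
      by (simp add: std_form_def std_map_def sympl_form_def inner_gram_operator inner_commute[of "gram_operator g _"] sym[of "fst v"])
    show "std_map g ` ({0} \<times> UNIV) = {0} \<times> UNIV"
    proof -
      have "(0, y) \<in> std_map g ` ({0} \<times> UNIV)" for y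
        using G'(3) by (intro image_eqI[of _ _ "(0, G' y)"]) (simp_all add: std_map_def)
      then show ?thesis by (auto simp: std_map_def)
    qed
  qed (simp_all add: std_map_def G')
qed

text \<open>
  Nondegeneracy of \<open>g\<close> on \<open>P\<close> makes the compression \<open>T\<close> of the Gram operator to \<open>P\<close> injective,
  hence surjective, so every functional on \<open>P\<close> is represented through \<open>g\<close>.
\<close>

lemma form_op_exists:
  fixes g :: "'v::euclidean_space \<Rightarrow>\<^sub>L 'v \<Rightarrow>\<^sub>L real"
  assumes sym: "\<And>x y. g x y = g y x" and P: "subspace P" and nd: "nondegenerate_on P g"
    and S: "sym_bilinear_on P S" and x: "x \<in> P"
  shows "form_op g P S x \<in> P" and "w \<in> P \<Longrightarrow> g (form_op g P S x) w = S x w"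
proof -
  obtain B where B: "finite B" "span B = P" "\<And>x. x \<in> P \<Longrightarrow> (\<Sum>b\<in>B. (x \<bullet> b) *\<^sub>R b) = x"
    using orthonormal_expansion[OF P] by blast
  have BP: "b \<in> P" if "b \<in> B" for b using B(2) that span_base by blast
  have dual: "(\<Sum>b\<in>B. f b *\<^sub>R b) \<bullet> w = (\<Sum>b\<in>B. f b * (w \<bullet> b))" for f w
    by (simp add: inner_sum_left inner_commute[of w])
  define T where "T u = (\<Sum>b\<in>B. (gram_operator g u \<bullet> b) *\<^sub>R b)" for u
  have linT: "linear T"
    by (rule linearI) (simp_all add: T_def linear_add[OF linear_gram_operator] linear_scale[OF linear_gram_operator]
        inner_add_left scaleR_add_left sum.distrib scaleR_sum_right)
  have T: "T u \<bullet> w = g u w" if "w \<in> P" for u w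
  proof -
    have "T u \<bullet> w = (\<Sum>b\<in>B. (w \<bullet> b) *\<^sub>R b) \<bullet> gram_operator g u"
      unfolding T_def dual by (simp add: inner_sum_left inner_commute mult.commute)
    then show ?thesis using B(3)[OF that] inner_gram_operator[of w g u] sym[of w u] by simp
  qed
  have TP: "T ` P \<subseteq> P" unfolding T_def using BP by (auto intro!: subspace_sum[OF P] subspace_scale[OF P])
  have "inj_on T (span P)"
    unfolding span_eq_iff[THEN iffD2, OF P]
  proof (rule inj_onI)
    fix u v assume uv: "u \<in> P" "v \<in> P" "T u = T v"
    have "g (u - v) w = 0" if "w \<in> P" for w
      using T[OF that, of u] T[OF that, of v] uv(3) by (simp add: blinfun.diff_right blinfun.diff_left)
    then have "u - v = 0" using nd subspace_diff[OF P uv(1,2)] unfolding nondegenerate_on_def by blast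
    then show "u = v" by simp
  qed
  then have "dim (T ` P) = dim P" by (rule dim_image_eq[OF linT])
  then have "T ` P = P"
    using TP P by (intro subspace_dim_equal linear_subspace_image[OF linT]) auto
  moreover have "(\<Sum>b\<in>B. S x b *\<^sub>R b) \<in> P" using BP by (intro subspace_sum[OF P] subspace_scale[OF P])
  \<comment> \<open>the right-hand side represents the functional \<open>S x\<close> through the inner product\<close>
  ultimately obtain u where u: "u \<in> P" "T u = (\<Sum>b\<in>B. S x b *\<^sub>R b)" by (metis imageE)
  have gu: "g u w = S x w" if "w \<in> P" for w
  proof -
    have "g u w = (\<Sum>b\<in>B. S x b * (w \<bullet> b))" using T[OF that, of u] u(2) dual by simp
    also have "\<dots> = S (\<Sum>b\<in>B. (w \<bullet> b) *\<^sub>R b) x"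
      using sym_bilinear_on_commute[OF S x] BP
      by (subst sym_bilinear_on_sum[OF S P _ x]) (auto intro!: sum.cong)
    also have "\<dots> = S x w" using B(3)[OF that] sym_bilinear_on_commute[OF S x that] by simp
    finally show ?thesis .
  qed
  have "form_op g P S x = u"
    unfolding form_op_def
  proof (rule the_equality)
    show "u \<in> P \<and> (\<forall>w\<in>P. S x w = g u w)" using u(1) gu by simp
    fix u' assume u': "u' \<in> P \<and> (\<forall>w\<in>P. S x w = g u' w)"
    have "g (u' - u) w = 0" if "w \<in> P" for w
      using u' gu[OF that] that by (simp add: blinfun.diff_right blinfun.diff_left)
    then have "u' - u = 0" using nd subspace_diff[OF P _ u(1)] u' unfolding nondegenerate_on_def by blast
    then show "u' = u" by simp
  qed
  with u(1) gu show "form_op g P S x \<in> P" "w \<in> P \<Longrightarrow> g (form_op g P S x) w = S x w" by simp_all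
qed

lemma initial_lagrangian_iff:
  fixes g :: "'v::euclidean_space \<Rightarrow>\<^sub>L 'v \<Rightarrow>\<^sub>L real"
  assumes "\<And>x y. g x y = g y x" "subspace P" "nondegenerate_on P g" "sym_bilinear_on P S"
  shows "q \<in> initial_lagrangian g P S \<longleftrightarrow> fst q \<in> P \<and> (\<forall>w\<in>P. g (snd q) w = - S (fst q) w)"
proof (cases "fst q \<in> P")
  case True
  have "g (snd q + form_op g P S (fst q)) w = g (snd q) w + S (fst q) w" if "w \<in> P" for w
    using form_op_exists(2)[OF assms True that] by (simp add: blinfun.add_right blinfun.add_left)
  then show ?thesis
    using True unfolding initial_lagrangian_def form_perp_def
    by (auto simp: case_prod_beta eq_neg_iff_add_eq_0)
qed (simp add: initial_lagrangian_def case_prod_beta)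

text \<open>
  The image of the initial Lagrangian in the standard model is the conormal space of \<open>P\<close> tilted by
  \<open>S\<close>.  It equals its annihilator: testing \<open>v\<close> against \<open>(0, p)\<close> with \<open>p\<close> orthogonal to \<open>P\<close> gives
  \<open>fst v \<in> P\<close>, and testing against one element above each \<open>w \<in> P\<close> then determines \<open>snd v\<close> on
  \<open>P\<close>.
\<close>

lemma lagrangian_graph_like:
  fixes P :: "'v::euclidean_space set"
  assumes P: "subspace P" and S: "sym_bilinear_on P S"
  shows "lagrangian std_form {q. fst q \<in> P \<and> (\<forall>w\<in>P. snd q \<bullet> w = - S (fst q) w)}" (is "lagrangian _ ?K")
  unfolding lagrangian_std_iff
proof
  have add: "S (x + y) w = S x w + S y w" and scale: "S (c *\<^sub>R x) w = c * S x w"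
    if "x \<in> P" "y \<in> P" "w \<in> P" for x y w c
    using S that by (auto simp: sym_bilinear_on_def)
  have zero: "S 0 w = 0" if "w \<in> P" for w using scale[of 0 0 w 0] subspace_0[OF P] that by simp
  show "subspace ?K"
  proof (rule subspaceI)
    show "0 \<in> ?K" by (simp add: subspace_0[OF P] zero)
    fix p q c assume p: "p \<in> ?K"
    then show "c *\<^sub>R p \<in> ?K" by (simp add: subspace_scale[OF P] scale)
    assume "q \<in> ?K"
    with p show "p + q \<in> ?K" by (simp add: subspace_add[OF P] inner_add_left add)
  qed
  show "?K = {v. \<forall>w\<in>?K. std_form v w = 0}"
  proof (intro equalityI subsetI)
    fix v assume v: "v \<in> ?K"
    have "std_form v w = 0" if w: "w \<in> ?K" for w
    proof -
      have "fst v \<bullet> snd w = - S (fst w) (fst v)" "snd v \<bullet> fst w = - S (fst v) (fst w)"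
        using v w by (simp_all add: inner_commute)
      then show ?thesis using sym_bilinear_on_commute[OF S, of "fst v" "fst w"] v w by (simp add: std_form_def)
    qed
    then show "v \<in> {v. \<forall>w\<in>?K. std_form v w = 0}" by blast
  next
    fix v assume "v \<in> {v. \<forall>w\<in>?K. std_form v w = 0}"
    then have v: "fst v \<bullet> p = snd v \<bullet> x" if "x \<in> P" "\<And>w. w \<in> P \<Longrightarrow> p \<bullet> w = - S x w" for x p
      using that by (force simp: std_form_def)
    obtain B where B: "finite B" "span B = P" "\<And>x. x \<in> P \<Longrightarrow> (\<Sum>b\<in>B. (x \<bullet> b) *\<^sub>R b) = x"
      using orthonormal_expansion[OF P] by blast
    have BP: "b \<in> P" if "b \<in> B" for b using B(2) that span_base by blast
    define u where "u = (\<Sum>b\<in>B. (fst v \<bullet> b) *\<^sub>R b)"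
    have uP: "u \<in> P" unfolding u_def using BP by (intro subspace_sum[OF P] subspace_scale[OF P])
    have perp: "(fst v - u) \<bullet> w = 0" if "w \<in> P" for w
    proof -
      have "u \<bullet> w = fst v \<bullet> (\<Sum>b\<in>B. (w \<bullet> b) *\<^sub>R b)"
        by (simp add: u_def inner_sum_left inner_sum_right mult.commute inner_commute)
      then show ?thesis using B(3)[OF that] by (simp add: inner_diff_left)
    qed
    have "fst v \<bullet> (fst v - u) = 0"
      using v[of 0 "fst v - u"] perp by (simp add: subspace_0[OF P] zero)
    moreover have "u \<bullet> (fst v - u) = 0" using perp[OF uP] by (simp add: inner_commute)
    ultimately have "(fst v - u) \<bullet> (fst v - u) = 0" by (simp add: inner_diff_left)
    then have fP: "fst v \<in> P" using uP by simp
    have "snd v \<bullet> w = - S (fst v) w" if w: "w \<in> P" for w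
    proof -
      define p where "p = (\<Sum>b\<in>B. - S w b *\<^sub>R b)"
      have p: "p \<bullet> y = - S w y" if y: "y \<in> P" for y
      proof -
        have "p \<bullet> y = - (\<Sum>b\<in>B. (y \<bullet> b) * S w b)"
          by (simp add: p_def inner_sum_left inner_commute[of y] sum_negf mult.commute)
        also have "(\<Sum>b\<in>B. (y \<bullet> b) * S w b) = (\<Sum>b\<in>B. (y \<bullet> b) * S b w)"
          using sym_bilinear_on_commute[OF S w BP] by (intro sum.cong) simp_all
        also have "(\<Sum>b\<in>B. (y \<bullet> b) * S b w) = S (\<Sum>b\<in>B. (y \<bullet> b) *\<^sub>R b) w"
          by (rule sym_bilinear_on_sum[OF S P BP w, symmetric])
        finally show ?thesis using B(3)[OF y] sym_bilinear_on_commute[OF S w y] by simp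
      qed
      show ?thesis
        using v[OF w p] p[OF fP] sym_bilinear_on_commute[OF S w fP] by (simp add: inner_commute)
    qed
    with fP show "v \<in> ?K" by simp
  qed
qed

text \<open>
  The derivative of the form along two solutions is \<open>g x (R y) - g (R x) y\<close>, which vanishes
  because \<open>R\<close> is symmetric with respect to \<open>g\<close>.
\<close>

lemma flow_symplectic:
  fixes R :: "real \<Rightarrow> 'v::euclidean_space \<Rightarrow>\<^sub>L 'v" and g :: "'v \<Rightarrow>\<^sub>L 'v \<Rightarrow>\<^sub>L real"
  assumes R: "continuous_on {a..b} R" and sym: "\<And>t x y. t \<in> {a..b} \<Longrightarrow> g (R t x) y = g x (R t y)"
    and t: "t \<in> {a..b}"
  shows "sympl_form g (flow a b R t p) (flow a b R t q) = sympl_form g p q"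
proof -
  have "a \<le> b" using t by simp
  let ?u = "\<lambda>s. flow a b R s p" and ?v = "\<lambda>s. flow a b R s q"
  have bb: "bounded_bilinear (\<lambda>x y. g x y)"
    by (rule bounded_bilinear.comp1[OF bounded_bilinear_blinfun_apply blinfun.bounded_linear_right])
  have "((\<lambda>s. sympl_form g (?u s) (?v s)) has_vector_derivative 0) (at s within {a..b})" if s: "s \<in> {a..b}" for s
  proof -
    have f: "((\<lambda>s. fst (flow a b R s x)) has_vector_derivative snd (flow a b R s x)) (at s within {a..b})"
      and sd: "((\<lambda>s. snd (flow a b R s x)) has_vector_derivative R s (fst (flow a b R s x))) (at s within {a..b})" for x
      using bounded_linear.has_vector_derivative[OF bounded_linear_fst flow_derivative[OF R s, of x]]
        bounded_linear.has_vector_derivative[OF bounded_linear_snd flow_derivative[OF R s, of x]] by simp_all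
    have "((\<lambda>s. sympl_form g (?u s) (?v s)) has_vector_derivative
      (g (fst (?u s)) (R s (fst (?v s))) + g (snd (?u s)) (snd (?v s)))
      - (g (snd (?u s)) (snd (?v s)) + g (R s (fst (?u s))) (fst (?v s)))) (at s within {a..b})"
      unfolding sympl_form_def
      by (intro has_vector_derivative_diff bounded_bilinear.has_vector_derivative[OF bb] f sd)
    then show ?thesis by (simp add: sym[OF s])
  qed
  then obtain c where c: "\<And>s. s \<in> {a..b} \<Longrightarrow> sympl_form g (?u s) (?v s) = c"
    using has_vector_derivative_zero_constant[of "{a..b}" "\<lambda>s. sympl_form g (?u s) (?v s)"] by auto
  from c[OF t] c[of a] \<open>a \<le> b\<close> show ?thesis
    by (simp add: ode_solution_flow(2)[OF R \<open>a \<le> b\<close>])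
qed

section \<open>Limits of quadruples\<close>

text \<open>
  Uniform independence of the converging frames bounds the coordinates of \<open>x i\<close>, so replacing the
  moving frame by the limit frame costs nothing in the limit, and the coordinates converge.  A
  test vector of \<open>P'\<close> is approximated by the vectors with the same coordinates in the moving
  frames.  The index map \<open>r\<close> allows for subsequences.
\<close>

lemma GB_limit:
  fixes P :: "nat \<Rightarrow> 'v::euclidean_space set"
  assumes GB: "GB_tendsto k P S P' S'"
    and S: "\<And>j. subspace (P j)" "\<And>j. sym_bilinear_on (P j) (S j)" and S': "subspace P'" "sym_bilinear_on P' S'"
    and r: "filterlim r at_top sequentially"
    and x: "\<And>i. x i \<in> P (r i)" "x \<longlonglongrightarrow> x'"
  shows "x' \<in> P'"
    and "w \<in> P' \<Longrightarrow> \<exists>w'. (\<forall>i. w' i \<in> P (r i)) \<and> w' \<longlonglongrightarrow> w \<and> (\<lambda>i. S (r i) (x i) (w' i)) \<longlonglongrightarrow> S' x' w"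
proof -
  obtain e e' where e: "\<And>j. is_frame k (e j) (P j)" and e': "is_frame k e' P'"
    and lim: "\<And>l. l < k \<Longrightarrow> (\<lambda>j. e j l) \<longlonglongrightarrow> e' l"
    and limS: "\<And>\<alpha> \<beta>. \<alpha> < k \<Longrightarrow> \<beta> < k \<Longrightarrow> (\<lambda>j. S j (e j \<alpha>) (e j \<beta>)) \<longlonglongrightarrow> S' (e' \<alpha>) (e' \<beta>)"
    using GB unfolding GB_tendsto_def by blast
  have ie: "inj_on (e j) {..<k}" "span (e j ` {..<k}) = P j" for j
    using e[of j] by (simp_all add: is_frame_def)
  have ie': "inj_on e' {..<k}" "independent (e' ` {..<k})" "span (e' ` {..<k}) = P'"
    using e' by (simp_all add: is_frame_def)
  have limr: "(\<lambda>i. e (r i) l) \<longlonglongrightarrow> e' l" if "l < k" for l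
    by (rule filterlim_compose[OF lim[OF that] r])
  have eP: "e j l \<in> P j" if "l < k" for j l
    using that span_base[of "e j l" "e j ` {..<k}"] ie(2)[of j] by simp
  have eP': "e' l \<in> P'" if "l < k" for l
    using that span_base[of "e' l" "e' ` {..<k}"] ie'(3) by simp
  obtain m \<delta> where m: "0 < m" "0 < \<delta>"
    "\<And>f c. (\<And>l. l < k \<Longrightarrow> dist (f l) (e' l) < \<delta>) \<Longrightarrow> m * (\<Sum>l<k. \<bar>c l\<bar>) \<le> norm (\<Sum>l<k. c l *\<^sub>R f l)"
    using frame_stability[OF ie'(1,2)] by blast
  have "\<exists>c. x i = (\<Sum>l<k. c l *\<^sub>R e (r i) l)" for i
    using x(1)[of i] in_span_frame_iff[OF ie(1), of "x i" "r i"] unfolding ie(2) by simp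
  then obtain c where c: "\<And>i. x i = (\<Sum>l<k. c i l *\<^sub>R e (r i) l)" by metis
  have close: "\<forall>\<^sub>F i in sequentially. \<forall>l\<in>{..<k}. dist (e (r i) l) (e' l) < \<delta>"
    using tendstoD[OF limr m(2)] by (intro eventually_ball_finite) auto
  obtain Bd where Bd: "\<And>i. norm (x i) \<le> Bd"
    using x(2) convergent_imp_Bseq[of x] unfolding Bseq_def convergent_def by blast
  have bdd: "\<forall>\<^sub>F i in sequentially. (\<Sum>l<k. \<bar>c i l\<bar>) \<le> Bd / m"
    using close
  proof eventually_elim
    case (elim i)
    then have "m * (\<Sum>l<k. \<bar>c i l\<bar>) \<le> norm (x i)"
      unfolding c[of i] by (intro m(3)) auto
    then show ?case using Bd[of i] \<open>0 < m\<close> by (simp add: field_simps)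
  qed
  define y where "y i = (\<Sum>l<k. c i l *\<^sub>R e' l)" for i
  have y: "y i \<in> P'" for i
    unfolding y_def ie'(3)[symmetric] by (rule frame_sum_in_span)
  have "(\<lambda>i. y i - x i) \<longlonglongrightarrow> 0"
  proof (rule Lim_null_comparison)
    show "\<forall>\<^sub>F i in sequentially. norm (y i - x i) \<le> (\<Sum>l<k. Bd / m * norm (e' l - e (r i) l))"
      using bdd
    proof eventually_elim
      case (elim i)
      have "y i - x i = (\<Sum>l<k. c i l *\<^sub>R (e' l - e (r i) l))"
        by (simp add: y_def c[of i] sum_subtractf[symmetric] scaleR_right_diff_distrib)
      then have "norm (y i - x i) \<le> (\<Sum>l<k. norm (c i l *\<^sub>R (e' l - e (r i) l)))"
        using norm_sum by metis
      also have "\<dots> \<le> (\<Sum>l<k. Bd / m * norm (e' l - e (r i) l))"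
      proof (rule sum_mono)
        fix l assume "l \<in> {..<k}"
        then have "\<bar>c i l\<bar> \<le> (\<Sum>l<k. \<bar>c i l\<bar>)" by (intro member_le_sum) auto
        then have "\<bar>c i l\<bar> \<le> Bd / m" using elim by simp
        then show "norm (c i l *\<^sub>R (e' l - e (r i) l)) \<le> Bd / m * norm (e' l - e (r i) l)"
          using mult_right_mono[of "\<bar>c i l\<bar>" "Bd / m" "norm (e' l - e (r i) l)"] by simp
      qed
      finally show ?case .
    qed
    have "(\<lambda>i. \<Sum>l<k. Bd / m * norm (e' l - e (r i) l)) \<longlonglongrightarrow> (\<Sum>l<k. Bd / m * norm (e' l - e' l))"
      by (intro tendsto_intros limr) auto
    then show "(\<lambda>i. \<Sum>l<k. Bd / m * norm (e' l - e (r i) l)) \<longlonglongrightarrow> 0" by simp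
  qed
  from tendsto_add[OF this x(2)] have ylim: "y \<longlonglongrightarrow> x'" by simp
  show x': "x' \<in> P'"
    by (rule closed_sequentially[OF closed_subspace[OF S'(1)] y ylim])
  then obtain c' where c': "x' = (\<Sum>l<k. c' l *\<^sub>R e' l)"
    using in_span_frame_iff[OF ie'(1), of x'] unfolding ie'(3) by blast
  have clim: "(\<lambda>i. c i l) \<longlonglongrightarrow> c' l" if l: "l < k" for l
  proof -
    have "(\<lambda>i. c i l - c' l) \<longlonglongrightarrow> 0"
    proof (rule Lim_null_comparison)
      have "norm (c i l - c' l) \<le> norm (y i - x') / m" for i
      proof -
        have "\<bar>c i l - c' l\<bar> \<le> (\<Sum>l<k. \<bar>c i l - c' l\<bar>)" using l by (intro member_le_sum[of l "{..<k}" "\<lambda>l. \<bar>c i l - c' l\<bar>"]) auto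
        moreover have "m * (\<Sum>l<k. \<bar>c i l - c' l\<bar>) \<le> norm (\<Sum>l<k. (c i l - c' l) *\<^sub>R e' l)"
          using m(2) by (intro m(3)) auto
        moreover have "(\<Sum>l<k. (c i l - c' l) *\<^sub>R e' l) = y i - x'"
          by (simp add: y_def c' sum_subtractf[symmetric] scaleR_left_diff_distrib)
        ultimately have "m * \<bar>c i l - c' l\<bar> \<le> norm (y i - x')"
          using \<open>0 < m\<close> by (smt (verit) mult_left_mono)
        then show ?thesis using \<open>0 < m\<close> by (simp add: field_simps)
      qed
      then show "\<forall>\<^sub>F i in sequentially. norm (c i l - c' l) \<le> norm (y i - x') / m" by simp
      have "(\<lambda>i. norm (y i - x') / m) \<longlonglongrightarrow> norm (x' - x') / m"
        using \<open>0 < m\<close> by (intro tendsto_intros ylim) auto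
      then show "(\<lambda>i. norm (y i - x') / m) \<longlonglongrightarrow> 0" by simp
    qed
    then show ?thesis by (simp add: LIM_zero_iff)
  qed
  assume w: "w \<in> P'"
  then obtain d where d: "w = (\<Sum>l<k. d l *\<^sub>R e' l)"
    using in_span_frame_iff[OF ie'(1), of w] unfolding ie'(3) by blast
  define w' where "w' i = (\<Sum>l<k. d l *\<^sub>R e (r i) l)" for i
  have w': "w' i \<in> P (r i)" for i
    unfolding w'_def ie(2)[symmetric] by (rule frame_sum_in_span)
  have "w' \<longlonglongrightarrow> w"
    unfolding w'_def d by (intro tendsto_intros limr) auto
  moreover have "(\<lambda>i. S (r i) (x i) (w' i)) \<longlonglongrightarrow> S' x' w"
  proof -
    have expand: "T (\<Sum>l<k. f l *\<^sub>R E l) (\<Sum>l<k. h l *\<^sub>R E l) = (\<Sum>\<alpha><k. \<Sum>\<beta><k. f \<alpha> * h \<beta> * T (E \<alpha>) (E \<beta>))"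
      if T: "sym_bilinear_on Q T" and Q: "subspace Q" and E: "\<And>l. l < k \<Longrightarrow> E l \<in> Q" for Q T E and f h :: "nat \<Rightarrow> real"
    proof -
      have hQ: "(\<Sum>l<k. h l *\<^sub>R E l) \<in> Q"
        using E by (intro subspace_sum[OF Q] subspace_scale[OF Q]) auto
      have "T (\<Sum>l<k. f l *\<^sub>R E l) (\<Sum>l<k. h l *\<^sub>R E l) = (\<Sum>\<alpha><k. f \<alpha> * T (E \<alpha>) (\<Sum>l<k. h l *\<^sub>R E l))"
        using E hQ by (intro sym_bilinear_on_sum[OF T Q]) auto
      also have "\<dots> = (\<Sum>\<alpha><k. f \<alpha> * (\<Sum>\<beta><k. h \<beta> * T (E \<beta>) (E \<alpha>)))"
      proof (rule sum.cong[OF refl])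
        fix \<alpha> assume "\<alpha> \<in> {..<k}"
        then have \<alpha>: "E \<alpha> \<in> Q" using E by simp
        have "T (\<Sum>l<k. h l *\<^sub>R E l) (E \<alpha>) = (\<Sum>\<beta><k. h \<beta> * T (E \<beta>) (E \<alpha>))"
          using E \<alpha> by (intro sym_bilinear_on_sum[OF T Q]) auto
        then show "f \<alpha> * T (E \<alpha>) (\<Sum>l<k. h l *\<^sub>R E l) = f \<alpha> * (\<Sum>\<beta><k. h \<beta> * T (E \<beta>) (E \<alpha>))"
          using sym_bilinear_on_commute[OF T \<alpha> hQ] by simp
      qed
      also have "\<dots> = (\<Sum>\<alpha><k. \<Sum>\<beta><k. f \<alpha> * h \<beta> * T (E \<alpha>) (E \<beta>))"
        using sym_bilinear_on_commute[OF T] E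
        by (intro sum.cong[OF refl]) (simp add: sum_distrib_left mult.assoc)
      finally show ?thesis .
    qed
    have "(\<lambda>i. \<Sum>\<alpha><k. \<Sum>\<beta><k. c i \<alpha> * d \<beta> * S (r i) (e (r i) \<alpha>) (e (r i) \<beta>)) \<longlonglongrightarrow>
        (\<Sum>\<alpha><k. \<Sum>\<beta><k. c' \<alpha> * d \<beta> * S' (e' \<alpha>) (e' \<beta>))"
    proof (intro tendsto_sum tendsto_mult tendsto_const)
      fix \<alpha> \<beta> assume ab: "\<alpha> \<in> {..<k}" "\<beta> \<in> {..<k}"
      then show "(\<lambda>i. c i \<alpha>) \<longlonglongrightarrow> c' \<alpha>" by (intro clim) simp
      show "(\<lambda>i. S (r i) (e (r i) \<alpha>) (e (r i) \<beta>)) \<longlonglongrightarrow> S' (e' \<alpha>) (e' \<beta>)"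
        using filterlim_compose[OF limS[of \<alpha> \<beta>] r] ab by simp
    qed
    moreover have "S (r i) (x i) (w' i) = (\<Sum>\<alpha><k. \<Sum>\<beta><k. c i \<alpha> * d \<beta> * S (r i) (e (r i) \<alpha>) (e (r i) \<beta>))" for i
      unfolding w'_def c[of i] by (rule expand[OF S(2)[of "r i"] S(1)[of "r i"]]) (rule eP)
    moreover have "S' x' w = (\<Sum>\<alpha><k. \<Sum>\<beta><k. c' \<alpha> * d \<beta> * S' (e' \<alpha>) (e' \<beta>))"
      unfolding d c' by (rule expand[OF S'(2,1)]) (rule eP')
    ultimately show ?thesis by simp
  qed
  ultimately show "\<exists>w'. (\<forall>i. w' i \<in> P (r i)) \<and> w' \<longlonglongrightarrow> w \<and> (\<lambda>i. S (r i) (x i) (w' i)) \<longlonglongrightarrow> S' x' w"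
    using w' by blast
qed

lemma form_tendsto:
  fixes g :: "'a \<Rightarrow> 'v::real_normed_vector \<Rightarrow>\<^sub>L 'v \<Rightarrow>\<^sub>L real"
  assumes "(g \<longlongrightarrow> g') F" "(x \<longlongrightarrow> x') F" "(y \<longlongrightarrow> y') F"
  shows "((\<lambda>i. g i (x i) (y i)) \<longlongrightarrow> g' x' y') F"
  by (intro bounded_bilinear.tendsto[OF bounded_bilinear_blinfun_apply] assms)

lemma std_map_tendsto:
  fixes g :: "'a \<Rightarrow> 'v::euclidean_space \<Rightarrow>\<^sub>L 'v \<Rightarrow>\<^sub>L real"
  assumes "(g \<longlongrightarrow> g') F" "(q \<longlongrightarrow> q') F"
  shows "((\<lambda>i. std_map (g i) (q i)) \<longlongrightarrow> std_map g' q') F"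
  unfolding std_map_def gram_operator_def
  by (intro tendsto_intros form_tendsto assms)

text \<open>
  Stretching \<open>[a, a + \<tau>]\<close> to \<open>[0, 1]\<close> multiplies the potential by \<open>\<tau>\<^sup>2\<close> and the derivative by
  \<open>\<tau>\<close>.  As \<open>\<tau>\<close> tends to \<open>0\<close> the equation becomes \<open>J'' = 0\<close>.
\<close>

lemma ode_solution_rescale:
  fixes R :: "real \<Rightarrow> 'v::euclidean_space \<Rightarrow>\<^sub>L 'v"
  assumes J: "ode_solution a b R J J'" and \<tau>: "0 \<le> \<tau>" "a + \<tau> \<le> b"
  shows "ode_solution 0 1 (\<lambda>s. \<tau>\<^sup>2 *\<^sub>R R (a + \<tau> * s)) (\<lambda>s. J (a + \<tau> * s)) (\<lambda>s. \<tau> *\<^sub>R J' (a + \<tau> * s))"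
  unfolding ode_solution_def
proof
  fix s :: real assume s: "s \<in> {0..1}"
  have \<tau>1: "\<tau> * u \<le> \<tau>" if "u \<le> 1" for u using mult_left_mono[OF that \<tau>(1)] by simp
  have sub: "(\<lambda>s. a + \<tau> * s) ` {0..1} \<subseteq> {a..b}"
    using \<tau> \<tau>1 by (force intro: mult_nonneg_nonneg)
  then have t: "a + \<tau> * s \<in> {a..b}" using s by blast
  have d: "((\<lambda>s. a + \<tau> * s) has_vector_derivative \<tau>) (at s within {0..1})"
    by (auto intro!: derivative_eq_intros simp: has_real_derivative_iff_has_vector_derivative[symmetric])
  have chain: "((\<lambda>s. f (a + \<tau> * s)) has_vector_derivative \<tau> *\<^sub>R f') (at s within {0..1})"
    if "(f has_vector_derivative f') (at (a + \<tau> * s) within {a..b})" for f and f' :: 'v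
    using vector_diff_chain_within[OF d has_vector_derivative_within_subset[OF that sub]] by (simp add: o_def)
  show "((\<lambda>s. J (a + \<tau> * s)) has_vector_derivative \<tau> *\<^sub>R J' (a + \<tau> * s)) (at s within {0..1}) \<and>
    ((\<lambda>s. \<tau> *\<^sub>R J' (a + \<tau> * s)) has_vector_derivative (\<tau>\<^sup>2 *\<^sub>R R (a + \<tau> * s)) (J (a + \<tau> * s))) (at s within {0..1})"
  proof
    show "((\<lambda>s. J (a + \<tau> * s)) has_vector_derivative \<tau> *\<^sub>R J' (a + \<tau> * s)) (at s within {0..1})"
      using J t by (intro chain) (auto simp: ode_solution_def)
    have "((\<lambda>s. J' (a + \<tau> * s)) has_vector_derivative \<tau> *\<^sub>R R (a + \<tau> * s) (J (a + \<tau> * s))) (at s within {0..1})"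
      using J t by (intro chain) (auto simp: ode_solution_def)
    from bounded_linear.has_vector_derivative[OF bounded_linear_scaleR_right[of \<tau>] this]
    show "((\<lambda>s. \<tau> *\<^sub>R J' (a + \<tau> * s)) has_vector_derivative (\<tau>\<^sup>2 *\<^sub>R R (a + \<tau> * s)) (J (a + \<tau> * s))) (at s within {0..1})"
      by (simp add: power2_eq_square blinfun.scaleR_left)
  qed
qed

lemma flow_zero_potential: "flow 0 1 (\<lambda>_. 0) 1 (x, z) = (x + z, z :: 'v::euclidean_space)"
proof -
  have "ode_solution 0 1 (\<lambda>_. 0) (\<lambda>s. x + s *\<^sub>R z) (\<lambda>_. z)"
    unfolding ode_solution_def by (auto intro!: derivative_eq_intros)
  from flow_ode_solution[OF continuous_on_const this, of 1] show ?thesis by simp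
qed

section \<open>Stability of the Maslov index\<close>


locale quadruple =
  fixes a b :: real and g :: "(real^'n) \<Rightarrow>\<^sub>L (real^'n) \<Rightarrow>\<^sub>L real"
    and R :: "real \<Rightarrow> (real^'n) \<Rightarrow>\<^sub>L (real^'n)" and P :: "(real^'n) set" and S :: "real^'n \<Rightarrow> real^'n \<Rightarrow> real"
  assumes ab: "a < b" and admissible: "admissible_quadruple a b g R P S"
begin

lemma
  shows sym: "g x y = g y x" and nondeg: "nondegenerate_on UNIV g" and R: "continuous_on {a..b} R"
    and R_sym: "t \<in> {a..b} \<Longrightarrow> g (R t x) y = g x (R t y)"
    and P: "subspace P" and nondegP: "nondegenerate_on P g" and S: "sym_bilinear_on P S"
  using admissible unfolding admissible_quadruple_def by blast+

abbreviation \<psi> :: "real \<Rightarrow> (real^'n) \<times> (real^'n) \<Rightarrow> (real^'n) \<times> (real^'n)" where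
  "\<psi> \<equiv> flow a b R"

abbreviation lag\<^sub>0 :: "((real^'n) \<times> (real^'n)) set" where
  "lag\<^sub>0 \<equiv> initial_lagrangian g P S"

abbreviation std_curve :: "real \<Rightarrow> ((real^'n) \<times> (real^'n)) set" where
  "std_curve t \<equiv> std_map g ` \<psi> t ` lag\<^sub>0"

lemmas in_lag_iff = initial_lagrangian_iff[OF sym P nondegP S]

lemma lag_scale: "q \<in> lag\<^sub>0 \<Longrightarrow> c *\<^sub>R q \<in> lag\<^sub>0"
  using S by (auto simp: in_lag_iff subspace_scale[OF P] blinfun.scaleR_right blinfun.scaleR_left sym_bilinear_on_def)

lemma focal_iff: "PS_focal a b g R P S b \<longleftrightarrow> (\<exists>q\<in>lag\<^sub>0. q \<noteq> 0 \<and> fst (\<psi> b q) = 0)"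
proof
  assume "PS_focal a b g R P S b"
  then obtain J J' t where J: "ode_solution a b R J J'" "J a \<in> P" "J' a + form_op g P S (J a) \<in> form_perp g P"
    and t: "t \<in> {a..b}" "J t \<noteq> 0" and b: "J b = 0"
    unfolding PS_focal_def PS_solution_def by blast
  have f: "\<psi> s (J a, J' a) = (J s, J' s)" if "s \<in> {a..b}" for s
    by (rule flow_ode_solution[OF R J(1) that])
  have "(J a, J' a) \<in> lag\<^sub>0" using J(2,3) by (simp add: initial_lagrangian_def)
  moreover have "(J a, J' a) \<noteq> 0"
  proof
    assume "(J a, J' a) = 0"
    then have "(J t, J' t) = 0" using f[OF t(1)] linear_0[OF flow_linear[OF R t(1)]] by simp
    then show False using t(2) by (simp add: zero_prod_def)
  qed
  moreover have "fst (\<psi> b (J a, J' a)) = 0" using f[of b] ab b by simp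
  ultimately show "\<exists>q\<in>lag\<^sub>0. q \<noteq> 0 \<and> fst (\<psi> b q) = 0" by blast
next
  assume "\<exists>q\<in>lag\<^sub>0. q \<noteq> 0 \<and> fst (\<psi> b q) = 0"
  then obtain q where q: "q \<in> lag\<^sub>0" "q \<noteq> 0" "fst (\<psi> b q) = 0" by blast
  define J J' where "J t = fst (\<psi> t q)" and "J' t = snd (\<psi> t q)" for t
  have sol: "ode_solution a b R J J'"
    unfolding J_def[abs_def] J'_def[abs_def] using ode_solution_flow(1)[OF R] ab by simp
  have a: "(J a, J' a) = q"
    using ode_solution_flow(2)[OF R, of q] ab by (simp add: J_def J'_def)
  have "J a \<in> P \<and> J' a + form_op g P S (J a) \<in> form_perp g P"
    using q(1) unfolding a[symmetric] initial_lagrangian_def by simp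
  then have "PS_solution a b g R P S J J'"
    using sol by (simp add: PS_solution_def)
  moreover have "\<exists>t\<in>{a..b}. J t \<noteq> 0"
  proof (rule ccontr)
    assume "\<not> ?thesis"
    then have 0: "J t = 0" if "t \<in> {a..b}" for t using that by blast
    have "(J has_vector_derivative J' a) (at a within {a..b})"
      using sol ab by (simp add: ode_solution_def)
    moreover have "(J has_vector_derivative 0) (at a within {a..b})"
      by (rule has_vector_derivative_transform[where f = "\<lambda>_. 0"]) (use 0 ab in auto)
    ultimately have "J' a = 0"
      using vector_derivative_unique_within_closed_interval[of a b a J "J' a" 0] ab by auto
    then show False using a q(2) 0[of a] ab by (simp add: zero_prod_def)
  qed
  ultimately show "PS_focal a b g R P S b"
  proof -
    assume *: "PS_solution a b g R P S J J'" "\<exists>t\<in>{a..b}. J t \<noteq> 0"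
    have "J b = 0" "b \<in> {a<..b}" using q(3) ab by (simp_all add: J_def)
    with * show ?thesis unfolding PS_focal_def by blast
  qed
qed

text \<open>
  Everything in standard coordinates: the flow conjugated by the standard map is a path of
  symplectic maps, and naturality of the index moves the computation there.
\<close>

lemma standard_model:
  obtains \<Phi> where "sympl_path a b \<Phi>" "lagrangian std_form (std_map g ` lag\<^sub>0)"
    "\<forall>t q. \<Phi> t (std_map g q) = std_map g (\<psi> t q)" "\<forall>q. std_map g q = 0 \<longrightarrow> q = 0"
    "quadruple_maslov_index a b g R P S = maslov_index std_form ({0} \<times> UNIV) a b std_curve"
proof -
  obtain D' where "sympl_iso (sympl_form g) std_form (std_map g) D' ({0} \<times> UNIV) ({0} \<times> UNIV)"
    by (rule std_map_iso[OF sym nondeg])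
  then interpret D: sympl_iso "sympl_form g" std_form "std_map g" D' "{0} \<times> UNIV" "{0} \<times> UNIV" .
  define \<Phi> where "\<Phi> t v = std_map g (\<psi> t (D' v))" for t v
  have L: "lagrangian std_form (std_map g ` lag\<^sub>0)"
  proof -
    have "std_map g ` lag\<^sub>0 = {q. fst q \<in> P \<and> (\<forall>w\<in>P. snd q \<bullet> w = - S (fst q) w)}" (is "_ = ?K")
    proof -
      have "std_map g q \<in> ?K \<longleftrightarrow> q \<in> lag\<^sub>0" for q
        by (simp add: in_lag_iff std_map_def inner_commute[of "gram_operator g _"] inner_gram_operator sym)
      note mem = this
      show ?thesis
      proof (intro equalityI subsetI)
        fix p assume "p \<in> std_map g ` lag\<^sub>0"
        then show "p \<in> ?K" using mem by blast
      next
        fix p assume "p \<in> ?K"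
        then have "std_map g (D' p) \<in> ?K" unfolding D.inv(2) .
        then have "D' p \<in> lag\<^sub>0" unfolding mem .
        then show "p \<in> std_map g ` lag\<^sub>0" by (rule image_eqI[rotated]) (rule D.inv(2)[symmetric])
      qed
    qed
    then show ?thesis using lagrangian_graph_like[OF P S] by simp
  qed
  have \<Phi>: "sympl_path a b \<Phi>"
    unfolding sympl_path_def
  proof (intro conjI ballI allI)
    fix t assume t: "t \<in> {a..b}"
    have "linear (std_map g \<circ> (\<psi> t \<circ> D'))"
      by (intro linear_compose D.lin flow_linear[OF R t])
    then show "linear (\<Phi> t)" unfolding \<Phi>_def[abs_def] comp_def .
    have "sympl_form g (\<psi> t p) (\<psi> t q) = sympl_form g p q" for p q
      by (rule flow_symplectic[OF R _ t]) (rule R_sym)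
    then show "std_form (\<Phi> t u) (\<Phi> t v) = std_form u v" for u v
      by (simp add: \<Phi>_def D.form D.converse.form)
  next
    fix v
    have "continuous_on UNIV (std_map g)"
      using D.lin(1) by (simp add: linear_continuous_on linear_conv_bounded_linear)
    then show "continuous_on {a..b} (\<lambda>t. \<Phi> t v)"
      unfolding \<Phi>_def by (rule continuous_on_compose2[OF _ flow_continuous[OF R]]) simp
  qed
  have \<Phi>_eq: "\<Phi> t (std_map g q) = std_map g (\<psi> t q)" for t q
    by (simp add: \<Phi>_def D.inv)
  have curve: "std_curve t = \<Phi> t ` std_map g ` lag\<^sub>0" for t
    by (simp add: image_image \<Phi>_eq)
  have "continuous_map (top_of_set {a..b}) (lagr_grassmannian std_form) std_curve"
    unfolding curve by (rule sympl_path_continuous[OF \<Phi> L])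
  from D.converse.maslov_index_image[OF this]
  have idx: "quadruple_maslov_index a b g R P S = maslov_index std_form ({0} \<times> UNIV) a b std_curve"
    unfolding D.image_inverse quadruple_maslov_index_def .
  have inj: "q = 0" if "std_map g q = 0" for q
    using D.inv(1)[of q] that linear_0[OF D.lin(2)] by simp
  show ?thesis
  proof (rule that[OF \<Phi> L _ _ idx])
    show "\<forall>t q. \<Phi> t (std_map g q) = std_map g (\<psi> t q)" by (intro allI \<Phi>_eq)
    show "\<forall>q. std_map g q = 0 \<longrightarrow> q = 0" using inj by simp
  qed
qed

lemma not_in_cycle:
  assumes t: "t \<in> {a..b}" and 0: "\<And>q. q \<in> lag\<^sub>0 \<Longrightarrow> fst (\<psi> t q) = 0 \<Longrightarrow> q = 0"
  shows "std_curve t \<notin> maslov_cycle std_form ({0} \<times> UNIV)"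
proof
  assume "std_curve t \<in> maslov_cycle std_form ({0} \<times> UNIV)"
  then have "\<not> std_curve t \<inter> ({0} \<times> UNIV) \<subseteq> {0}"
    unfolding maslov_cycle_iff lagr_stratum_def by (auto simp: dim_eq_0)
  then obtain w where w: "w \<in> std_curve t \<inter> ({0} \<times> UNIV)" "w \<notin> {0}" by (meson subsetI)
  then have "w \<in> std_curve t" "fst w = 0" by (simp_all add: mem_Times_iff)
  then obtain q where q: "q \<in> lag\<^sub>0" "w = std_map g (\<psi> t q)" by blast
  have "fst (\<psi> t q) = 0" using \<open>fst w = 0\<close> q(2) by (simp add: std_map_def)
  then have "q = 0" by (rule 0[OF q(1)])
  then have "w = std_map g 0" using q(2) linear_0[OF flow_linear[OF R t]] by simp
  then show False using w(2) linear_0[OF linear_std_map[of g]] by simp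
qed

end

locale converging_quadruples = limit: quadruple a b g' R' P' S'
  for a b and g' :: "(real^'n) \<Rightarrow>\<^sub>L (real^'n) \<Rightarrow>\<^sub>L real" and R' P' S' +
  fixes k :: nat and g R P S
  assumes admissible: "\<And>j::nat. admissible_quadruple a b (g j) (R j) (P j) (S j)"
    and GB: "GB_tendsto k P S P' S'" and g_lim: "g \<longlonglongrightarrow> g'"
    and R_lim: "uniform_limit {a..b} R R' sequentially"
begin

sublocale seq: quadruple a b "g j" "R j" "P j" "S j" for j
  by unfold_locales (use limit.ab admissible in auto)

lemma GB_limit_along:
  assumes "filterlim r at_top sequentially" "\<And>i. x i \<in> P (r i)" "x \<longlonglongrightarrow> x'"
  shows "x' \<in> P'"
    and "w \<in> P' \<Longrightarrow> \<exists>w'. (\<forall>i. w' i \<in> P (r i)) \<and> w' \<longlonglongrightarrow> w \<and> (\<lambda>i. S (r i) (x i) (w' i)) \<longlonglongrightarrow> S' x' w"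
  using GB_limit[OF GB seq.P seq.S limit.P limit.S assms] by blast+

lemma g_limit_along: "filterlim r at_top sequentially \<Longrightarrow> (\<lambda>i. g (r i)) \<longlonglongrightarrow> g'"
  by (rule filterlim_compose[OF g_lim])

lemma R_limit_along: "filterlim r at_top sequentially \<Longrightarrow> uniform_limit {a..b} (\<lambda>i. R (r i)) R' sequentially"
  by (rule filterlim_compose[OF R_lim])

lemma lag_limit:
  assumes r: "filterlim r at_top sequentially" and q: "\<And>i. q i \<in> seq.lag\<^sub>0 (r i)" "q \<longlonglongrightarrow> q'"
  shows "q' \<in> limit.lag\<^sub>0"
  unfolding limit.in_lag_iff
proof (intro conjI ballI)
  have x: "fst (q i) \<in> P (r i)" for i using q(1)[of i] by (simp add: seq.in_lag_iff)
  have xlim: "(\<lambda>i. fst (q i)) \<longlonglongrightarrow> fst q'" by (rule tendsto_fst[OF q(2)])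
  show "fst q' \<in> P'" by (rule GB_limit_along(1)[OF r x xlim])
  fix w assume "w \<in> P'"
  then obtain w' where w': "\<And>i. w' i \<in> P (r i)" "w' \<longlonglongrightarrow> w" "(\<lambda>i. S (r i) (fst (q i)) (w' i)) \<longlonglongrightarrow> S' (fst q') w"
    using GB_limit_along(2)[OF r x xlim] by blast
  have "(\<lambda>i. g (r i) (snd (q i)) (w' i)) \<longlonglongrightarrow> g' (snd q') w"
    by (intro form_tendsto g_limit_along r tendsto_snd q(2) w'(2))
  moreover have "(\<lambda>i. g (r i) (snd (q i)) (w' i)) \<longlonglongrightarrow> - S' (fst q') w"
    using tendsto_minus[OF w'(3)] q(1) w'(1) by (simp add: seq.in_lag_iff)
  ultimately show "g' (snd q') w = - S' (fst q') w" by (rule LIMSEQ_unique)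
qed

lemma flow_limit:
  assumes r: "filterlim r at_top sequentially" and "q \<longlonglongrightarrow> q'" "\<tau> \<longlonglongrightarrow> \<tau>'" "\<And>i. \<tau> i \<in> {a..b}"
  shows "(\<lambda>i. seq.\<psi> (r i) (\<tau> i) (q i)) \<longlonglongrightarrow> limit.\<psi> \<tau>' q'"
  by (rule flow_tendsto[OF seq.R limit.R R_limit_along[OF r] assms(2-4)])

lemma no_crossing_near_end:
  assumes nf: "\<not> PS_focal a b g' R' P' S' b"
  obtains \<epsilon> where "0 < \<epsilon>" "\<forall>\<^sub>F j in sequentially. \<forall>t\<in>{a..b}. dist t b < \<epsilon> \<longrightarrow>
    (\<forall>q\<in>seq.lag\<^sub>0 j. fst (seq.\<psi> j t q) = 0 \<longrightarrow> q = 0)"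
proof (rule zero_sets_trivial_near[of "\<lambda>j t. {q. t \<in> {a..b} \<and> q \<in> seq.lag\<^sub>0 j \<and> fst (seq.\<psi> j t q) = 0}" b "{a..b}"])
  fix j t c and q assume "q \<in> {q. t \<in> {a..b} \<and> q \<in> seq.lag\<^sub>0 j \<and> fst (seq.\<psi> j t q) = 0}"
  then show "c *\<^sub>R q \<in> {q. t \<in> {a..b} \<and> q \<in> seq.lag\<^sub>0 j \<and> fst (seq.\<psi> j t q) = 0}"
    using linear_scale[OF flow_linear[OF seq.R]] by (auto simp: seq.lag_scale)
next
  fix r \<tau> q q\<^sub>0 assume r: "filterlim r at_top sequentially" and \<tau>: "\<tau> \<longlonglongrightarrow> b" "\<And>i. \<tau> i \<in> {a..b}"
    and q: "\<And>i. q i \<in> {q. \<tau> i \<in> {a..b} \<and> q \<in> seq.lag\<^sub>0 (r i) \<and> fst (seq.\<psi> (r i) (\<tau> i) q) = 0}" "q \<longlonglongrightarrow> q\<^sub>0"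
  have "q\<^sub>0 \<in> limit.lag\<^sub>0" using q(1) by (intro lag_limit[OF r _ q(2)]) simp
  moreover have "(\<lambda>i. fst (seq.\<psi> (r i) (\<tau> i) (q i))) \<longlonglongrightarrow> fst (limit.\<psi> b q\<^sub>0)"
    by (intro tendsto_fst flow_limit[OF r q(2) \<tau>])
  then have "fst (limit.\<psi> b q\<^sub>0) = 0" using q(1) by (simp add: LIMSEQ_const_iff)
  ultimately show "q\<^sub>0 = 0" using nf limit.focal_iff by blast
next
  fix \<epsilon> :: real assume "0 < \<epsilon>" and ev: "\<forall>\<^sub>F j in sequentially. \<forall>t\<in>{a..b}. dist t b < \<epsilon> \<longrightarrow>
    {q. t \<in> {a..b} \<and> q \<in> seq.lag\<^sub>0 j \<and> fst (seq.\<psi> j t q) = 0} \<subseteq> {0}"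
  show thesis
  proof (rule that[OF \<open>0 < \<epsilon>\<close>])
    show "\<forall>\<^sub>F j in sequentially. \<forall>t\<in>{a..b}. dist t b < \<epsilon> \<longrightarrow> (\<forall>q\<in>seq.lag\<^sub>0 j. fst (seq.\<psi> j t q) = 0 \<longrightarrow> q = 0)"
      using ev by eventually_elim blast
  qed
qed

text \<open>
  By rescaling, \<open>J (a + \<tau> i)\<close> is the value at time \<open>1\<close> of a solution with initial values
  \<open>x i\<close> and \<open>\<tau> i *\<^sub>R y i\<close> whose potential tends to \<open>0\<close>; in the limit the solution is affine.
\<close>

lemma rescaled_zero_limit:
  assumes r: "filterlim r at_top sequentially" and \<tau>: "\<tau> \<longlonglongrightarrow> 0" "\<And>i. 0 < \<tau> i" "\<And>i. a + \<tau> i \<le> b"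
    and lim: "x \<longlonglongrightarrow> x'" "(\<lambda>i. \<tau> i *\<^sub>R y i) \<longlonglongrightarrow> z'" and 0: "\<And>i. fst (seq.\<psi> (r i) (a + \<tau> i) (x i, y i)) = 0"
  shows "x' + z' = 0"
proof -
  define T where "T i s = (\<tau> i)\<^sup>2 *\<^sub>R R (r i) (a + \<tau> i * s)" for i s
  have sub: "a + \<tau> i * s \<in> {a..b}" if "s \<in> {0..1}" for i s
  proof -
    have "0 \<le> \<tau> i * s" "\<tau> i * s \<le> \<tau> i"
      using that \<tau>(2)[of i] by (simp_all add: mult_left_le)
    then show ?thesis using \<tau>(3)[of i] by simp
  qed
  have T: "continuous_on {0..1} (T i)" for i
    unfolding T_def
    by (intro continuous_intros continuous_on_compose2[OF seq.R[of "r i"]]) (use sub in auto)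
  have J: "flow 0 1 (T i) 1 (x i, \<tau> i *\<^sub>R y i) = (fst (seq.\<psi> (r i) (a + \<tau> i) (x i, y i)), \<tau> i *\<^sub>R snd (seq.\<psi> (r i) (a + \<tau> i) (x i, y i)))" for i
  proof -
    have "a \<le> b" using limit.ab by simp
    have "ode_solution 0 1 (T i) (\<lambda>s. fst (seq.\<psi> (r i) (a + \<tau> i * s) (x i, y i)))
        (\<lambda>s. \<tau> i *\<^sub>R snd (seq.\<psi> (r i) (a + \<tau> i * s) (x i, y i)))"
      unfolding T_def
      by (rule ode_solution_rescale[OF ode_solution_flow(1)[OF seq.R \<open>a \<le> b\<close>]]) (use \<tau>(2,3) less_imp_le in auto)
    from flow_ode_solution[OF T this, of 1] show ?thesis
      by (simp add: ode_solution_flow(2)[OF seq.R \<open>a \<le> b\<close>])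
  qed
  have "uniform_limit {0..1} T (\<lambda>_. 0) sequentially"
  proof (rule uniform_limitI)
    fix e :: real assume "0 < e"
    obtain M where M: "\<And>t. t \<in> {a..b} \<Longrightarrow> norm (R' t) \<le> M"
      using continuous_on_Icc_norm_bound[OF limit.R] by blast
    have ev1: "\<forall>\<^sub>F i in sequentially. \<forall>t\<in>{a..b}. dist (R (r i) t) (R' t) < 1"
      by (rule uniform_limitD[OF R_limit_along[OF r]]) simp
    have "(\<lambda>i. (\<tau> i)\<^sup>2 * (M + 1)) \<longlonglongrightarrow> 0\<^sup>2 * (M + 1)" by (intro tendsto_intros \<tau>(1))
    then have ev2: "\<forall>\<^sub>F i in sequentially. (\<tau> i)\<^sup>2 * (M + 1) < e"
      using \<open>0 < e\<close> by (intro order_tendstoD(2)) auto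
    from ev1 ev2 show "\<forall>\<^sub>F i in sequentially. \<forall>s\<in>{0..1}. dist (T i s) 0 < e"
    proof eventually_elim
      case (elim i)
      show ?case
      proof
        fix s :: real assume "s \<in> {0..1}"
        then have t: "a + \<tau> i * s \<in> {a..b}" by (rule sub)
        have "norm (R (r i) (a + \<tau> i * s)) \<le> norm (R' (a + \<tau> i * s)) + dist (R (r i) (a + \<tau> i * s)) (R' (a + \<tau> i * s))"
          unfolding dist_norm by (rule norm_triangle_sub)
        also have "\<dots> \<le> M + 1"
          using M[OF t] elim(1) t by (intro add_mono order_less_imp_le[of "dist _ _"]) auto
        finally have "norm (T i s) \<le> (\<tau> i)\<^sup>2 * (M + 1)"
          unfolding T_def by (simp add: mult_left_mono)
        then show "dist (T i s) 0 < e" using elim(2) by simp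
      qed
    qed
  qed
  from flow_tendsto[OF T continuous_on_const this tendsto_Pair[OF lim] tendsto_const[of 1]]
  have "(\<lambda>i. flow 0 1 (T i) 1 (x i, \<tau> i *\<^sub>R y i)) \<longlonglongrightarrow> (x' + z', z')"
    by (simp add: flow_zero_potential)
  from tendsto_fst[OF this] show ?thesis
    by (simp add: J 0 LIMSEQ_const_iff)
qed

text \<open>
  The initial derivative may be large compared with \<open>x\<close>, so vectors are normalized after the
  rescaling \<open>z = \<tau> y\<close>.  In the limit \<open>x + z = 0\<close> with \<open>x \<in> P'\<close> and \<open>z\<close> orthogonal to \<open>P'\<close>, hence
  \<open>x = 0\<close> by nondegeneracy on \<open>P'\<close>.
\<close>

lemma no_crossing_near_start:
  obtains \<epsilon> where "0 < \<epsilon>" "\<forall>\<^sub>F j in sequentially. \<forall>t\<in>{a<..b}. dist t a < \<epsilon> \<longrightarrow>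
    (\<forall>q\<in>seq.lag\<^sub>0 j. fst (seq.\<psi> j t q) = 0 \<longrightarrow> q = 0)"
proof -
  \<comment> \<open>the initial value with rescaled coordinates \<open>v = (x, (t - a) y)\<close>\<close>
  define u where "u t v = (fst v, (1 / (t - a)) *\<^sub>R snd v)" for t and v :: "(real^'n) \<times> (real^'n)"
  have u_scale: "u t (c *\<^sub>R v) = c *\<^sub>R u t v" for t c v by (simp add: u_def)
  define Z where "Z j t = {v. t \<in> {a<..b} \<and> u t v \<in> seq.lag\<^sub>0 j \<and> fst (seq.\<psi> j t (u t v)) = 0}" for j t
  show thesis
  proof (rule zero_sets_trivial_near[of Z a "{a<..b}"])
    fix j t v c assume v: "v \<in> Z j t"
    then have "t \<in> {a..b}" by (simp add: Z_def)
    then have "seq.\<psi> j t (c *\<^sub>R q) = c *\<^sub>R seq.\<psi> j t q" for q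
      by (rule linear_scale[OF flow_linear[OF seq.R]])
    then show "c *\<^sub>R v \<in> Z j t"
      using v by (simp add: Z_def u_scale seq.lag_scale)
  next
    fix r \<kappa> v v\<^sub>0 assume r: "filterlim r at_top sequentially" and \<kappa>: "\<kappa> \<longlonglongrightarrow> a" "\<And>i. \<kappa> i \<in> {a<..b}"
      and v: "\<And>i. v i \<in> Z (r i) (\<kappa> i)" "v \<longlonglongrightarrow> v\<^sub>0"
    define \<tau> where "\<tau> i = \<kappa> i - a" for i
    have \<tau>: "\<tau> \<longlonglongrightarrow> 0" "\<And>i. 0 < \<tau> i" "\<And>i. a + \<tau> i \<le> b" "\<And>i. a + \<tau> i = \<kappa> i"
      using \<kappa>(2) tendsto_diff[OF \<kappa>(1) tendsto_const[of a]] by (auto simp: \<tau>_def[abs_def])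
    define y where "y i = (1 / \<tau> i) *\<^sub>R snd (v i)" for i
    have y: "\<tau> i *\<^sub>R y i = snd (v i)" for i using \<tau>(2)[of i] by (simp add: y_def)
    have q: "(fst (v i), y i) \<in> seq.lag\<^sub>0 (r i)" "fst (seq.\<psi> (r i) (a + \<tau> i) (fst (v i), y i)) = 0" for i
      using v(1)[of i] unfolding Z_def u_def \<tau>(4) y_def \<tau>_def by auto
    have x: "fst (v i) \<in> P (r i)" for i using q(1)[of i] by (simp add: seq.in_lag_iff)
    have xlim: "(\<lambda>i. fst (v i)) \<longlonglongrightarrow> fst v\<^sub>0" and zlim: "(\<lambda>i. \<tau> i *\<^sub>R y i) \<longlonglongrightarrow> snd v\<^sub>0"
      unfolding y by (intro tendsto_fst tendsto_snd v(2))+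
    have sum0: "fst v\<^sub>0 + snd v\<^sub>0 = 0"
      by (rule rescaled_zero_limit[OF r \<tau>(1-3) xlim zlim q(2)])
    have xP: "fst v\<^sub>0 \<in> P'" by (rule GB_limit_along(1)[OF r x xlim])
    have perp: "g' (snd v\<^sub>0) w = 0" if w: "w \<in> P'" for w
    proof -
      obtain w' where w': "\<And>i. w' i \<in> P (r i)" "w' \<longlonglongrightarrow> w" "(\<lambda>i. S (r i) (fst (v i)) (w' i)) \<longlonglongrightarrow> S' (fst v\<^sub>0) w"
        using GB_limit_along(2)[OF r x xlim w] by blast
      have "g (r i) (\<tau> i *\<^sub>R y i) (w' i) = - (\<tau> i * S (r i) (fst (v i)) (w' i))" for i
        using q(1)[of i] w'(1)[of i] by (simp add: seq.in_lag_iff blinfun.scaleR_right blinfun.scaleR_left)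
      moreover have "(\<lambda>i. - (\<tau> i * S (r i) (fst (v i)) (w' i))) \<longlonglongrightarrow> - (0 * S' (fst v\<^sub>0) w)"
        by (intro tendsto_intros \<tau>(1) w'(3))
      moreover have "(\<lambda>i. g (r i) (\<tau> i *\<^sub>R y i) (w' i)) \<longlonglongrightarrow> g' (snd v\<^sub>0) w"
        by (intro form_tendsto g_limit_along r zlim w'(2))
      ultimately have "(\<lambda>i. g (r i) (\<tau> i *\<^sub>R y i) (w' i)) \<longlonglongrightarrow> 0"
        "(\<lambda>i. g (r i) (\<tau> i *\<^sub>R y i) (w' i)) \<longlonglongrightarrow> g' (snd v\<^sub>0) w" by simp_all
      then show ?thesis by (rule LIMSEQ_unique[symmetric])
    qed
    have sx: "snd v\<^sub>0 = - fst v\<^sub>0" using sum0 by (simp add: eq_neg_iff_add_eq_0 add.commute)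
    have "g' (fst v\<^sub>0) w = 0" if "w \<in> P'" for w
      using perp[OF that] unfolding sx by (simp add: blinfun.minus_right blinfun.minus_left)
    then have "fst v\<^sub>0 = 0" using limit.nondegP xP unfolding nondegenerate_on_def by blast
    then show "v\<^sub>0 = 0" using sx by (simp add: prod_eq_iff)
  next
    fix \<epsilon> :: real assume "0 < \<epsilon>" and ev: "\<forall>\<^sub>F j in sequentially. \<forall>t\<in>{a<..b}. dist t a < \<epsilon> \<longrightarrow> Z j t \<subseteq> {0}"
    show thesis
    proof (rule that[OF \<open>0 < \<epsilon>\<close>])
      show "\<forall>\<^sub>F j in sequentially. \<forall>t\<in>{a<..b}. dist t a < \<epsilon> \<longrightarrow> (\<forall>q\<in>seq.lag\<^sub>0 j. fst (seq.\<psi> j t q) = 0 \<longrightarrow> q = 0)"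
        using ev
      proof (eventually_elim, intro ballI impI)
        fix j t q assume Z: "\<forall>t\<in>{a<..b}. dist t a < \<epsilon> \<longrightarrow> Z j t \<subseteq> {0}" and t: "t \<in> {a<..b}" "dist t a < \<epsilon>"
          and q: "q \<in> seq.lag\<^sub>0 j" "fst (seq.\<psi> j t q) = 0"
        have "u t (fst q, (t - a) *\<^sub>R snd q) = q" using t(1) by (simp add: u_def)
        then have "(fst q, (t - a) *\<^sub>R snd q) \<in> Z j t" using t(1) q by (simp add: Z_def)
        then have "(fst q, (t - a) *\<^sub>R snd q) = 0" using Z t by blast
        then show "q = 0" using t(1) by (simp add: prod_eq_iff zero_prod_def)
      qed
    qed
  qed
qed

text \<open>
  The constant sequence turns statements about all large \<open>j\<close> into statements about the limit.
\<close>

lemma constant_sequence: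
  "converging_quadruples a b g' R' P' S' k (\<lambda>_. g') (\<lambda>_. R') (\<lambda>_. P') (\<lambda>_. S')"
proof (unfold_locales)
  show "admissible_quadruple a b g' R' P' S'" by (rule limit.admissible)
  show "GB_tendsto k (\<lambda>_. P') (\<lambda>_. S') P' S'"
    using GB unfolding GB_tendsto_def by (elim exE conjE) (rule exI[of _ "\<lambda>_. e'" for e'], rule exI, auto)
  show "uniform_limit {a..b} (\<lambda>_. R') R' sequentially"
    by (rule uniform_limit_const)
qed (rule tendsto_const)

lemma common_noncrossing_ends:
  assumes nf: "\<not> PS_focal a b g' R' P' S' b"
  obtains \<epsilon> where "0 < \<epsilon>"
    "\<forall>t\<in>{a<..b}. t < a + \<epsilon> \<or> b - \<epsilon> < t \<longrightarrow> (\<forall>q\<in>limit.lag\<^sub>0. fst (limit.\<psi> t q) = 0 \<longrightarrow> q = 0)"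
    "\<forall>\<^sub>F j in sequentially. \<forall>t\<in>{a<..b}. t < a + \<epsilon> \<or> b - \<epsilon> < t \<longrightarrow>
       (\<forall>q\<in>seq.lag\<^sub>0 j. fst (seq.\<psi> j t q) = 0 \<longrightarrow> q = 0)"
proof -
  interpret const: converging_quadruples a b g' R' P' S' k "\<lambda>_. g'" "\<lambda>_. R'" "\<lambda>_. P'" "\<lambda>_. S'"
    by (rule constant_sequence)
  obtain \<epsilon>1 where \<epsilon>1: "0 < \<epsilon>1" "\<forall>\<^sub>F j in sequentially. \<forall>t\<in>{a<..b}. dist t a < \<epsilon>1 \<longrightarrow>
    (\<forall>q\<in>seq.lag\<^sub>0 j. fst (seq.\<psi> j t q) = 0 \<longrightarrow> q = 0)" by (rule no_crossing_near_start)
  obtain \<epsilon>2 where \<epsilon>2: "0 < \<epsilon>2" "\<forall>\<^sub>F j in sequentially. \<forall>t\<in>{a..b}. dist t b < \<epsilon>2 \<longrightarrow>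
    (\<forall>q\<in>seq.lag\<^sub>0 j. fst (seq.\<psi> j t q) = 0 \<longrightarrow> q = 0)" by (rule no_crossing_near_end[OF nf])
  obtain \<epsilon>3 where \<epsilon>3: "0 < \<epsilon>3" "\<forall>\<^sub>F j::nat in sequentially. \<forall>t\<in>{a<..b}. dist t a < \<epsilon>3 \<longrightarrow>
    (\<forall>q\<in>limit.lag\<^sub>0. fst (limit.\<psi> t q) = 0 \<longrightarrow> q = 0)" by (rule const.no_crossing_near_start)
  obtain \<epsilon>4 where \<epsilon>4: "0 < \<epsilon>4" "\<forall>\<^sub>F j::nat in sequentially. \<forall>t\<in>{a..b}. dist t b < \<epsilon>4 \<longrightarrow>
    (\<forall>q\<in>limit.lag\<^sub>0. fst (limit.\<psi> t q) = 0 \<longrightarrow> q = 0)" by (rule const.no_crossing_near_end[OF nf])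
  define \<epsilon> where "\<epsilon> = min (min \<epsilon>1 \<epsilon>2) (min \<epsilon>3 \<epsilon>4)"
  have \<epsilon>: "0 < \<epsilon>" "\<epsilon> \<le> \<epsilon>1" "\<epsilon> \<le> \<epsilon>2" "\<epsilon> \<le> \<epsilon>3" "\<epsilon> \<le> \<epsilon>4"
    using \<epsilon>1(1) \<epsilon>2(1) \<epsilon>3(1) \<epsilon>4(1) by (auto simp: \<epsilon>_def)
  show thesis
  proof (rule that[OF \<epsilon>(1)])
    show "\<forall>t\<in>{a<..b}. t < a + \<epsilon> \<or> b - \<epsilon> < t \<longrightarrow> (\<forall>q\<in>limit.lag\<^sub>0. fst (limit.\<psi> t q) = 0 \<longrightarrow> q = 0)"
    proof (intro ballI impI)
      fix t q assume t: "t \<in> {a<..b}" "t < a + \<epsilon> \<or> b - \<epsilon> < t" and q: "q \<in> limit.lag\<^sub>0" "fst (limit.\<psi> t q) = 0"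
      have "t \<in> {a..b}" and d: "dist t a < \<epsilon>3 \<or> dist t b < \<epsilon>4" using t \<epsilon> by (auto simp: dist_real_def)
      moreover have "\<forall>t\<in>{a<..b}. dist t a < \<epsilon>3 \<longrightarrow> (\<forall>q\<in>limit.lag\<^sub>0. fst (limit.\<psi> t q) = 0 \<longrightarrow> q = 0)"
        using \<epsilon>3(2) by simp
      moreover have "\<forall>t\<in>{a..b}. dist t b < \<epsilon>4 \<longrightarrow> (\<forall>q\<in>limit.lag\<^sub>0. fst (limit.\<psi> t q) = 0 \<longrightarrow> q = 0)"
        using \<epsilon>4(2) by simp
      ultimately show "q = 0" using t(1) q by blast
    qed
  next
    show "\<forall>\<^sub>F j in sequentially. \<forall>t\<in>{a<..b}. t < a + \<epsilon> \<or> b - \<epsilon> < t \<longrightarrow>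
       (\<forall>q\<in>seq.lag\<^sub>0 j. fst (seq.\<psi> j t q) = 0 \<longrightarrow> q = 0)"
      using \<epsilon>1(2) \<epsilon>2(2)
    proof (eventually_elim, intro ballI impI)
      fix j t q
      assume 1: "\<forall>t\<in>{a<..b}. dist t a < \<epsilon>1 \<longrightarrow> (\<forall>q\<in>seq.lag\<^sub>0 j. fst (seq.\<psi> j t q) = 0 \<longrightarrow> q = 0)"
        and 2: "\<forall>t\<in>{a..b}. dist t b < \<epsilon>2 \<longrightarrow> (\<forall>q\<in>seq.lag\<^sub>0 j. fst (seq.\<psi> j t q) = 0 \<longrightarrow> q = 0)"
        and t: "t \<in> {a<..b}" "t < a + \<epsilon> \<or> b - \<epsilon> < t" and q: "q \<in> seq.lag\<^sub>0 j" "fst (seq.\<psi> j t q) = 0"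
      have "t \<in> {a..b}" and d: "dist t a < \<epsilon>1 \<or> dist t b < \<epsilon>2" using t \<epsilon> by (auto simp: dist_real_def)
      then show "q = 0" using 1 2 t(1) q by blast
    qed
  qed
qed

text \<open>
  The two conditions of \<open>near_curves_homologous\<close> hold for the limit curve itself, where the
  projection is the identity, so they persist for large \<open>j\<close> by the compactness principle.
\<close>

lemma curve_class_eventually_eq:
  assumes cd: "a < c" "c < d" "d \<le> b"
    and c: "\<And>q. q \<in> limit.lag\<^sub>0 \<Longrightarrow> fst (limit.\<psi> c q) = 0 \<Longrightarrow> q = 0"
    and d: "\<And>q. q \<in> limit.lag\<^sub>0 \<Longrightarrow> fst (limit.\<psi> d q) = 0 \<Longrightarrow> q = 0"
  shows "\<forall>\<^sub>F j in sequentially. curve_class std_form ({0} \<times> UNIV) c d (seq.std_curve j) =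
    curve_class std_form ({0} \<times> UNIV) c d limit.std_curve"
proof -
  obtain \<Phi> where \<Phi>: "sympl_path a b \<Phi>" and L: "lagrangian std_form (std_map g' ` limit.lag\<^sub>0)"
    and \<Phi>': "\<forall>t q. \<Phi> t (std_map g' q) = std_map g' (limit.\<psi> t q)" and inj: "\<forall>q. std_map g' q = 0 \<longrightarrow> q = 0"
    and "quadruple_maslov_index a b g' R' P' S' = maslov_index std_form ({0} \<times> UNIV) a b limit.std_curve"
    by (rule limit.standard_model)
  note \<Phi>_eq = \<Phi>'[rule_format]
  have subL: "subspace (std_map g' ` limit.lag\<^sub>0)" using L by (simp add: lagrangian_def)
  obtain B where "finite B \<and> span B = std_map g' ` limit.lag\<^sub>0 \<and>
      (\<forall>x\<in>std_map g' ` limit.lag\<^sub>0. (\<Sum>e\<in>B. (x \<bullet> e) *\<^sub>R e) = x)"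
    using orthonormal_expansion[OF subL] by (rule exE)
  note B = conjunct1[OF this] conjunct2[OF this, THEN conjunct1] conjunct2[OF this, THEN conjunct2, THEN bspec]
  define \<pi> where "\<pi> t = moving_proj B (\<Phi> t)" for t
  \<comment> \<open>the homotopy, as a linear function of the initial value \<open>q\<close>; for \<open>s = 0\<close> it is the projection alone\<close>
  define N where "N j s t q = s *\<^sub>R std_map (g j) (seq.\<psi> j t q) + (1 - s) *\<^sub>R \<pi> t (std_map (g j) (seq.\<psi> j t q))" for j s t q
  have N_limit: "(\<lambda>i. N (r i) (s i) (t i) (q i)) \<longlonglongrightarrow> std_map g' (limit.\<psi> t' q')"
    if r: "filterlim r at_top sequentially" and s: "s \<longlonglongrightarrow> s'" and t: "t \<longlonglongrightarrow> t'" "\<And>i. t i \<in> {a..b}" "t' \<in> {a..b}"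
      and q: "\<And>i. q i \<in> seq.lag\<^sub>0 (r i)" "q \<longlonglongrightarrow> q'" for r s s' t t' q q'
  proof -
    have q': "q' \<in> limit.lag\<^sub>0" by (rule lag_limit[OF r q])
    have F: "(\<lambda>i. std_map (g (r i)) (seq.\<psi> (r i) (t i) (q i))) \<longlonglongrightarrow> std_map g' (limit.\<psi> t' q')"
      by (intro std_map_tendsto g_limit_along r flow_limit q t(1,2))
    have \<Phi>t: "(\<lambda>i. \<Phi> (t i) v) \<longlonglongrightarrow> \<Phi> t' v" for v
      by (rule continuous_on_tendsto_compose[OF sympl_pathD(3)[OF \<Phi>] t(1,3)]) (intro always_eventually allI t(2))
    have "(\<lambda>i. \<pi> (t i) (std_map (g (r i)) (seq.\<psi> (r i) (t i) (q i)))) \<longlonglongrightarrow> \<pi> t' (std_map g' (limit.\<psi> t' q'))"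
      unfolding \<pi>_def moving_proj_def std_form_def by (intro tendsto_intros \<Phi>t F)
    also have "\<pi> t' (std_map g' (limit.\<psi> t' q')) = std_map g' (limit.\<psi> t' q')"
      unfolding \<pi>_def \<Phi>_eq[symmetric]
      using moving_proj_image[OF sympl_pathD(1,2)[OF \<Phi> t(3)], of B "std_map g' q'"] B(3) q' by simp
    finally have "(\<lambda>i. N (r i) (s i) (t i) (q i)) \<longlonglongrightarrow>
      s' *\<^sub>R std_map g' (limit.\<psi> t' q') + (1 - s') *\<^sub>R std_map g' (limit.\<psi> t' q')"
      unfolding N_def by (intro tendsto_intros s F)
    then show ?thesis by (simp add: scaleR_left_distrib[symmetric])
  qed
  have N_scale: "N j s t (r *\<^sub>R q) = r *\<^sub>R N j s t q" if "t \<in> {a..b}" for j s t r q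
    by (simp add: N_def \<pi>_def linear_scale[OF flow_linear[OF seq.R that]] linear_scale[OF linear_std_map]
        linear_scale[OF moving_proj_linear] algebra_simps)
  have cd_sub: "{c..d} \<subseteq> {a..b}" using cd by auto
  have ev_inj: "\<forall>\<^sub>F j in sequentially. \<forall>t\<in>{c..d}. {q. t \<in> {c..d} \<and> q \<in> seq.lag\<^sub>0 j \<and> N j 0 t q = 0} \<subseteq> {0}"
  proof (rule zero_sets_trivial_compact[OF _ compact_Icc])
    show "r *\<^sub>R q \<in> {q. t \<in> {c..d} \<and> q \<in> seq.lag\<^sub>0 j \<and> N j 0 t q = 0}"
      if "q \<in> {q. t \<in> {c..d} \<and> q \<in> seq.lag\<^sub>0 j \<and> N j 0 t q = 0}" for j t q r
      using that N_scale[of t] cd_sub by (auto simp: seq.lag_scale)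
  next
    fix r t t\<^sub>0 q q\<^sub>0 assume r: "filterlim r at_top sequentially" and t\<^sub>0: "t\<^sub>0 \<in> {c..d}" and t: "t \<longlonglongrightarrow> t\<^sub>0" "\<And>i. t i \<in> {c..d}"
      and q: "\<And>i. q i \<in> {q. t i \<in> {c..d} \<and> q \<in> seq.lag\<^sub>0 (r i) \<and> N (r i) 0 (t i) q = 0}" "q \<longlonglongrightarrow> q\<^sub>0"
    have t': "\<And>i. t i \<in> {a..b}" "t\<^sub>0 \<in> {a..b}" using t(2) t\<^sub>0 cd_sub by blast+
    have q': "\<And>i. q i \<in> seq.lag\<^sub>0 (r i)" "\<And>i. N (r i) 0 (t i) (q i) = 0" using q(1) by simp_all
    from N_limit[OF r tendsto_const[of 0] t(1) t' q'(1) q(2)] have "std_map g' (limit.\<psi> t\<^sub>0 q\<^sub>0) = 0"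
      by (simp add: q'(2) LIMSEQ_const_iff)
    then have "std_map g' q\<^sub>0 = 0"
      unfolding \<Phi>_eq[symmetric] by (rule sympl_path_eq_0[OF \<Phi> t'(2)])
    then show "q\<^sub>0 = 0" using inj by blast
  qed
  have ev_ends: "\<forall>\<^sub>F j in sequentially. \<forall>p\<in>{0..1} \<times> {c, d}.
    {q. p \<in> {0..1} \<times> {c, d} \<and> q \<in> seq.lag\<^sub>0 j \<and> fst (N j (fst p) (snd p) q) = 0} \<subseteq> {0}"
  proof (rule zero_sets_trivial_compact)
    show "r *\<^sub>R q \<in> {q. p \<in> {0..1} \<times> {c, d} \<and> q \<in> seq.lag\<^sub>0 j \<and> fst (N j (fst p) (snd p) q) = 0}"
      if "q \<in> {q. p \<in> {0..1} \<times> {c, d} \<and> q \<in> seq.lag\<^sub>0 j \<and> fst (N j (fst p) (snd p) q) = 0}" for j p q r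
    proof -
      have "snd p \<in> {a..b}" using that cd by (auto simp: mem_Times_iff)
      then show ?thesis using that by (simp add: seq.lag_scale N_scale)
    qed
    show "compact ({0..1::real} \<times> {c, d})" by (intro compact_Times compact_Icc finite_imp_compact) simp
  next
    fix r p p\<^sub>0 q q\<^sub>0 assume r: "filterlim r at_top sequentially" and p\<^sub>0: "p\<^sub>0 \<in> {0..1} \<times> {c, d}"
      and p: "p \<longlonglongrightarrow> p\<^sub>0" "\<And>i. p i \<in> {0..1} \<times> {c, d}"
      and q: "\<And>i. q i \<in> {q. p i \<in> {0..1} \<times> {c, d} \<and> q \<in> seq.lag\<^sub>0 (r i) \<and> fst (N (r i) (fst (p i)) (snd (p i)) q) = 0}"
        "q \<longlonglongrightarrow> q\<^sub>0"
    have t': "snd (p i) \<in> {a..b}" for i using p(2)[of i] cd by (auto simp: mem_Times_iff)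
    have t\<^sub>0': "snd p\<^sub>0 \<in> {a..b}" using p\<^sub>0 cd by (auto simp: mem_Times_iff)
    have q': "\<And>i. q i \<in> seq.lag\<^sub>0 (r i)" "\<And>i. fst (N (r i) (fst (p i)) (snd (p i)) (q i)) = 0" using q(1) by simp_all
    from tendsto_fst[OF N_limit[OF r tendsto_fst[OF p(1)] tendsto_snd[OF p(1)] t' t\<^sub>0' q'(1) q(2)]]
    have "fst (limit.\<psi> (snd p\<^sub>0) q\<^sub>0) = 0"
      by (simp add: q'(2) LIMSEQ_const_iff std_map_def)
    moreover have "q\<^sub>0 \<in> limit.lag\<^sub>0" by (rule lag_limit[OF r q'(1) q(2)])
    moreover have "snd p\<^sub>0 = c \<or> snd p\<^sub>0 = d" using p\<^sub>0 by (auto simp: mem_Times_iff)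
    ultimately show "q\<^sub>0 = 0" using c[of q\<^sub>0] d[of q\<^sub>0] by metis
  qed
  from ev_inj ev_ends show ?thesis
  proof eventually_elim
    case (elim j)
    obtain F where F: "sympl_path a b F" and M: "lagrangian std_form (std_map (g j) ` seq.lag\<^sub>0 j)"
      and F': "\<forall>t q. F t (std_map (g j) q) = std_map (g j) (seq.\<psi> j t q)"
      and "\<forall>q. std_map (g j) q = 0 \<longrightarrow> q = 0"
      and "quadruple_maslov_index a b (g j) (R j) (P j) (S j) = maslov_index std_form ({0} \<times> UNIV) a b (seq.std_curve j)"
      by (rule seq.standard_model[of j])
    note F_eq = F'[rule_format]
    have zero: "std_map (g j) 0 = 0"
      by (rule linear_0[OF linear_std_map])
    have "curve_class std_form ({0} \<times> UNIV) c d (\<lambda>t. \<Phi> t ` std_map g' ` limit.lag\<^sub>0) =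
      curve_class std_form ({0} \<times> UNIV) c d (\<lambda>t. F t ` std_map (g j) ` seq.lag\<^sub>0 j)"
    proof (rule near_curves_homologous[OF \<Phi> F L M B])
      show "a \<le> c" "c \<le> d" "d \<le> b" using cd by auto
    next
      fix t v assume t: "t \<in> {c..d}" and v: "v \<in> std_map (g j) ` seq.lag\<^sub>0 j" and 0: "moving_proj B (\<Phi> t) (F t v) = 0"
      from v obtain q where q: "q \<in> seq.lag\<^sub>0 j" "v = std_map (g j) q" by blast
      have "N j 0 t q = 0" using 0 by (simp add: N_def \<pi>_def q(2) F_eq)
      then have "q = 0" using elim(1) t q(1) by blast
      then show "v = 0" using q(2) zero by simp
    next
      fix s t v assume s: "s \<in> {0..1}" and t: "t \<in> {c, d}" and v: "v \<in> std_map (g j) ` seq.lag\<^sub>0 j"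
        and 0: "fst (s *\<^sub>R F t v + (1 - s) *\<^sub>R moving_proj B (\<Phi> t) (F t v)) = 0"
      from v obtain q where q: "q \<in> seq.lag\<^sub>0 j" "v = std_map (g j) q" by blast
      have "fst (N j (fst (s, t)) (snd (s, t)) q) = 0" using 0 by (simp add: N_def \<pi>_def q(2) F_eq)
      moreover have "(s, t) \<in> {0..1} \<times> {c, d}" using s t by blast
      ultimately have "q = 0" using elim(2) q(1) by blast
      then show "v = 0" using q(2) zero by simp
    qed
    moreover have "\<Phi> t ` std_map g' ` limit.lag\<^sub>0 = limit.std_curve t"
      "F t ` std_map (g j) ` seq.lag\<^sub>0 j = seq.std_curve j t" for t
      by (simp_all add: image_image \<Phi>_eq F_eq)
    ultimately show ?case by simp
  qed
qed

end

lemma (in quadruple) index_on_subinterval: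
  assumes \<epsilon>: "0 < \<epsilon>" "a < c" "c < a + \<epsilon>" "c < d" "b - \<epsilon> < d" "d < b"
    and nc: "\<And>t q. t \<in> {a<..b} \<Longrightarrow> t < a + \<epsilon> \<or> b - \<epsilon> < t \<Longrightarrow> q \<in> lag\<^sub>0 \<Longrightarrow> fst (\<psi> t q) = 0 \<Longrightarrow> q = 0"
  shows "quadruple_maslov_index a b g R P S = maslov_index_rel std_form ({0} \<times> UNIV) c d std_curve"
proof -
  obtain \<Phi> where \<Phi>: "sympl_path a b \<Phi>" and L: "lagrangian std_form (std_map g ` lag\<^sub>0)"
    and \<Phi>': "\<forall>t q. \<Phi> t (std_map g q) = std_map g (\<psi> t q)" and "\<forall>q. std_map g q = 0 \<longrightarrow> q = 0"
    and idx: "quadruple_maslov_index a b g R P S = maslov_index std_form ({0} \<times> UNIV) a b std_curve"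
    by (rule standard_model)
  note \<Phi>_eq = \<Phi>'[rule_format]
  have "std_curve = (\<lambda>t. \<Phi> t ` std_map g ` lag\<^sub>0)" by (simp add: image_image \<Phi>_eq)
  then have cont: "continuous_map (top_of_set {a..b}) (lagr_grassmannian std_form) std_curve"
    using sympl_path_continuous[OF \<Phi> L] by simp
  have no: "std_curve t \<notin> maslov_cycle std_form ({0} \<times> UNIV)" if "t \<in> {a<..b}" "t < a + \<epsilon> \<or> b - \<epsilon> < t" for t
    using that by (intro not_in_cycle nc[OF that]) auto
  show ?thesis
    unfolding idx
  proof (rule maslov_index_eq_rel[OF cont])
    show "{t \<in> {a<..<b}. std_curve t \<in> maslov_cycle std_form ({0} \<times> UNIV)} \<subseteq> {c..d}"
    proof
      fix t assume t: "t \<in> {t \<in> {a<..<b}. std_curve t \<in> maslov_cycle std_form ({0} \<times> UNIV)}"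
      then have "\<not> (t < a + \<epsilon> \<or> b - \<epsilon> < t)" using no[of t] by auto
      then show "t \<in> {c..d}" using \<epsilon> by auto
    qed
    show "std_curve c \<notin> maslov_cycle std_form ({0} \<times> UNIV)" "std_curve d \<notin> maslov_cycle std_form ({0} \<times> UNIV)"
      by (rule no; use \<epsilon> in simp)+
  qed (use \<epsilon> in auto)
qed

theorem theorem5p2p1:
  fixes a b :: real and k :: nat
    and g :: "nat \<Rightarrow> (real^'n) \<Rightarrow>\<^sub>L (real^'n) \<Rightarrow>\<^sub>L real"
    and R :: "nat \<Rightarrow> real \<Rightarrow> (real^'n) \<Rightarrow>\<^sub>L (real^'n)"
    and P :: "nat \<Rightarrow> (real^'n) set"
    and S :: "nat \<Rightarrow> real^'n \<Rightarrow> real^'n \<Rightarrow> real"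
    and g' :: "(real^'n) \<Rightarrow>\<^sub>L (real^'n) \<Rightarrow>\<^sub>L real"
    and R' :: "real \<Rightarrow> (real^'n) \<Rightarrow>\<^sub>L (real^'n)"
    and P' :: "(real^'n) set"
    and S' :: "real^'n \<Rightarrow> real^'n \<Rightarrow> real"
  assumes "a < b"
    and "\<And>j. admissible_quadruple a b (g j) (R j) (P j) (S j)"
    and "admissible_quadruple a b g' R' P' S'"
    and "\<And>j. dim (P j) = k" and "dim P' = k"
    and "GB_tendsto k P S P' S'"
    and "g \<longlonglongrightarrow> g'"
    and "uniform_limit {a..b} R R' sequentially"
    and "\<not> PS_focal a b g' R' P' S' b"
  shows "\<forall>\<^sub>F j in sequentially.
    \<not> PS_focal a b (g j) (R j) (P j) (S j) b \<and>
    quadruple_maslov_index a b (g j) (R j) (P j) (S j) =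
      quadruple_maslov_index a b g' R' P' S'"
proof -
  interpret converging_quadruples a b g' R' P' S' k g R P S
    by unfold_locales (fact assms)+
  obtain \<epsilon> where "0 < \<epsilon>"
    and lim': "\<forall>t\<in>{a<..b}. t < a + \<epsilon> \<or> b - \<epsilon> < t \<longrightarrow> (\<forall>q\<in>limit.lag\<^sub>0. fst (limit.\<psi> t q) = 0 \<longrightarrow> q = 0)"
    and ev: "\<forall>\<^sub>F j in sequentially. \<forall>t\<in>{a<..b}. t < a + \<epsilon> \<or> b - \<epsilon> < t \<longrightarrow>
       (\<forall>q\<in>seq.lag\<^sub>0 j. fst (seq.\<psi> j t q) = 0 \<longrightarrow> q = 0)"
    by (rule common_noncrossing_ends[OF assms(9)])
  note lim = lim'[rule_format]
  \<comment> \<open>a third leaves room for \<open>c < d\<close>\<close>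
  define \<delta> where "\<delta> = min \<epsilon> (b - a) / 3"
  define c d where "c = a + \<delta>" and "d = b - \<delta>"
  have \<delta>: "0 < \<delta>" "\<delta> < \<epsilon>" "2 * \<delta> < b - a"
    using \<open>0 < \<epsilon>\<close> \<open>a < b\<close> by (auto simp: \<delta>_def min_def)
  then have cd: "a < c" "c < a + \<epsilon>" "c < d" "b - \<epsilon> < d" "d < b"
    by (auto simp: c_def d_def)
  have "\<forall>\<^sub>F j in sequentially. curve_class std_form ({0} \<times> UNIV) c d (seq.std_curve j) =
    curve_class std_form ({0} \<times> UNIV) c d limit.std_curve"
  proof (rule curve_class_eventually_eq)
    show "q = 0" if "q \<in> limit.lag\<^sub>0" "fst (limit.\<psi> c q) = 0" for q
      by (rule lim[OF _ _ that]) (use cd in auto)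
    show "q = 0" if "q \<in> limit.lag\<^sub>0" "fst (limit.\<psi> d q) = 0" for q
      by (rule lim[OF _ _ that]) (use cd in auto)
  qed (use cd in auto)
  with ev show ?thesis
  proof eventually_elim
    case (elim j)
    have nc: "q = 0" if "t \<in> {a<..b}" "t < a + \<epsilon> \<or> b - \<epsilon> < t" "q \<in> seq.lag\<^sub>0 j" "fst (seq.\<psi> j t q) = 0" for t q
      using elim(1) that by blast
    have "b \<in> {a<..b}" "b < a + \<epsilon> \<or> b - \<epsilon> < b" using \<open>a < b\<close> \<open>0 < \<epsilon>\<close> by auto
    then have "\<not> PS_focal a b (g j) (R j) (P j) (S j) b"
      using nc unfolding seq.focal_iff by blast
    moreover have "quadruple_maslov_index a b (g j) (R j) (P j) (S j) =
      maslov_index_rel std_form ({0} \<times> UNIV) c d (seq.std_curve j)"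
      by (rule seq.index_on_subinterval[OF \<open>0 < \<epsilon>\<close> cd nc])
    moreover have "quadruple_maslov_index a b g' R' P' S' = maslov_index_rel std_form ({0} \<times> UNIV) c d limit.std_curve"
      by (rule limit.index_on_subinterval[OF \<open>0 < \<epsilon>\<close> cd lim])
    ultimately show ?case using elim(2) by (simp add: maslov_index_rel_def)
  qed
qed

end
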